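(* Let $\mathcal X,\mathcal U,\mathcal Y$ be (possibly infinite-dimensional) complex Hilbert spaces and let $\Sigma$ be the linear system with bounded system operators $A\in\mathcal L(\mathcal X)$, $B\in\mathcal L(\mathcal U,\mathcal X)$, $C\in\mathcal L(\mathcal X,\mathcal Y)$, $D\in\mathcal L(\mathcal U,\mathcal Y)$. Assume that $\Sigma$ has a dichotomy and is dichotomously $\ell^2$-exactly controllable and dichotomously $\ell^2$-exactly observable. Then the following are equivalent: (1) $\|F_\Sigma\|_{\infty,\mathbb T}:=\sup_{z\in\mathbb T}\|F_\Sigma(z)\|\le1$, where $F_\Sigma(z)=D+zC(I-zA)^{-1}B$. (2) There is a bounded and boundedly invertible selfadjoint operator $H$ on $\mathcal X$ which satisfies the KYP-inequality $$\begin{bmatrix} A & B \\ C & D \end{bmatrix}^*\begin{bmatrix} H & 0 \\ 0 & I_{\mathcal Y} \end{bmatrix}\begin{bmatrix} A & B \\ C & D \end{bmatrix}\preceq\begin{bmatrix} H & 0 \\ 0 & I_{\mathcal U} \end{bmatrix}.$$ Moreover, the dimension of the spectral subspace of $A$ over the unit disk (respectively, exterior of the closed unit disk) agrees with the dimension of the spectral subspace of $H$ over the positive real line (respectively, over the negative real line).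
   Context: $X\preceq Y$ means $Y-X$ is positive-semidefinite. The system is $\mathbf x(n+1)=A\mathbf x(n)+B\mathbf u(n)$, $\mathbf y(n)=C\mathbf x(n)+D\mathbf u(n)$ ($n\in\mathbb Z$). It has a dichotomy if $\sigma(A)\cap\mathbb T=\emptyset$, where $\mathbb T$ is the unit circle. Then $\mathcal X=\mathcal X_-\dot+\mathcal X_+$ (direct, not necessarily orthogonal), where $\mathcal X_+$ and $\mathcal X_-$ are the (Riesz) spectral subspaces of $A$ over the open unit disk and over the exterior of the closed unit disk. Put $A_\pm=A|_{\mathcal X_\pm}$ (so $A_+$ and $A_-^{-1}$ have spectrum in the open unit disk), $B=\begin{bmatrix} B_- \\ B_+ \end{bmatrix}$, $C=\begin{bmatrix} C_- & C_+ \end{bmatrix}$ accordingly. Let $\mathbb Z_+=\{0,1,2,\dots\}$, $\mathbb Z_-=\{-1,-2,\dots\}$, and define the bounded operators $\mathbf W_c^+=\operatorname{row}_{j<0}[A_+^{-j-1}B_+]:\ell^2_{\mathcal U}(\mathbb Z_-)\to\mathcal X_+$, $\mathbf W_c^-=\operatorname{row}_{j\ge0}[-A_-^{-j-1}B_-]:\ell^2_{\mathcal U}(\mathbb Z_+)\to\mathcal X_-$, $\mathbf W_o^+=\operatorname{col}_{i\ge0}[C_+A_+^i]:\mathcal X_+\to\ell^2_{\mathcal Y}(\mathbb Z_+)$, $\mathbf W_o^-=\operatorname{col}_{i<0}[-C_-A_-^i]:\mathcal X_-\to\ell^2_{\mathcal Y}(\mathbb Z_-)$. $\Sigma$ is dichotomously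 $\ell^2$-exactly controllable if $\mathbf W_c^+$ and $\mathbf W_c^-$ are surjective (equivalently, $\mathbf W_c=[\mathbf W_c^+\ \mathbf W_c^-]$ maps onto $\mathcal X$), and dichotomously $\ell^2$-exactly observable if $(\mathbf W_o^+)^*:\ell^2_{\mathcal Y}(\mathbb Z_+)\to\mathcal X_+$ and $(\mathbf W_o^-)^*:\ell^2_{\mathcal Y}(\mathbb Z_-)\to\mathcal X_-$ are surjective. The spectral subspace of the selfadjoint operator $H$ over a Borel set is the range of the corresponding spectral projection. *)

theory Defs
  imports "HOL-Analysis.Analysis"
begin

section \<open>Complex Hilbert spaces and bounded operators\<close>

text \<open>The inner product is linear in its first argument. Completeness is inherited from
  \<^class>\<open>banach\<close>; positive definiteness follows from the last axiom.\<close>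

class complex_hilbert = banach +
  fixes scaleC :: "complex \<Rightarrow> 'a \<Rightarrow> 'a" (infixr "*\<^sub>C" 75)
    and cinner :: "'a \<Rightarrow> 'a \<Rightarrow> complex"
  assumes scaleC_add_right: "c *\<^sub>C (x + y) = c *\<^sub>C x + c *\<^sub>C y"
    and scaleC_add_left: "(c + d) *\<^sub>C x = c *\<^sub>C x + d *\<^sub>C x"
    and scaleC_scaleC: "c *\<^sub>C d *\<^sub>C x = (c * d) *\<^sub>C x"
    and scaleR_scaleC: "r *\<^sub>R x = complex_of_real r *\<^sub>C x"
    and cinner_commute: "cinner x y = cnj (cinner y x)"
    and cinner_add_left: "cinner (x + y) z = cinner x z + cinner y z"
    and cinner_scaleC_left: "cinner (c *\<^sub>C x) y = c * cinner x y"
    and cinner_self: "cinner x x = complex_of_real ((norm x)\<^sup>2)"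

instantiation complex :: complex_hilbert
begin

definition scaleC_complex :: "complex \<Rightarrow> complex \<Rightarrow> complex"
  where "scaleC_complex c x = c * x"

definition cinner_complex :: "complex \<Rightarrow> complex \<Rightarrow> complex"
  where "cinner_complex x y = x * cnj y"

instance
  by standard
    (simp_all add: scaleC_complex_def cinner_complex_def algebra_simps scaleR_conv_of_real
      complex_mult_cnj cmod_power2)

end

text \<open>The Hilbert space direct sum; the library norm on products is the Euclidean one.\<close>

instantiation prod :: (complex_hilbert, complex_hilbert) complex_hilbert
begin

definition scaleC_prod :: "complex \<Rightarrow> 'a \<times> 'b \<Rightarrow> 'a \<times> 'b"
  where "scaleC_prod c x = (c *\<^sub>C fst x, c *\<^sub>C snd x)"

definition cinner_prod :: "'a \<times> 'b \<Rightarrow> 'a \<times> 'b \<Rightarrow> complex"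
  where "cinner_prod x y = cinner (fst x) (fst y) + cinner (snd x) (snd y)"

instance
proof
  fix c d :: complex and r :: real and x y z :: "'a \<times> 'b"
  show "c *\<^sub>C (x + y) = c *\<^sub>C x + c *\<^sub>C y"
    by (simp add: scaleC_prod_def scaleC_add_right)
  show "(c + d) *\<^sub>C x = c *\<^sub>C x + d *\<^sub>C x"
    by (simp add: scaleC_prod_def scaleC_add_left)
  show "c *\<^sub>C d *\<^sub>C x = (c * d) *\<^sub>C x"
    by (simp add: scaleC_prod_def scaleC_scaleC)
  show "r *\<^sub>R x = complex_of_real r *\<^sub>C x"
    by (simp add: scaleC_prod_def scaleR_prod_def scaleR_scaleC)
  show "cinner x y = cnj (cinner y x)"
    by (simp add: cinner_prod_def cinner_commute[of "fst x"] cinner_commute[of "snd x"])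
  show "cinner (x + y) z = cinner x z + cinner y z"
    by (simp add: cinner_prod_def cinner_add_left)
  show "cinner (c *\<^sub>C x) y = c * cinner x y"
    by (simp add: cinner_prod_def scaleC_prod_def cinner_scaleC_left algebra_simps)
  show "cinner x x = complex_of_real ((norm x)\<^sup>2)"
    by (simp add: cinner_prod_def cinner_self norm_prod_def)
qed

end

definition bounded_clinear :: "('a::complex_hilbert \<Rightarrow> 'b::complex_hilbert) \<Rightarrow> bool"
  where "bounded_clinear T \<longleftrightarrow> bounded_linear T \<and> (\<forall>c x. T (c *\<^sub>C x) = c *\<^sub>C T x)"

definition boundedly_invertible :: "('a::complex_hilbert \<Rightarrow> 'b::complex_hilbert) \<Rightarrow> bool"
  where "boundedly_invertible T \<longleftrightarrow>
    bounded_clinear T \<and> (\<exists>R. bounded_clinear R \<and> R \<circ> T = id \<and> T \<circ> R = id)"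

text \<open>Hilbert space adjoint of \<open>T\<close> from the Hilbert space with carrier \<open>S\<close> and inner product
  \<open>ipS\<close> to a Hilbert space with inner product \<open>ipT\<close>. Carriers are needed because the
  spectral subspaces and the sequence spaces below are not types.\<close>

definition adjoint_on ::
  "'a set \<Rightarrow> ('a \<Rightarrow> 'a \<Rightarrow> complex) \<Rightarrow> ('b \<Rightarrow> 'b \<Rightarrow> complex) \<Rightarrow> ('a \<Rightarrow> 'b) \<Rightarrow> 'b \<Rightarrow> 'a"
  where "adjoint_on S ipS ipT T y = (THE x. x \<in> S \<and> (\<forall>v\<in>S. ipT (T v) y = ipS v x))"

definition hadj :: "('a::complex_hilbert \<Rightarrow> 'b::complex_hilbert) \<Rightarrow> 'b \<Rightarrow> 'a"
  where "hadj T = adjoint_on UNIV cinner cinner T"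

definition selfadjoint :: "('a::complex_hilbert \<Rightarrow> 'a) \<Rightarrow> bool"
  where "selfadjoint T \<longleftrightarrow> bounded_clinear T \<and> hadj T = T"

definition positive_semidefinite :: "('a::complex_hilbert \<Rightarrow> 'a) \<Rightarrow> bool"
  where "positive_semidefinite T \<longleftrightarrow> selfadjoint T \<and> (\<forall>x. 0 \<le> Re (cinner (T x) x))"

definition loewner_le :: "('a::complex_hilbert \<Rightarrow> 'a) \<Rightarrow> ('a \<Rightarrow> 'a) \<Rightarrow> bool"
  where "loewner_le S T \<longleftrightarrow> positive_semidefinite (\<lambda>x. T x - S x)"

definition op_spectrum :: "('a::complex_hilbert \<Rightarrow> 'a) \<Rightarrow> complex set"
  where "op_spectrum T = {\<mu>. \<not> boundedly_invertible (\<lambda>x. \<mu> *\<^sub>C x - T x)}"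


section \<open>Hilbert space dimension\<close>

text \<open>An orthonormal basis of a closed subspace \<open>S\<close>: an orthonormal subset of \<open>S\<close> that is
  complete in \<open>S\<close>.\<close>

definition orthonormal_basis_of :: "'a::complex_hilbert set \<Rightarrow> 'a set \<Rightarrow> bool"
  where "orthonormal_basis_of S E \<longleftrightarrow>
    E \<subseteq> S \<and>
    (\<forall>e\<in>E. \<forall>f\<in>E. cinner e f = (if e = f then 1 else 0)) \<and>
    (\<forall>x\<in>S. (\<forall>e\<in>E. cinner x e = 0) \<longrightarrow> x = 0)"

text \<open>The dimension is a cardinal, and all orthonormal bases have the same one. As usual in
  HOL, cardinals are well-orders, to be compared up to \<^const>\<open>ordIso\<close>.\<close>

definition hilbert_dim :: "'a::complex_hilbert set \<Rightarrow> 'a rel"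
  where "hilbert_dim S = card_of (SOME E. orthonormal_basis_of S E)"


section \<open>Spectral projections of selfadjoint operators\<close>

definition orthogonal_projection :: "('a::complex_hilbert \<Rightarrow> 'a) \<Rightarrow> bool"
  where "orthogonal_projection P \<longleftrightarrow> selfadjoint P \<and> P \<circ> P = P"

definition scalar_measure ::
  "(real set \<Rightarrow> 'a::complex_hilbert \<Rightarrow> 'a) \<Rightarrow> 'a \<Rightarrow> real measure"
  where "scalar_measure E x = measure_of UNIV (sets borel) (\<lambda>S. ennreal (Re (cinner (E S x) x)))"

text \<open>\<open>E\<close> is a projection-valued Borel measure (countably additive in the strong operator
  topology) with bounded support, and \<open>H\<close> is the integral of the identity function against
  \<open>E\<close>. Vanishing on the empty set and multiplicativity of \<open>E\<close> follow from countable
  additivity; by polarization the quadratic form determines \<open>H\<close>.\<close>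

definition spectral_measure_of ::
  "('a::complex_hilbert \<Rightarrow> 'a) \<Rightarrow> (real set \<Rightarrow> 'a \<Rightarrow> 'a) \<Rightarrow> bool"
  where "spectral_measure_of H E \<longleftrightarrow>
    (\<forall>S\<in>sets borel. orthogonal_projection (E S)) \<and>
    E UNIV = id \<and>
    (\<forall>F::nat \<Rightarrow> real set. range F \<subseteq> sets borel \<longrightarrow> disjoint_family F \<longrightarrow>
      (\<forall>x. (\<lambda>n. E (F n) x) sums E (\<Union>n. F n) x)) \<and>
    (\<exists>r. E {-r..r} = id) \<and>
    (\<forall>x. cinner (H x) x = complex_of_real (\<integral>t. t \<partial>scalar_measure E x))"

text \<open>The spectral measure of a bounded selfadjoint operator exists and is unique on Borel sets,
  so for Borel \<open>S\<close> the value below does not depend on the choice.\<close>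

definition spectral_projection :: "('a::complex_hilbert \<Rightarrow> 'a) \<Rightarrow> real set \<Rightarrow> 'a \<Rightarrow> 'a"
  where "spectral_projection H S = (SOME E. spectral_measure_of H E) S"

definition spectral_subspace :: "('a::complex_hilbert \<Rightarrow> 'a) \<Rightarrow> real set \<Rightarrow> 'a set"
  where "spectral_subspace H S = range (spectral_projection H S)"


section \<open>Dichotomy and Riesz spectral subspaces\<close>

definition has_dichotomy :: "('x::complex_hilbert \<Rightarrow> 'x) \<Rightarrow> bool"
  where "has_dichotomy A \<longleftrightarrow> op_spectrum A \<inter> sphere 0 1 = {}"

text \<open>The Riesz projection \<open>(1 / (2 \<pi> \<i>)) \<ointegral> (\<zeta> I - A)\<^sup>-\<^sup>1 d\<zeta>\<close> over the positively oriented
  unit circle, applied to a vector, with the parametrization \<open>\<zeta> = cis t\<close>,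
  \<open>d\<zeta> = \<i> cis t dt\<close>.\<close>

definition riesz_projection :: "('x::complex_hilbert \<Rightarrow> 'x) \<Rightarrow> 'x \<Rightarrow> 'x"
  where "riesz_projection A x =
    (1 / (2 * complex_of_real pi * \<i>)) *\<^sub>C
      integral {0..2 * pi} (\<lambda>t. (\<i> * cis t) *\<^sub>C inv (\<lambda>v. cis t *\<^sub>C v - A v) x)"

text \<open>Under a dichotomy the complementary projection is the Riesz projection for the part of
  the spectrum outside the closed unit disk.\<close>

definition proj_plus :: "('x::complex_hilbert \<Rightarrow> 'x) \<Rightarrow> 'x \<Rightarrow> 'x"
  where "proj_plus A = riesz_projection A"

definition proj_minus :: "('x::complex_hilbert \<Rightarrow> 'x) \<Rightarrow> 'x \<Rightarrow> 'x"
  where "proj_minus A x = x - riesz_projection A x"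

definition X_plus :: "('x::complex_hilbert \<Rightarrow> 'x) \<Rightarrow> 'x set"
  where "X_plus A = range (proj_plus A)"

definition X_minus :: "('x::complex_hilbert \<Rightarrow> 'x) \<Rightarrow> 'x set"
  where "X_minus A = range (proj_minus A)"

text \<open>Integer powers of the restriction of \<open>A\<close> to the invariant subspace \<open>S\<close>; negative powers
  are those of the inverse of \<open>A\<close> restricted to \<open>S\<close>.\<close>

definition restr_power :: "'x set \<Rightarrow> ('x \<Rightarrow> 'x) \<Rightarrow> int \<Rightarrow> 'x \<Rightarrow> 'x"
  where "restr_power S A k =
    (if k \<ge> 0 then A ^^ nat k else inv_into S A ^^ nat (- k))"


section \<open>Controllability and observability\<close>

text \<open>The space of square summable sequences over an index set \<open>I\<close>, realized as sequences on
  all integers that vanish off \<open>I\<close>.\<close>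

definition ell2 :: "int set \<Rightarrow> (int \<Rightarrow> 'a::complex_hilbert) set"
  where "ell2 I = {u. (\<forall>i. i \<notin> I \<longrightarrow> u i = 0) \<and> (\<lambda>i. (norm (u i))\<^sup>2) summable_on I}"

definition ell2_inner ::
  "int set \<Rightarrow> (int \<Rightarrow> 'a::complex_hilbert) \<Rightarrow> (int \<Rightarrow> 'a) \<Rightarrow> complex"
  where "ell2_inner I u v = (\<Sum>\<^sub>\<infinity>i\<in>I. cinner (u i) (v i))"

text \<open>With respect to the decomposition of the state space, the components of \<open>B\<close> are
  \<open>proj_plus A \<circ> B\<close> and \<open>proj_minus A \<circ> B\<close>, and those of \<open>C\<close> are its restrictions.\<close>

definition Wc_plus ::
  "('x::complex_hilbert \<Rightarrow> 'x) \<Rightarrow> ('u::complex_hilbert \<Rightarrow> 'x) \<Rightarrow> (int \<Rightarrow> 'u) \<Rightarrow> 'x"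
  where "Wc_plus A B u =
    (\<Sum>\<^sub>\<infinity>j\<in>{..<0}. restr_power (X_plus A) A (- j - 1) (proj_plus A (B (u j))))"

definition Wc_minus ::
  "('x::complex_hilbert \<Rightarrow> 'x) \<Rightarrow> ('u::complex_hilbert \<Rightarrow> 'x) \<Rightarrow> (int \<Rightarrow> 'u) \<Rightarrow> 'x"
  where "Wc_minus A B u =
    (\<Sum>\<^sub>\<infinity>j\<in>{0..}. - restr_power (X_minus A) A (- j - 1) (proj_minus A (B (u j))))"

definition Wo_plus ::
  "('x::complex_hilbert \<Rightarrow> 'x) \<Rightarrow> ('x \<Rightarrow> 'y::complex_hilbert) \<Rightarrow> 'x \<Rightarrow> int \<Rightarrow> 'y"
  where "Wo_plus A C x i = (if i \<ge> 0 then C (restr_power (X_plus A) A i x) else 0)"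

definition Wo_minus ::
  "('x::complex_hilbert \<Rightarrow> 'x) \<Rightarrow> ('x \<Rightarrow> 'y::complex_hilbert) \<Rightarrow> 'x \<Rightarrow> int \<Rightarrow> 'y"
  where "Wo_minus A C x i = (if i < 0 then - C (restr_power (X_minus A) A i x) else 0)"

definition dichotomously_exactly_controllable ::
  "('x::complex_hilbert \<Rightarrow> 'x) \<Rightarrow> ('u::complex_hilbert \<Rightarrow> 'x) \<Rightarrow> bool"
  where "dichotomously_exactly_controllable A B \<longleftrightarrow>
    Wc_plus A B ` ell2 {..<0} = X_plus A \<and>
    Wc_minus A B ` ell2 {0..} = X_minus A"

definition dichotomously_exactly_observable ::
  "('x::complex_hilbert \<Rightarrow> 'x) \<Rightarrow> ('x \<Rightarrow> 'y::complex_hilbert) \<Rightarrow> bool"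
  where "dichotomously_exactly_observable A C \<longleftrightarrow>
    adjoint_on (X_plus A) cinner (ell2_inner {0..}) (Wo_plus A C) ` ell2 {0..} = X_plus A \<and>
    adjoint_on (X_minus A) cinner (ell2_inner {..<0}) (Wo_minus A C) ` ell2 {..<0} = X_minus A"


section \<open>Transfer function and KYP inequality\<close>

definition transfer_function ::
  "('x::complex_hilbert \<Rightarrow> 'x) \<Rightarrow> ('u::complex_hilbert \<Rightarrow> 'x) \<Rightarrow>
   ('x \<Rightarrow> 'y::complex_hilbert) \<Rightarrow> ('u \<Rightarrow> 'y) \<Rightarrow> complex \<Rightarrow> 'u \<Rightarrow> 'y"
  where "transfer_function A B C D z u = D u + z *\<^sub>C C (inv (\<lambda>x. x - z *\<^sub>C A x) (B u))"

definition transfer_norm ::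
  "('x::complex_hilbert \<Rightarrow> 'x) \<Rightarrow> ('u::complex_hilbert \<Rightarrow> 'x) \<Rightarrow>
   ('x \<Rightarrow> 'y::complex_hilbert) \<Rightarrow> ('u \<Rightarrow> 'y) \<Rightarrow> ereal"
  where "transfer_norm A B C D = (SUP z\<in>sphere 0 1. ereal (onorm (transfer_function A B C D z)))"

definition block_op ::
  "('a \<Rightarrow> 'c::plus) \<Rightarrow> ('b \<Rightarrow> 'c) \<Rightarrow> ('a \<Rightarrow> 'd::plus) \<Rightarrow> ('b \<Rightarrow> 'd) \<Rightarrow> 'a \<times> 'b \<Rightarrow> 'c \<times> 'd"
  where "block_op A B C D = (\<lambda>(x, u). (A x + B u, C x + D u))"

definition KYP_inequality ::
  "('x::complex_hilbert \<Rightarrow> 'x) \<Rightarrow> ('u::complex_hilbert \<Rightarrow> 'x) \<Rightarrow>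
   ('x \<Rightarrow> 'y::complex_hilbert) \<Rightarrow> ('u \<Rightarrow> 'y) \<Rightarrow> ('x \<Rightarrow> 'x) \<Rightarrow> bool"
  where "KYP_inequality A B C D H \<longleftrightarrow>
    loewner_le
      (hadj (block_op A B C D) \<circ> block_op H (\<lambda>_. 0) (\<lambda>_. 0) id \<circ> block_op A B C D)
      (block_op H (\<lambda>_. 0) (\<lambda>_. 0) id)"

end

theory Submission
  imports Defs "HOL-Probability.Helly_Selection" "HOL-Probability.Probability_Mass_Function"
begin

text \<open>Call a solution of the system on all of \<open>\<int>\<close> with square summable input and bounded state a
  trajectory; the dichotomy makes the state unique, and trajectories that agree at one time can be
  concatenated there. If the transfer function is contractive, every trajectory has output energy
  at most its input energy (Fourier multipliers on the \<open>N\<close>-th roots of unity, \<open>N \<rightarrow> \<infinity>\<close>). Hence the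
  available storage, the supremum of the net energy \<open>\<parallel>y\<parallel>\<^sup>2 - \<parallel>u\<parallel>\<^sup>2\<close> that can be extracted over
  nonnegative times, is finite and, by exact controllability, bounded by a multiple of \<open>\<parallel>x\<parallel>\<^sup>2\<close>.
  As a supremum of a quadratic form over the fibres of a linear map it satisfies the parallelogram
  law, so it is the form of a selfadjoint \<open>H\<close>; concatenation gives the KYP inequality. Conversely,
  along \<open>x(n) = z\<^sup>-\<^sup>n x(0)\<close> the \<open>H\<close>-terms of the KYP inequality cancel.

  By exact observability, any solution \<open>H\<close> of the KYP inequality is uniformly positive on the stable
  and uniformly negative on the unstable subspace. So \<open>H\<close> is invertible, and the spectral projections
  of \<open>H\<close> and the Riesz projections restrict to injections between the spectral subspaces of \<open>A\<close> and
  \<open>H\<close> in both directions, which compares the dimensions.\<close>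

section \<open>Bounded operators on Hilbert spaces\<close>

text \<open>The Riesz projection enters only through the Fourier coefficients of the resolvent on
  the circle. Multiplication by \<open>A\<close> shifts their index, and one integration by parts
  gives decay of order 1/n. These two facts yield idempotence, and the semigroup law then improves
  the decay to an exponential rate. That rate absorbs the linear growth in the crude bounds for
  periodic trajectories, so discrete Fourier sums can stand in for vector-valued integrals.
  Surjectivity has to become a quantitative estimate twice, for steering and for observation.
  Zabreiko's lemma is therefore phrased for a relation between vectors and costs, which suits both.
  \<open>spectral_projection\<close> and \<open>hilbert_dim\<close> are chosen by
  \<open>SOME\<close>, so nothing can be said about inertia before spectral measures and orthonormal
  bases are known to exist. The spectral measure is built from moments: a polynomial calculus for an
  operator between 0 and I gives a scalar measure for each vector, and projections are mean square
  limits of polynomials. Dimensions are cardinals, so injections in both directions suffice.\<close>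

lemma scaleC_zero_right [simp]: "c *\<^sub>C (0::'a::complex_hilbert) = 0"
  using scaleC_add_right[of c 0 "0::'a"] by simp

lemma scaleC_zero_left [simp]: "0 *\<^sub>C (x::'a::complex_hilbert) = 0"
  using scaleC_add_left[of 0 0 x] by simp

lemma scaleC_one [simp]: "1 *\<^sub>C (x::'a::complex_hilbert) = x"
  using scaleR_scaleC[of 1 x] by simp

lemma scaleC_minus_right [simp]: "c *\<^sub>C (- (x::'a::complex_hilbert)) = - (c *\<^sub>C x)"
  using scaleC_add_right[of c x "-x"] by (simp add: eq_neg_iff_add_eq_0 add.commute)

lemma scaleC_minus_left [simp]: "(- c) *\<^sub>C (x::'a::complex_hilbert) = - (c *\<^sub>C x)"
  using scaleC_add_left[of c "-c" x] by (simp add: eq_neg_iff_add_eq_0 add.commute)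

lemma scaleC_diff_right: "c *\<^sub>C ((x::'a::complex_hilbert) - y) = c *\<^sub>C x - c *\<^sub>C y"
  using scaleC_add_right[of c x "-y"] by simp

lemma scaleC_diff_left: "(c - d) *\<^sub>C (x::'a::complex_hilbert) = c *\<^sub>C x - d *\<^sub>C x"
  using scaleC_add_left[of c "-d" x] by simp

lemma scaleC_sum_right: "c *\<^sub>C (\<Sum>i\<in>I. f i :: 'a::complex_hilbert) = (\<Sum>i\<in>I. c *\<^sub>C f i)"
  by (induction I rule: infinite_finite_induct) (auto simp: scaleC_add_right)

lemma scaleC_sum_left: "(\<Sum>i\<in>I. f i) *\<^sub>C (x :: 'a::complex_hilbert) = (\<Sum>i\<in>I. f i *\<^sub>C x)"
  by (induction I rule: infinite_finite_induct) (auto simp: scaleC_add_left)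

lemma cinner_add_right: "cinner x (y + z) = cinner x y + cinner x (z::'a::complex_hilbert)"
  by (metis cinner_add_left cinner_commute complex_cnj_add)

lemma cinner_scaleC_right: "cinner x (c *\<^sub>C y) = cnj c * cinner x (y::'a::complex_hilbert)"
  by (metis cinner_commute cinner_scaleC_left complex_cnj_mult)

lemma cinner_zero_left [simp]: "cinner 0 (x::'a::complex_hilbert) = 0"
  using cinner_add_left[of 0 0 x] by simp

lemma cinner_zero_right [simp]: "cinner (x::'a::complex_hilbert) 0 = 0"
  using cinner_add_right[of x 0 0] by simp

lemma cinner_minus_left [simp]: "cinner (- x) (y::'a::complex_hilbert) = - cinner x y"
  using cinner_add_left[of x "-x" y] by (simp add: eq_neg_iff_add_eq_0 add.commute)

lemma cinner_minus_right [simp]: "cinner x (- (y::'a::complex_hilbert)) = - cinner x y"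
  using cinner_add_right[of x y "-y"] by (simp add: eq_neg_iff_add_eq_0 add.commute)

lemma cinner_diff_left: "cinner (x - y) (z::'a::complex_hilbert) = cinner x z - cinner y z"
  using cinner_add_left[of x "-y" z] by simp

lemma cinner_diff_right: "cinner x (y - (z::'a::complex_hilbert)) = cinner x y - cinner x z"
  using cinner_add_right[of x y "-z"] by simp

lemma cinner_scaleR_left: "cinner (r *\<^sub>R x) (y::'a::complex_hilbert) = of_real r * cinner x y"
  by (simp add: scaleR_scaleC cinner_scaleC_left)

lemma cinner_scaleR_right: "cinner x (r *\<^sub>R (y::'a::complex_hilbert)) = of_real r * cinner x y"
  by (simp add: scaleR_scaleC cinner_scaleC_right)

lemma cinner_sum_left: "cinner (\<Sum>i\<in>I. f i) (y::'a::complex_hilbert) = (\<Sum>i\<in>I. cinner (f i) y)"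
  by (induction I rule: infinite_finite_induct) (auto simp: cinner_add_left)

lemma cinner_sum_right: "cinner y (\<Sum>i\<in>I. f i :: 'a::complex_hilbert) = (\<Sum>i\<in>I. cinner y (f i))"
  by (induction I rule: infinite_finite_induct) (auto simp: cinner_add_right)

lemma norm_sq_eq_cinner: "(norm (x::'a::complex_hilbert))\<^sup>2 = Re (cinner x x)"
  by (simp add: cinner_self)

lemma cinner_eq_zero_iff [simp]: "cinner x x = 0 \<longleftrightarrow> (x::'a::complex_hilbert) = 0"
  by (simp add: cinner_self)

lemma Re_cinner_commute: "Re (cinner x (y::'a::complex_hilbert)) = Re (cinner y x)"
  by (subst cinner_commute) simp

lemma norm_scaleC [simp]: "norm (c *\<^sub>C (x::'a::complex_hilbert)) = cmod c * norm x"
proof -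
  have "complex_of_real ((norm (c *\<^sub>C x))\<^sup>2) = c * cnj c * complex_of_real ((norm x)\<^sup>2)"
    unfolding cinner_self[symmetric] by (simp add: cinner_scaleC_left cinner_scaleC_right)
  also have "\<dots> = complex_of_real ((cmod c * norm x)\<^sup>2)"
    by (simp only: complex_norm_square[symmetric] of_real_mult[symmetric] of_real_power[symmetric] power_mult_distrib)
  finally have "(norm (c *\<^sub>C x))\<^sup>2 = (cmod c * norm x)\<^sup>2"
    by (simp only: of_real_eq_iff)
  then show ?thesis by (simp add: power2_eq_iff_nonneg)
qed

lemma norm_add_sq: "(norm (x + y))\<^sup>2 = (norm x)\<^sup>2 + (norm y)\<^sup>2 + 2 * Re (cinner x (y::'a::complex_hilbert))"
  by (simp add: norm_sq_eq_cinner cinner_add_left cinner_add_right Re_cinner_commute[of y x])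

lemma norm_diff_sq: "(norm (x - y))\<^sup>2 = (norm x)\<^sup>2 + (norm y)\<^sup>2 - 2 * Re (cinner x (y::'a::complex_hilbert))"
  using norm_add_sq[of x "-y"] by simp

lemma parallelogram_law:
  "(norm (x + y))\<^sup>2 + (norm (x - y))\<^sup>2 = 2 * (norm x)\<^sup>2 + 2 * (norm (y::'a::complex_hilbert))\<^sup>2"
  by (simp add: norm_add_sq norm_diff_sq)

lemma cinner_cauchy_schwarz: "cmod (cinner x (y::'a::complex_hilbert)) \<le> norm x * norm y"
proof (cases "y = 0")
  case False
  define c where "c = cinner x y / of_real ((norm y)\<^sup>2)"
  have n: "norm y > 0" using False by simp
  have "0 \<le> (norm (x - c *\<^sub>C y))\<^sup>2" by simp
  also have "\<dots> = (norm x)\<^sup>2 + (cmod c)\<^sup>2 * (norm y)\<^sup>2 - 2 * Re (cnj c * cinner x y)"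
    by (simp add: norm_diff_sq cinner_scaleC_right power_mult_distrib)
  also have "cnj c * cinner x y = of_real ((cmod (cinner x y))\<^sup>2 / (norm y)\<^sup>2)"
    unfolding c_def by (simp add: mult.commute flip: complex_norm_square)
  also have "(cmod c)\<^sup>2 * (norm y)\<^sup>2 = (cmod (cinner x y))\<^sup>2 / (norm y)\<^sup>2"
    using n by (simp add: c_def norm_divide power_divide norm_mult power2_eq_square)
  finally have "(cmod (cinner x y))\<^sup>2 / (norm y)\<^sup>2 \<le> (norm x)\<^sup>2" by simp
  then have "(cmod (cinner x y))\<^sup>2 \<le> (norm x * norm y)\<^sup>2"
    using n by (simp add: field_simps power_mult_distrib)
  then show ?thesis by (rule power2_le_imp_le) simp
qed simp

lemma Re_cinner_le: "Re (cinner x (y::'a::complex_hilbert)) \<le> norm x * norm y"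
  using cinner_cauchy_schwarz[of x y] complex_Re_le_cmod[of "cinner x y"] by linarith

lemma bounded_bilinear_cinner: "bounded_bilinear (cinner :: 'a::complex_hilbert \<Rightarrow> 'a \<Rightarrow> complex)"
proof
  show "\<exists>K. \<forall>a b::'a. norm (cinner a b) \<le> norm a * norm b * K"
    using cinner_cauchy_schwarz by (intro exI[of _ 1]) auto
qed (auto simp: cinner_add_left cinner_add_right cinner_scaleR_left cinner_scaleR_right scaleR_conv_of_real)

lemma bounded_bilinear_scaleC: "bounded_bilinear (scaleC :: complex \<Rightarrow> 'a::complex_hilbert \<Rightarrow> 'a)"
proof
  show "\<exists>K. \<forall>a. \<forall>b::'a. norm (a *\<^sub>C b) \<le> norm a * norm b * K"
    by (intro exI[of _ 1]) auto
qed (auto simp: scaleC_add_left scaleC_add_right scaleR_scaleC scaleC_scaleC mult.commute scaleC_complex_def)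

lemmas tendsto_cinner = bounded_bilinear.tendsto[OF bounded_bilinear_cinner]
lemmas tendsto_scaleC = bounded_bilinear.tendsto[OF bounded_bilinear_scaleC]

lemma cinner_extensionality:
  assumes "\<And>v. cinner v x = cinner v (y::'a::complex_hilbert)" shows "x = y"
proof -
  have "cinner (x - y) (x - y) = 0" using assms[of "x - y"] by (simp add: cinner_diff_right)
  then show ?thesis by simp
qed

section \<open>Bounded complex-linear operators\<close>

lemma bounded_clinear_bounded_linear: "bounded_clinear T \<Longrightarrow> bounded_linear T"
  and bounded_clinear_scaleC: "bounded_clinear T \<Longrightarrow> T (c *\<^sub>C x) = c *\<^sub>C T x"
  by (auto simp: bounded_clinear_def)

lemma bounded_clinear_add: "bounded_clinear T \<Longrightarrow> T (x + y) = T x + T y"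
  and bounded_clinear_diff: "bounded_clinear T \<Longrightarrow> T (x - y) = T x - T y"
  and bounded_clinear_minus: "bounded_clinear T \<Longrightarrow> T (- x) = - T x"
  and bounded_clinear_zero: "bounded_clinear T \<Longrightarrow> T 0 = 0"
  and bounded_clinear_scaleR: "bounded_clinear T \<Longrightarrow> T (r *\<^sub>R x) = r *\<^sub>R T x"
  and bounded_clinear_sum: "bounded_clinear T \<Longrightarrow> T (\<Sum>i\<in>I. f i) = (\<Sum>i\<in>I. T (f i))"
  by (auto simp: bounded_clinear_def linear_simps linear_sum bounded_linear.linear)

lemmas bounded_clinear_simps = bounded_clinear_add bounded_clinear_diff bounded_clinear_minus
  bounded_clinear_zero bounded_clinear_scaleR bounded_clinear_scaleC

lemma bounded_clinear_bound:
  assumes "bounded_clinear T" obtains K where "K > 0" "\<And>x. norm (T x) \<le> K * norm x"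
  using bounded_linear.pos_bounded[OF bounded_clinear_bounded_linear[OF assms]] by (metis mult.commute)

lemma bounded_clinearI:
  assumes "\<And>x y. T (x + y) = T x + T y" "\<And>c x. T (c *\<^sub>C x) = c *\<^sub>C T x"
    and "\<And>x. norm (T x) \<le> K * norm x"
  shows "bounded_clinear T"
  unfolding bounded_clinear_def
  by (auto intro!: bounded_linear_intro[where K = K] simp: assms scaleR_scaleC mult.commute)

lemma bounded_clinear_compose:
  assumes "bounded_clinear S" "bounded_clinear T" shows "bounded_clinear (\<lambda>x. S (T x))"
  using assms bounded_linear_compose[of S T] by (auto simp: bounded_clinear_def)

lemma bounded_clinear_ident [simp]: "bounded_clinear (\<lambda>x. x)" "bounded_clinear id"
  by (auto simp: bounded_clinear_def id_def)

lemma bounded_clinear_zero_op [simp]: "bounded_clinear (\<lambda>x. 0)"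
  by (auto simp: bounded_clinear_def)

lemma bounded_clinear_add_op:
  "bounded_clinear S \<Longrightarrow> bounded_clinear T \<Longrightarrow> bounded_clinear (\<lambda>x. S x + T x)"
  by (auto simp: bounded_clinear_def bounded_linear_add scaleC_add_right)

lemma bounded_clinear_minus_op:
  "bounded_clinear S \<Longrightarrow> bounded_clinear (\<lambda>x. - S x)"
  by (auto simp: bounded_clinear_def bounded_linear_minus)

lemma bounded_clinear_diff_op:
  "bounded_clinear S \<Longrightarrow> bounded_clinear T \<Longrightarrow> bounded_clinear (\<lambda>x. S x - T x)"
  by (auto simp: bounded_clinear_def bounded_linear_sub scaleC_diff_right)

lemma bounded_clinear_scaleC_op:
  "bounded_clinear S \<Longrightarrow> bounded_clinear (\<lambda>x. c *\<^sub>C S x)"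
  using bounded_linear_compose[OF bounded_bilinear.bounded_linear_right[OF bounded_bilinear_scaleC], of S c]
  by (auto simp: bounded_clinear_def scaleC_scaleC mult.commute scaleC_complex_def)

lemma bounded_clinear_scaleR_op:
  "bounded_clinear S \<Longrightarrow> bounded_clinear (\<lambda>x. r *\<^sub>R S x)"
  by (subst scaleR_scaleC) (rule bounded_clinear_scaleC_op)

lemma bounded_clinear_funpow:
  fixes T :: "'a::complex_hilbert \<Rightarrow> 'a" shows "bounded_clinear T \<Longrightarrow> bounded_clinear (T ^^ n)"
proof (induction n)
  case (Suc n)
  then show ?case using bounded_clinear_compose[of T "T ^^ n"] by (simp add: o_def)
qed simp

lemma bounded_clinear_fst [simp]: "bounded_clinear (fst :: 'a::complex_hilbert \<times> 'b::complex_hilbert \<Rightarrow> 'a)"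
  and bounded_clinear_snd [simp]: "bounded_clinear (snd :: 'a::complex_hilbert \<times> 'b::complex_hilbert \<Rightarrow> 'b)"
  by (auto simp: bounded_clinear_def scaleC_prod_def bounded_linear_fst bounded_linear_snd)

lemma bounded_clinear_Pair:
  "bounded_clinear S \<Longrightarrow> bounded_clinear T \<Longrightarrow> bounded_clinear (\<lambda>x. (S x, T x))"
  by (auto simp: bounded_clinear_def scaleC_prod_def bounded_linear_Pair)

section \<open>Complex subspaces, Riesz representation and adjoints\<close>

definition csubspace :: "'a::complex_hilbert set \<Rightarrow> bool" where
  "csubspace S \<longleftrightarrow> 0 \<in> S \<and> (\<forall>x\<in>S. \<forall>y\<in>S. x + y \<in> S) \<and> (\<forall>c. \<forall>x\<in>S. c *\<^sub>C x \<in> S)"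

lemma csubspace_sum: "csubspace S \<Longrightarrow> (\<And>i. i \<in> I \<Longrightarrow> f i \<in> S) \<Longrightarrow> (\<Sum>i\<in>I. f i) \<in> S"
  by (induction I rule: infinite_finite_induct) (auto simp: csubspace_def)

lemma csubspace_diff:
  assumes "csubspace S" "x \<in> S" "y \<in> S" shows "x - y \<in> S"
proof -
  have "(-1) *\<^sub>C y \<in> S" using assms unfolding csubspace_def by blast
  then have "x + (-1) *\<^sub>C y \<in> S" using assms unfolding csubspace_def by blast
  then show ?thesis by simp
qed

definition closed_csubspace :: "'a::complex_hilbert set \<Rightarrow> bool" where
  "closed_csubspace S \<longleftrightarrow> closed S \<and> csubspace S"

lemma closed_csubspace_scaleR: "closed_csubspace S \<Longrightarrow> x \<in> S \<Longrightarrow> r *\<^sub>R x \<in> S"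
  by (auto simp: closed_csubspace_def csubspace_def scaleR_scaleC)

lemma closed_csubspace_diff: "closed_csubspace S \<Longrightarrow> x \<in> S \<Longrightarrow> y \<in> S \<Longrightarrow> x - y \<in> S"
  by (simp add: closed_csubspace_def csubspace_diff)

lemma closed_csubspace_UNIV [simp]: "closed_csubspace UNIV"
  by (simp add: closed_csubspace_def csubspace_def)

text \<open>The representing vector minimizes \<open>x \<mapsto> \<parallel>x\<parallel>\<^sup>2 - 2 Re (f x)\<close>; the parallelogram law makes
  minimizing sequences Cauchy.\<close>

lemma riesz_representation:
  fixes f :: "'a::complex_hilbert \<Rightarrow> complex"
  assumes S: "closed_csubspace S"
    and add: "\<And>x y. x \<in> S \<Longrightarrow> y \<in> S \<Longrightarrow> f (x + y) = f x + f y"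
    and scale: "\<And>c x. x \<in> S \<Longrightarrow> f (c *\<^sub>C x) = c * f x"
    and bound: "\<And>x. x \<in> S \<Longrightarrow> cmod (f x) \<le> K * norm x"
  shows "\<exists>!x. x \<in> S \<and> (\<forall>v\<in>S. f v = cinner v x)"
proof -
  note Scl = S[unfolded closed_csubspace_def csubspace_def]
  define J where "J x = (norm x)\<^sup>2 - 2 * Re (f x)" for x
  define I where "I = Inf (J ` S)"
  have ReF: "Re (f x) \<le> K * norm x" if "x \<in> S" for x
    using bound[OF that] complex_Re_le_cmod[of "f x"] by linarith
  have low: "J x \<ge> - K\<^sup>2" if "x \<in> S" for x
  proof -
    have "0 \<le> (norm x - K)\<^sup>2" by simp
    then have "(norm x)\<^sup>2 - 2 * (K * norm x) \<ge> - K\<^sup>2" by (simp add: power2_diff algebra_simps)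
    with ReF[OF that] show ?thesis unfolding J_def by linarith
  qed
  have bdd: "bdd_below (J ` S)" using low by (auto intro!: bdd_belowI2)
  have I_le: "I \<le> J x" if "x \<in> S" for x
    unfolding I_def using bdd that by (auto intro: cInf_lower)
  have "\<exists>x\<in>S. J x < I + 1 / Suc n" for n
  proof -
    have "Inf (J ` S) < I + 1 / Suc n" unfolding I_def by simp
    from cInf_lessD[OF _ this] Scl show ?thesis by blast
  qed
  then obtain X where X: "\<And>n. X n \<in> S" "\<And>n. J (X n) < I + 1 / Suc n" by metis
  have key: "(norm (x - y))\<^sup>2 \<le> 2 * (J x - I) + 2 * (J y - I)" if "x \<in> S" "y \<in> S" for x y
  proof -
    have s: "x + y \<in> S" "(1/2) *\<^sub>R (x + y) \<in> S" using that Scl closed_csubspace_scaleR[OF S] by blast+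
    have "f ((1/2) *\<^sub>R (x + y)) = (f x + f y) / 2"
      using scale[OF s(1), of "1/2"] add[OF that] by (simp add: scaleR_scaleC)
    moreover have "(norm ((1/2) *\<^sub>R (x + y)))\<^sup>2 = (norm (x + y))\<^sup>2 / 4"
      unfolding norm_scaleR by (simp add: power_divide)
    ultimately have Jm: "J ((1/2) *\<^sub>R (x + y)) = (norm (x + y))\<^sup>2 / 4 - Re (f x) - Re (f y)"
      unfolding J_def by (simp only: Re_divide_numeral plus_complex.sel) (simp add: field_simps)
    have "I \<le> (norm (x + y))\<^sup>2 / 4 - Re (f x) - Re (f y)" using I_le[OF s(2)] unfolding Jm .
    moreover have "2 * (J x - I) + 2 * (J y - I)
        = 2 * (norm x)\<^sup>2 + 2 * (norm y)\<^sup>2 - 4 * (I + Re (f x) + Re (f y))"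
      unfolding J_def by (simp add: algebra_simps)
    ultimately show ?thesis using parallelogram_law[of x y] by (simp add: field_simps)
  qed
  have "Cauchy X"
  proof (rule metric_CauchyI)
    fix e :: real assume e: "e > 0"
    obtain N where N: "4 / e\<^sup>2 < Suc N" using reals_Archimedean2 less_SucI
      by (metis less_trans lessI of_nat_less_iff)
    show "\<exists>M. \<forall>m\<ge>M. \<forall>n\<ge>M. dist (X m) (X n) < e"
    proof (intro exI[of _ N] allI impI)
      fix m n assume mn: "m \<ge> N" "n \<ge> N"
      have a: "1 / Suc m \<le> 1 / Suc N" "1 / Suc n \<le> 1 / Suc N" using mn by (auto simp: field_simps)
      have b: "4 * (1 / Suc N) < e\<^sup>2" using N e by (simp add: field_simps)
      have "(norm (X m - X n))\<^sup>2 < e\<^sup>2"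
        using key[OF X(1) X(1), of m n] X(2)[of m] X(2)[of n] a b by (smt (verit))
      then show "dist (X m) (X n) < e" using e by (simp add: dist_norm power2_less_imp_less)
    qed
  qed
  then obtain x where x: "X \<longlonglongrightarrow> x" using Cauchy_convergent_iff convergent_def by blast
  have xS: "x \<in> S" using closed_sequentially[of S X x] Scl X x by auto
  have fdiff: "f (a - b) = f a - f b" if "a \<in> S" "b \<in> S" for a b
    using add[of "a - b" b] closed_csubspace_diff[OF S that] that by simp
  have "(\<lambda>n. f (X n) - f x) \<longlonglongrightarrow> 0"
  proof (rule Lim_null_comparison)
    show "\<forall>\<^sub>F n in sequentially. norm (f (X n) - f x) \<le> K * norm (X n - x)"
      using bound[OF closed_csubspace_diff[OF S X(1) xS]] fdiff[OF X(1) xS] by (auto intro!: always_eventually)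
    have "(\<lambda>n. K * norm (X n - x)) \<longlonglongrightarrow> K * norm (x - x)" using x by (intro tendsto_intros)
    then show "(\<lambda>n. K * norm (X n - x)) \<longlonglongrightarrow> 0" by simp
  qed
  then have fX: "(\<lambda>n. f (X n)) \<longlonglongrightarrow> f x" by (simp add: LIM_zero_iff)
  have "(\<lambda>n. J (X n)) \<longlonglongrightarrow> J x" unfolding J_def by (intro tendsto_intros x fX)
  moreover have "(\<lambda>n. I + 1 / Suc n) \<longlonglongrightarrow> I + 0" by (intro tendsto_intros lim_inverse_n'[THEN LIMSEQ_Suc])
  ultimately have "J x \<le> I + 0" by (rule LIMSEQ_le) (use X(2) less_imp_le in blast)
  then have Jx: "J x \<le> J y" if "y \<in> S" for y using I_le[OF that] by simp
  \<comment> \<open>First-order condition at the minimizer: along x + t v the functional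
    \<open>J\<close> is a quadratic in t, whose linear coefficient \<open>2 * d\<close> must
    vanish.\<close>
  have re: "Re (f v) = Re (cinner v x)" if v: "v \<in> S" for v
  proof -
    define d where "d = Re (cinner v x) - Re (f v)"
    have q: "0 \<le> t\<^sup>2 * (norm v)\<^sup>2 + 2 * t * d" for t :: real
    proof -
      have tv: "t *\<^sub>R v \<in> S" "x + t *\<^sub>R v \<in> S" using closed_csubspace_scaleR[OF S v] Scl xS by auto
      have "f (x + t *\<^sub>R v) = f x + of_real t * f v" using add[OF xS tv(1)] scale[OF v] by (simp add: scaleR_scaleC)
      then have "J (x + t *\<^sub>R v) = J x + t\<^sup>2 * (norm v)\<^sup>2 + 2 * t * d"
        by (simp add: J_def norm_add_sq d_def cinner_scaleR_right Re_cinner_commute[of x] power_mult_distrib algebra_simps)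
      with Jx[OF tv(2)] show ?thesis by linarith
    qed
    have "d = 0"
    proof (rule ccontr)
      assume "d \<noteq> 0"
      \<comment> \<open>The test value t = - d / N makes the quadratic negative if d is nonzero; the
        added 1 keeps N positive for v = 0 as well.\<close>
      define N where "N = (norm v)\<^sup>2 + 1"
      have N: "N > 0" unfolding N_def by (smt (verit) zero_le_power2)
      have "0 \<le> (- d / N)\<^sup>2 * (N - 1) + 2 * (- d / N) * d" using q[of "- d / N"] by (simp add: N_def)
      also have "\<dots> = - (d\<^sup>2 / N) - d\<^sup>2 / N\<^sup>2" using N by (simp add: field_simps power2_eq_square)
      also have "\<dots> < 0" using N \<open>d \<noteq> 0\<close> zero_less_divide_iff[of "d\<^sup>2"] by (smt (verit) zero_less_power2)
      finally show False by simp
    qed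
    then show ?thesis by (simp add: d_def)
  qed
  have rep: "f v = cinner v x" if v: "v \<in> S" for v
  proof (rule complex_eqI)
    show "Re (f v) = Re (cinner v x)" by (rule re[OF v])
    have "\<i> *\<^sub>C v \<in> S" using v Scl by blast
    from re[OF this] show "Im (f v) = Im (cinner v x)" by (simp add: scale[OF v] cinner_scaleC_left)
  qed
  show ?thesis
  proof (intro ex1I[of _ x] conjI ballI xS rep)
    fix y assume y: "y \<in> S \<and> (\<forall>v\<in>S. f v = cinner v y)"
    have d: "y - x \<in> S" using closed_csubspace_diff[OF S] y xS by blast
    then have "cinner (y - x) (y - x) = 0" using y rep[OF d] by (simp add: cinner_diff_right)
    then show "y = x" by simp
  qed
qed

text \<open>Boundedness of \<open>T\<close> makes \<open>v \<mapsto> cinner (T v) y\<close> a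
  bounded functional, so by Riesz representation the description by \<open>THE\<close> in
  \<open>adjoint_on\<close> has exactly one solution. Every property of \<open>hadj\<close> rests on
  this.\<close>

lemma cinner_hadj:
  fixes T :: "'a::complex_hilbert \<Rightarrow> 'b::complex_hilbert"
  assumes T: "bounded_clinear T"
  shows "cinner (T v) y = cinner v (hadj T y)"
proof -
  obtain K where K: "K > 0" "\<And>x. norm (T x) \<le> K * norm x" using bounded_clinear_bound[OF T] by blast
  have "\<exists>!x. x \<in> UNIV \<and> (\<forall>v\<in>UNIV. cinner (T v) y = cinner v x)"
  proof (rule riesz_representation)
    fix x :: 'a
    show "cmod (cinner (T x) y) \<le> (K * norm y) * norm x"
      using cinner_cauchy_schwarz[of "T x" y] mult_right_mono[OF K(2)[of x] norm_ge_zero[of y]]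
      by (simp add: algebra_simps)
  qed (auto simp: bounded_clinear_simps[OF T] cinner_add_left cinner_scaleC_left)
  from theI'[OF this] show ?thesis unfolding hadj_def adjoint_on_def by blast
qed

lemma hadj_eqI:
  assumes "bounded_clinear T" "\<And>v. cinner (T v) y = cinner v x" shows "hadj T y = x"
  using assms cinner_hadj by (metis cinner_extensionality)

lemma bounded_clinear_hadj:
  fixes T :: "'a::complex_hilbert \<Rightarrow> 'b::complex_hilbert"
  assumes T: "bounded_clinear T" shows "bounded_clinear (hadj T)"
proof -
  obtain K where K: "K > 0" "\<And>x. norm (T x) \<le> K * norm x" using bounded_clinear_bound[OF T] by blast
  show ?thesis
  proof (rule bounded_clinearI)
    fix x y c
    show "hadj T (x + y) = hadj T x + hadj T y"
      by (rule hadj_eqI[OF T]) (simp add: cinner_add_right cinner_hadj[OF T])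
    show "hadj T (c *\<^sub>C x) = c *\<^sub>C hadj T x"
      by (rule hadj_eqI[OF T]) (simp add: cinner_scaleC_right cinner_hadj[OF T])
    have "(norm (hadj T x))\<^sup>2 = Re (cinner (T (hadj T x)) x)"
      by (simp add: norm_sq_eq_cinner cinner_hadj[OF T])
    also have "\<dots> \<le> norm (T (hadj T x)) * norm x" by (rule Re_cinner_le)
    also have "\<dots> \<le> (K * norm (hadj T x)) * norm x" by (intro mult_right_mono K) simp
    finally have "norm (hadj T x) * norm (hadj T x) \<le> norm (hadj T x) * (K * norm x)"
      by (simp add: power2_eq_square algebra_simps)
    then show "norm (hadj T x) \<le> K * norm x"
      using K(1) by (cases "hadj T x = 0") auto
  qed
qed

lemma selfadjoint_iff:
  "selfadjoint T \<longleftrightarrow> bounded_clinear T \<and> (\<forall>x y. cinner (T x) y = cinner x (T y))"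
proof safe
  assume T: "selfadjoint T"
  then show "bounded_clinear T" by (simp add: selfadjoint_def)
  fix x y show "cinner (T x) y = cinner x (T y)"
    using T cinner_hadj[of T x y] by (simp add: selfadjoint_def)
next
  assume "bounded_clinear T" "\<forall>x y. cinner (T x) y = cinner x (T y)"
  then show "selfadjoint T" unfolding selfadjoint_def by (auto intro!: ext hadj_eqI)
qed

lemma selfadjointD:
  assumes "selfadjoint T"
  shows "bounded_clinear T" "cinner (T x) y = cinner x (T y)"
  using assms by (auto simp: selfadjoint_iff)

lemma selfadjoint_cinner_real:
  assumes "selfadjoint T" shows "cinner (T x) x = of_real (Re (cinner (T x) x))"
proof -
  have "cnj (cinner (T x) x) = cinner (T x) x"
    using selfadjointD(2)[OF assms, of x x] cinner_commute[of x "T x"] by simp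
  then show ?thesis by (metis Reals_cnj_iff of_real_Re)
qed

lemma boundedly_invertible_inv:
  assumes "boundedly_invertible T"
  shows "bounded_clinear (inv T)" "inv T (T x) = x" "T (inv T y) = y" "bij T"
proof -
  obtain R where R: "bounded_clinear R" "R \<circ> T = id" "T \<circ> R = id"
    using assms unfolding boundedly_invertible_def by blast
  show b: "bij T" using R by (metis o_bij)
  have "inv T = R" using R by (metis inv_unique_comp)
  then show "bounded_clinear (inv T)" using R by simp
  show "inv T (T x) = x" "T (inv T y) = y"
    using b by (auto simp: bij_is_inj bij_is_surj surj_f_inv_f)
qed

text \<open>Zabreiko's lemma, for a seminorm given by its sublevel relation: \<open>R x r\<close> means that
  \<open>x\<close> has a representation of cost at most \<open>r\<close>.\<close>

lemma countably_subadditive_bounded: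
  fixes R :: "'a::banach \<Rightarrow> real \<Rightarrow> bool"
  assumes mono: "\<And>x r s. R x r \<Longrightarrow> r \<le> s \<Longrightarrow> R x s"
    and scale: "\<And>x r c. R x r \<Longrightarrow> R (c *\<^sub>R x) (\<bar>c\<bar> * r)"
    and sums: "\<And>x r. (\<And>k. R (x k) (r k)) \<Longrightarrow> (\<And>k. r k \<ge> 0) \<Longrightarrow> summable r \<Longrightarrow> summable x
      \<Longrightarrow> R (\<Sum>k. x k) (\<Sum>k. r k)"
    and total: "\<And>x. \<exists>r. R x r"
  shows "\<exists>M>0. \<forall>x. R x (M * norm x)"
proof -
  have Rz: "R 0 0" using total[of 0] scale[of 0 _ 0] by auto
  have Radd: "R (x + y) (r + s)" if "R x r" "R y s" "r \<ge> 0" "s \<ge> 0" for x y r s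
  proof -
    define X where "X k = (if k = 0 then x else if k = (1::nat) then y else 0)" for k
    define T where "T k = (if k = 0 then r else if k = (1::nat) then s else 0)" for k
    have Xk: "R (X k) (T k)" "T k \<ge> 0" for k using that Rz by (auto simp: X_def T_def)
    have X: "X sums (x + y)" using sums_finite[of "{0,1::nat}" X] by (simp add: X_def)
    have T: "T sums (r + s)" using sums_finite[of "{0,1::nat}" T] by (simp add: T_def)
    have "R (\<Sum>k. X k) (\<Sum>k. T k)"
      by (rule sums) (use that Rz sums_summable[OF X] sums_summable[OF T] in \<open>auto simp: Xk\<close>)
    then show ?thesis using X T by (simp add: sums_iff)
  qed
  \<comment> \<open>Sublevel sets of the cost: they cover the space, so by Baire the closure of one
    of them contains a ball.\<close>
  define V where "V n = {x. R x (real n)}" for n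
  have cov: "(\<Union>n. closure (V n)) = UNIV"
  proof -
    have "\<exists>n. x \<in> closure (V n)" for x
    proof -
      obtain r where r: "R x r" using total by blast
      have "R x (real (nat \<lceil>r\<rceil>))" using mono[OF r] by (simp add: real_nat_ceiling_ge)
      then have "x \<in> V (nat \<lceil>r\<rceil>)" by (simp add: V_def)
      then show ?thesis using closure_subset[of "V (nat \<lceil>r\<rceil>)"] by (intro exI[of _ "nat \<lceil>r\<rceil>"]) auto
    qed
    then show ?thesis by auto
  qed
  have "\<exists>n. interior (closure (V n)) \<noteq> {}"
  proof (rule ccontr)
    assume e: "\<not> ?thesis"
    have "euclidean interior_of \<Union>(range (\<lambda>n. closure (V n))) = {}"
    proof (rule Baire_category_alt)
      fix T assume "T \<in> range (\<lambda>n. closure (V n))"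
      then obtain n where n: "T = closure (V n)" by blast
      show "closedin euclidean T \<and> euclidean interior_of T = {}"
        using e n by simp
    qed (simp_all add: completely_metrizable_space_euclidean)
    with cov show False by simp
  qed
  then obtain n a r where r: "r > 0" "cball a r \<subseteq> closure (V n)"
    by (metis ex_in_conv mem_interior_cball)
  \<comment> \<open>Convexity and symmetry of \<open>V n\<close> move the ball to the origin: x is
    the midpoint of a + x and - (a - x).\<close>
  have ball: "x \<in> closure (V n)" if "norm x \<le> r" for x
  proof -
    have "a + x \<in> closure (V n)" "a - x \<in> closure (V n)"
      using r that by (auto simp: subset_iff dist_norm)
    then obtain p q where p: "\<And>k. p k \<in> V n" "p \<longlonglongrightarrow> a + x" and q: "\<And>k. q k \<in> V n" "q \<longlonglongrightarrow> a - x"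
      by (metis closure_sequential)
    have "(1/2) *\<^sub>R (p k + (-1) *\<^sub>R q k) \<in> V n" for k
    proof -
      have "R ((-1) *\<^sub>R q k) (real n)" using scale[of "q k" "real n" "-1"] q(1)[of k] by (simp add: V_def)
      then have "R (p k + (-1) *\<^sub>R q k) (real n + real n)" using p(1)[of k] by (intro Radd) (auto simp: V_def)
      from scale[OF this, of "1/2"] show ?thesis by (simp add: V_def)
    qed
    moreover have "(\<lambda>k. (1/2) *\<^sub>R (p k + (-1) *\<^sub>R q k)) \<longlonglongrightarrow> (1/2) *\<^sub>R ((a + x) + (-1) *\<^sub>R (a - x))"
      by (intro tendsto_intros p q)
    moreover have "(1/2) *\<^sub>R ((a + x) + (-1) *\<^sub>R (a - x)) = x"
      by (simp add: scaleR_2[symmetric])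
    ultimately show ?thesis by (metis (no_types, lifting) closure_sequential)
  qed
  \<comment> \<open>Rescaled density: a vector of norm at most t r is approximated at cost n t, up
    to an error of half that radius.\<close>
  have step: "\<exists>v. R v (real n * t) \<and> norm (x - v) \<le> t * r / 2" if x: "norm x \<le> t * r" "t > 0" for x t
  proof -
    have "norm ((1/t) *\<^sub>R x) \<le> r" using x by (simp add: field_simps)
    from ball[OF this] obtain v where v: "v \<in> V n" "dist v ((1/t) *\<^sub>R x) < r / 2"
      using r(1) by (metis closure_approachable half_gt_zero)
    have "norm (x - t *\<^sub>R v) = norm (t *\<^sub>R ((1/t) *\<^sub>R x - v))"
      using x by (simp add: scaleR_diff_right)
    also have "\<dots> = t * dist v ((1/t) *\<^sub>R x)" using x by (simp add: dist_norm norm_minus_commute del: scaleR_scaleR)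
    also have "\<dots> \<le> t * (r / 2)" using v x by (intro mult_left_mono) auto
    finally have "norm (x - t *\<^sub>R v) \<le> t * r / 2" by simp
    moreover have "R (t *\<^sub>R v) (real n * t)" using scale[of v "real n" t] v x by (simp add: V_def mult.commute)
    ultimately show ?thesis by blast
  qed
  have main: "R x (2 * real n)" if x: "norm x \<le> r" for x
  proof -
    define g where "g t y = (SOME v. R v (real n * t) \<and> norm (y - v) \<le> t * r / 2)" for t y
    have g: "R (g t y) (real n * t)" "norm (y - g t y) \<le> t * r / 2" if "norm y \<le> t * r" "t > 0" for y t
      using someI_ex[OF step[OF that]] unfolding g_def by blast+
    \<comment> \<open>\<open>Y k\<close> is the remainder after k approximations. The remainders
      halve, the costs n / 2^k add up to 2 n, and the assumption on series passes to the exact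
      sum.\<close>
    define Y where "Y = rec_nat x (\<lambda>k y. y - g ((1/2)^k) y)"
    have Y0: "Y 0 = x" and YS: "Y (Suc k) = Y k - g ((1/2)^k) (Y k)" for k by (auto simp: Y_def)
    have nY: "norm (Y k) \<le> (1/2)^k * r" for k
    proof (induction k)
      case (Suc k)
      then show ?case using g(2)[of "Y k" "(1/2)^k"] by (simp add: YS)
    qed (simp add: Y0 x)
    define v where "v k = g ((1/2)^k) (Y k)" for k
    have Rv: "R (v k) (real n * (1/2)^k)" for k unfolding v_def using nY by (intro g) auto
    have "(\<lambda>k. (1/2::real)^k) \<longlonglongrightarrow> 0" by (rule LIMSEQ_realpow_zero) simp_all
    then have "(\<lambda>k. (1/2)^k * r) \<longlonglongrightarrow> 0" by (rule tendsto_mult_left_zero)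
    then have "Y \<longlonglongrightarrow> 0" by (rule Lim_null_comparison[rotated]) (use nY in \<open>auto intro: always_eventually\<close>)
    then have "(\<lambda>k. Y k - Y (Suc k)) sums (Y 0 - 0)" by (rule telescope_sums')
    then have vs: "v sums x" unfolding v_def by (simp add: Y0 YS)
    have gs: "(\<lambda>k. real n * (1/2)^k) sums (real n * 2)"
      using sums_mult[OF geometric_sums[of "1/2::real"], of "real n"] by simp
    have "R (\<Sum>k. v k) (\<Sum>k. real n * (1/2)^k)"
      by (rule sums[OF Rv]) (use vs gs in \<open>auto simp: sums_iff\<close>)
    then show ?thesis using vs gs by (simp add: sums_iff mult.commute)
  qed
  show ?thesis
  \<comment> \<open>The added 1 keeps the constant positive when n = 0.\<close>
  proof (intro exI[of _ "(2 * real n + 1) / r"] conjI allI)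
    show "(2 * real n + 1) / r > 0" using r by (simp add: add_nonneg_pos)
    fix x :: 'a
    show "R x ((2 * real n + 1) / r * norm x)"
    proof (cases "x = 0")
      case False
      have "norm ((r / norm x) *\<^sub>R x) \<le> r" using r False by simp
      from scale[OF main[OF this], of "norm x / r"]
      have "R x (norm x / r * (2 * real n))" using r False by simp
      then show ?thesis
      proof (rule mono)
        show "norm x / r * (2 * real n) \<le> (2 * real n + 1) / r * norm x"
          using divide_right_mono[OF mult_left_mono[of "2 * real n" "2 * real n + 1" "norm x"], of r] r
          by (simp add: mult.commute)
      qed
    qed (use Rz in simp)
  qed
qed

section \<open>The Riesz projection of a dichotomous operator\<close>

lemma scaleC_bounded_linear: "bounded_linear (\<lambda>x::'a::complex_hilbert. c *\<^sub>C x)"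
  by (rule bounded_bilinear.bounded_linear_right[OF bounded_bilinear_scaleC])

text \<open>Pointwise invertibility becomes uniform by compactness of the circle: approximate kernel
  vectors at points \<open>z n\<close> would accumulate at some l, where the bounded inverse
  excludes them. The bound controls all contour integrals below.\<close>

lemma resolvent_lower_bound:
  fixes A :: "'x::complex_hilbert \<Rightarrow> 'x"
  assumes A: "bounded_clinear A" and dich: "has_dichotomy A"
  obtains c where "c > 0" "\<And>z v. cmod z = 1 \<Longrightarrow> c * norm v \<le> norm (z *\<^sub>C v - A v)"
proof -
  have inv: "boundedly_invertible (\<lambda>v. z *\<^sub>C v - A v)" if "cmod z = 1" for z
  proof -
    have "z \<in> sphere 0 1" using that by simp
    with dich have "z \<notin> op_spectrum A" unfolding has_dichotomy_def by blast
    then show ?thesis unfolding op_spectrum_def by simp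
  qed
  have "\<exists>c>0. \<forall>z v. cmod z = 1 \<longrightarrow> c * norm v \<le> norm (z *\<^sub>C v - A v)"
  proof (rule ccontr)
    assume neg: "\<not> ?thesis"
    have "\<exists>z v. cmod z = 1 \<and> norm (z *\<^sub>C v - A v) < (1 / Suc n) * norm v" for n
    proof -
      have "(0::real) < 1 / Suc n" by simp
      then show ?thesis using neg not_le by blast
    qed
    then obtain z v where zv: "\<And>n. cmod (z n) = 1" "\<And>n. norm (z n *\<^sub>C v n - A (v n)) < (1 / Suc n) * norm (v n)"
      by metis
    have "\<forall>n. z n \<in> sphere 0 1" using zv(1) by simp
    with compact_sphere[of "0::complex" 1]
    obtain l r where l: "l \<in> sphere 0 1" "strict_mono r" "(z \<circ> r) \<longlonglongrightarrow> l"
      unfolding compact_def by blast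
    have li: "boundedly_invertible (\<lambda>v. l *\<^sub>C v - A v)" using inv l by simp
    obtain K where K: "K > 0" "\<And>x. norm (inv (\<lambda>v. l *\<^sub>C v - A v) x) \<le> K * norm x"
      using bounded_clinear_bound[OF boundedly_invertible_inv(1)[OF li]] by blast
    have low: "norm v \<le> K * norm (l *\<^sub>C v - A v)" for v
      using K(2)[of "l *\<^sub>C v - A v"] boundedly_invertible_inv(2)[OF li, of v] by simp
    have "1 \<le> K * (cmod (l - z (r n)) + 1 / Suc (r n))" for n
    proof -
      have vpos: "norm (v (r n)) > 0"
        using zv(2)[of "r n"] by (metis mult_zero_right norm_ge_zero not_le zero_less_norm_iff norm_eq_zero)
      have "l *\<^sub>C v (r n) - A (v (r n)) = (l - z (r n)) *\<^sub>C v (r n) + (z (r n) *\<^sub>C v (r n) - A (v (r n)))"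
        by (simp add: scaleC_diff_left)
      then have "norm (l *\<^sub>C v (r n) - A (v (r n))) \<le> norm ((l - z (r n)) *\<^sub>C v (r n)) + norm (z (r n) *\<^sub>C v (r n) - A (v (r n)))"
        by (simp only: norm_triangle_ineq)
      then have "norm (l *\<^sub>C v (r n) - A (v (r n))) \<le> cmod (l - z (r n)) * norm (v (r n)) + (1 / Suc (r n)) * norm (v (r n))"
        using zv(2)[of "r n"] unfolding norm_scaleC by linarith
      then have "norm (v (r n)) \<le> K * (cmod (l - z (r n)) * norm (v (r n)) + (1 / Suc (r n)) * norm (v (r n)))"
        using low[of "v (r n)"] mult_left_mono[OF _ less_imp_le[OF K(1)]] by (meson order_trans)
      then have "norm (v (r n)) * 1 \<le> norm (v (r n)) * (K * (cmod (l - z (r n)) + 1 / Suc (r n)))"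
        by (simp add: algebra_simps)
      then show ?thesis using vpos by (simp only: mult_le_cancel_left_pos)
    qed
    moreover have "(\<lambda>n. K * (cmod (l - z (r n)) + 1 / Suc (r n))) \<longlonglongrightarrow> K * (cmod (l - l) + 0)"
    proof (intro tendsto_intros)
      show "(\<lambda>n. z (r n)) \<longlonglongrightarrow> l" using l by (simp add: o_def)
      have "(\<lambda>n. 1 / real (Suc n)) \<longlonglongrightarrow> 0" using LIMSEQ_Suc[OF lim_inverse_n'] by simp
      from LIMSEQ_subseq_LIMSEQ[OF this l(2)] show "(\<lambda>n. 1 / real (Suc (r n))) \<longlonglongrightarrow> 0" by (simp add: o_def)
    qed
    ultimately have "1 \<le> K * (cmod (l - l) + 0)" by (intro LIMSEQ_le_const) auto
    then show False by simp
  qed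
  then show ?thesis using that by blast
qed

section \<open>The resolvent on the unit circle and its Fourier coefficients\<close>

locale circle_resolvent =
  fixes A :: "'x::complex_hilbert \<Rightarrow> 'x" and c :: real
  assumes A: "bounded_clinear A" and dich: "has_dichotomy A"
    and c_pos: "c > 0" and lower: "\<And>z v. cmod z = 1 \<Longrightarrow> c * norm v \<le> norm (z *\<^sub>C v - A v)"
begin

definition Rs :: "real \<Rightarrow> 'x \<Rightarrow> 'x" where "Rs t = inv (\<lambda>v. cis t *\<^sub>C v - A v)"

lemma invertible: "cmod z = 1 \<Longrightarrow> boundedly_invertible (\<lambda>v. z *\<^sub>C v - A v)"
proof -
  assume "cmod z = 1"
  then have "z \<in> sphere 0 1" by simp
  with dich have "z \<notin> op_spectrum A" unfolding has_dichotomy_def by blast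
  then show ?thesis unfolding op_spectrum_def by simp
qed

lemma Rs_clinear: "bounded_clinear (Rs t)"
  unfolding Rs_def by (rule boundedly_invertible_inv(1)[OF invertible]) simp

lemma Rs_right: "cis t *\<^sub>C Rs t x - A (Rs t x) = x"
  unfolding Rs_def using boundedly_invertible_inv(3)[OF invertible, of "cis t" x] by simp

lemma Rs_left: "Rs t (cis t *\<^sub>C v - A v) = v"
  unfolding Rs_def using boundedly_invertible_inv(2)[OF invertible, of "cis t" v] by simp

lemma A_Rs: "A (Rs t x) = cis t *\<^sub>C Rs t x - x"
  using Rs_right[of t x] by (simp add: algebra_simps)

lemma Rs_A: "Rs t (A x) = A (Rs t x)"
  using Rs_left[of t x] by (simp add: A_Rs bounded_clinear_simps[OF Rs_clinear] algebra_simps)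

lemma Rs_bound: "norm (Rs t x) \<le> norm x / c"
  using lower[of "cis t" "Rs t x"] c_pos by (simp add: Rs_right field_simps)

text \<open>The first resolvent identity. Together with the uniform bound it yields both continuity
  and differentiability of the resolvent.\<close>

lemma Rs_identity: "Rs s x - Rs t x = (cis t - cis s) *\<^sub>C Rs s (Rs t x)"
proof -
  have "cis s *\<^sub>C Rs t x - A (Rs t x) = x - (cis t - cis s) *\<^sub>C Rs t x"
    by (simp add: A_Rs scaleC_diff_left)
  then have "Rs t x = Rs s (x - (cis t - cis s) *\<^sub>C Rs t x)" using Rs_left[of s "Rs t x"] by simp
  also have "\<dots> = Rs s x - (cis t - cis s) *\<^sub>C Rs s (Rs t x)"
    by (simp only: bounded_clinear_diff[OF Rs_clinear] bounded_clinear_scaleC[OF Rs_clinear])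
  finally show ?thesis by (simp add: algebra_simps)
qed

lemma Rs_periodic: "Rs (2 * pi) = Rs 0"
  by (simp add: Rs_def)

lemma Rs_tendsto: "((\<lambda>s. Rs s x) \<longlongrightarrow> Rs t x) (at t within S)"
proof -
  have "((\<lambda>s. cmod (cis t - cis s) * (norm (Rs t x) / c)) \<longlongrightarrow> cmod (cis t - cis t) * (norm (Rs t x) / c)) (at t within S)"
    by (intro tendsto_intros)
  then have "((\<lambda>s. cmod (cis t - cis s) * (norm (Rs t x) / c)) \<longlongrightarrow> 0) (at t within S)" by simp
  then have "((\<lambda>s. Rs s x - Rs t x) \<longlongrightarrow> 0) (at t within S)"
    by (rule Lim_null_comparison[rotated])
       (simp add: Rs_identity[of _ x t] mult_left_mono Rs_bound del: times_divide_eq_right)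
  then show ?thesis by (simp add: LIM_zero_iff)
qed

lemma Rs_continuous: "continuous_on S (\<lambda>t. Rs t x)"
  unfolding continuous_on_def using Rs_tendsto by blast

text \<open>The chain rule for d/dz (z - A)^(-1) = - (z - A)^(-2) along z = cis t.\<close>

lemma Rs_vector_derivative:
  "((\<lambda>s. Rs s x) has_vector_derivative (- \<i> * cis t) *\<^sub>C Rs t (Rs t x)) (at t within S)"
  unfolding has_vector_derivative_def
proof (rule has_derivativeI_sandwich[where e = 1])
  let ?y = "Rs t x"
  let ?e = "\<lambda>s. cis s - cis t - (s - t) *\<^sub>R (\<i> * cis t)"
  let ?H = "\<lambda>s. norm (?e s) / norm (s - t) * (norm ?y / c) + norm (Rs s ?y - Rs t ?y)"
  fix s assume s: "s \<noteq> t"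
  \<comment> \<open>Two error terms: the first-order remainder of \<open>cis\<close>, which is o(s -
    t), and s - t times the change of the outer resolvent, which vanishes by continuity.\<close>
  have "Rs s x - Rs t x - (s - t) *\<^sub>R ((- \<i> * cis t) *\<^sub>C Rs t ?y)
      = - (?e s *\<^sub>C Rs s ?y) - (s - t) *\<^sub>R (\<i> * cis t) *\<^sub>C (Rs s ?y - Rs t ?y)"
    unfolding Rs_identity[of s x t]
    by (simp add: scaleC_diff_left scaleC_diff_right scaleC_add_left scaleR_scaleC scaleC_scaleC
        scaleC_complex_def algebra_simps del: scaleC_minus_left)
  then have "norm (Rs s x - Rs t x - (s - t) *\<^sub>R ((- \<i> * cis t) *\<^sub>C Rs t ?y))
      \<le> norm (?e s) * norm (Rs s ?y) + \<bar>s - t\<bar> * norm (Rs s ?y - Rs t ?y)"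
    using norm_triangle_ineq4[of "- (?e s *\<^sub>C Rs s ?y)" "(s - t) *\<^sub>R (\<i> * cis t) *\<^sub>C (Rs s ?y - Rs t ?y)"]
    by (simp add: norm_mult del: Rs_identity)
  also have "\<dots> \<le> norm (?e s) * (norm ?y / c) + \<bar>s - t\<bar> * norm (Rs s ?y - Rs t ?y)"
    by (intro add_right_mono mult_left_mono Rs_bound) simp
  finally have "norm (Rs s x - Rs t x - (s - t) *\<^sub>R ((- \<i> * cis t) *\<^sub>C Rs t ?y)) / \<bar>s - t\<bar>
     \<le> (norm (?e s) * (norm ?y / c) + \<bar>s - t\<bar> * norm (Rs s ?y - Rs t ?y)) / \<bar>s - t\<bar>"
    by (rule divide_right_mono) simp
  also have "\<dots> = ?H s" using s by (simp add: add_divide_distrib)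
  finally show "norm (Rs s x - Rs t x - (s - t) *\<^sub>R ((- \<i> * cis t) *\<^sub>C Rs t ?y)) / norm (s - t) \<le> ?H s"
    by simp
next
  let ?y = "Rs t x"
  have "((\<lambda>x. cis x) has_derivative (\<lambda>h. h *\<^sub>R (\<i> * cis t))) (at t within S)"
    by (rule has_derivative_cis) (rule has_derivative_ident)
  then have "((\<lambda>s. norm (cis s - cis t - (s - t) *\<^sub>R (\<i> * cis t)) / norm (s - t)) \<longlongrightarrow> 0) (at t within S)"
    unfolding has_derivative_iff_norm by blast
  moreover have "((\<lambda>s. norm (Rs s ?y - Rs t ?y)) \<longlongrightarrow> norm (Rs t ?y - Rs t ?y)) (at t within S)"
    by (intro tendsto_intros Rs_tendsto)
  ultimately have "((\<lambda>s. norm (cis s - cis t - (s - t) *\<^sub>R (\<i> * cis t)) / norm (s - t) * (norm ?y / c)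
      + norm (Rs s ?y - Rs t ?y)) \<longlongrightarrow> 0 * (norm ?y / c) + norm (Rs t ?y - Rs t ?y)) (at t within S)"
    by (intro tendsto_add tendsto_mult tendsto_const)
  then show "((\<lambda>s. norm (cis s - cis t - (s - t) *\<^sub>R (\<i> * cis t)) / norm (s - t) * (norm ?y / c)
      + norm (Rs s ?y - Rs t ?y)) \<longlongrightarrow> 0) (at t within S)"
    by simp
qed (simp_all only: zero_less_one bounded_linear_scaleR_left)

text \<open>Fourier coefficients of the resolvent; \<open>G 0\<close> is the Riesz projection.\<close>

definition G :: "int \<Rightarrow> 'x \<Rightarrow> 'x" where
  "G k x = (1 / (2 * pi)) *\<^sub>R integral {0..2 * pi} (\<lambda>t. cis (of_int (k + 1) * t) *\<^sub>C Rs t x)"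

lemma continuous_on_scaleC: "continuous_on S (\<lambda>t. cis (r * t) *\<^sub>C Rs t x)"
  by (intro bounded_bilinear.continuous_on[OF bounded_bilinear_scaleC] continuous_intros Rs_continuous)

lemma integrable_G: "(\<lambda>t. cis (r * t) *\<^sub>C Rs t x) integrable_on {0..2 * pi}"
  by (intro integrable_continuous_interval continuous_on_scaleC)

lemma cis_int_periodic: "cis (of_int n * (2 * pi)) = 1"
  using cis_multiple_2pi[of "of_int n"] by (simp add: mult_ac)

lemma vd_cis: "((\<lambda>t. cis (r * t)) has_vector_derivative (of_real r * \<i> * cis (r * t))) (at t within S)"
  unfolding has_vector_derivative_def
  by (rule derivative_eq_intros refl | simp add: scaleR_conv_of_real mult_ac)+

lemma G_bound: "norm (G k x) \<le> norm x / c"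
proof -
  have "norm (integral {0..2 * pi} (\<lambda>t. cis (of_int (k + 1) * t) *\<^sub>C Rs t x)) \<le> (norm x / c) * (2 * pi - 0)"
    by (intro integral_bound continuous_on_scaleC) (auto simp: Rs_bound)
  then show ?thesis by (simp add: G_def field_simps)
qed

text \<open>Integration by parts: the boundary terms cancel because the integrand is periodic, and
  what remains is the derivative of the resolvent, bounded by \<open>norm x / c / c\<close>. Decay
  of order 1/k is all that is obtained here; the exponential rate comes later.\<close>

lemma G_decay: "\<bar>real_of_int (k + 1)\<bar> * norm (G k x) \<le> norm x / c\<^sup>2"
proof -
  define n where "n = k + 1"
  have "((\<lambda>t. cis (of_int n * t) *\<^sub>C Rs t x) has_vector_derivative
      (cis (of_int n * t) *\<^sub>C ((- \<i> * cis t) *\<^sub>C Rs t (Rs t x)) + (of_real (of_int n) * \<i> * cis (of_int n * t)) *\<^sub>C Rs t x))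
      (at t within {0..2 * pi})" for t
    by (rule bounded_bilinear.has_vector_derivative[OF bounded_bilinear_scaleC vd_cis Rs_vector_derivative])
  then have "((\<lambda>t. cis (of_int n * t) *\<^sub>C ((- \<i> * cis t) *\<^sub>C Rs t (Rs t x)) + (of_real (of_int n) * \<i> * cis (of_int n * t)) *\<^sub>C Rs t x)
      has_integral (cis (of_int n * (2 * pi)) *\<^sub>C Rs (2 * pi) x - cis (of_int n * 0) *\<^sub>C Rs 0 x)) {0..2 * pi}"
    by (intro fundamental_theorem_of_calculus) auto
  then have 1: "((\<lambda>t. cis (of_int n * t) *\<^sub>C ((- \<i> * cis t) *\<^sub>C Rs t (Rs t x)) + (of_real (of_int n) * \<i> * cis (of_int n * t)) *\<^sub>C Rs t x)
      has_integral 0) {0..2 * pi}"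
    by (simp add: cis_int_periodic Rs_periodic del: cis_mult)
  have 2: "((\<lambda>t. (of_real (of_int n) * \<i>) *\<^sub>C (cis (of_int n * t) *\<^sub>C Rs t x)) has_integral
      (of_real (of_int n) * \<i>) *\<^sub>C integral {0..2 * pi} (\<lambda>t. cis (of_int n * t) *\<^sub>C Rs t x)) {0..2 * pi}"
    using has_integral_linear[OF integrable_integral[OF integrable_G] scaleC_bounded_linear] by (simp only: o_def)
  have 3: "((\<lambda>t. cis (of_int n * t) *\<^sub>C ((- \<i> * cis t) *\<^sub>C Rs t (Rs t x))) has_integral
      (0 - (of_real (of_int n) * \<i>) *\<^sub>C integral {0..2 * pi} (\<lambda>t. cis (of_int n * t) *\<^sub>C Rs t x))) {0..2 * pi}"
    using has_integral_diff[OF 1 2] by (simp only: scaleC_scaleC add_diff_cancel_right')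
  have "norm (0 - (of_real (of_int n) * \<i>) *\<^sub>C integral {0..2 * pi} (\<lambda>t. cis (of_int n * t) *\<^sub>C Rs t x))
      \<le> (norm x / c / c) * measure lborel {0..2 * pi}"
  proof (rule has_integral_bound_real[OF _ _ 3, of _ "{}"])
    fix t
    show "norm (cis (of_int n * t) *\<^sub>C ((- \<i> * cis t) *\<^sub>C Rs t (Rs t x))) \<le> norm x / c / c"
      using order_trans[OF Rs_bound[of t "Rs t x"] divide_right_mono[OF Rs_bound[of t x], of c]] c_pos
      by (simp add: norm_mult)
  qed (use c_pos in auto)
  then have "\<bar>real_of_int n\<bar> * norm (integral {0..2 * pi} (\<lambda>t. cis (of_int n * t) *\<^sub>C Rs t x)) \<le> norm x / c\<^sup>2 * (2 * pi)"
    by (simp add: norm_mult power2_eq_square)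
  then show ?thesis unfolding G_def n_def[symmetric] using pi_gt_zero
    by (simp add: field_simps)
qed

lemma integral_cis: "integral {0..2 * pi} (\<lambda>t. cis (of_int n * t) *\<^sub>C (x::'x)) = (if n = 0 then (2 * pi) *\<^sub>R x else 0)"
proof (cases "n = 0")
  case False
  have "((\<lambda>t. cis (of_int n * t) *\<^sub>C x) has_vector_derivative
      (cis (of_int n * t) *\<^sub>C 0 + (of_real (of_int n) * \<i> * cis (of_int n * t)) *\<^sub>C x)) (at t within {0..2 * pi})" for t
    by (rule bounded_bilinear.has_vector_derivative[OF bounded_bilinear_scaleC vd_cis has_vector_derivative_const])
  then have "((\<lambda>t. cis (of_int n * t) *\<^sub>C 0 + (of_real (of_int n) * \<i> * cis (of_int n * t)) *\<^sub>C x)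
      has_integral (cis (of_int n * (2 * pi)) *\<^sub>C x - cis (of_int n * 0) *\<^sub>C x)) {0..2 * pi}"
    by (intro fundamental_theorem_of_calculus) auto
  then have "((\<lambda>t. (of_real (of_int n) * \<i>) *\<^sub>C (cis (of_int n * t) *\<^sub>C x)) has_integral 0) {0..2 * pi}"
    by (simp add: cis_int_periodic scaleC_scaleC)
  note has_integral_linear[OF this scaleC_bounded_linear[of "inverse (of_real (of_int n) * \<i>)"]]
  then
  have "((\<lambda>t. cis (of_int n * t) *\<^sub>C x) has_integral 0) {0..2 * pi}"
  proof -
    have "inverse (of_real (of_int n) * \<i>) * (of_real (of_int n) * \<i>) = 1"
      using False by (intro left_inverse) simp
    with \<open>(_ has_integral _ *\<^sub>C 0) _\<close> show ?thesis
      by (simp only: o_def scaleC_scaleC mult.assoc[symmetric] mult_1_left scaleC_zero_right)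
  qed
  then show ?thesis using False by (simp add: integral_unique)
qed simp

text \<open>\<open>A\<close> times the resolvent at z is z times the resolvent minus the identity,
  so \<open>A\<close> shifts the Fourier index by one. The identity term has a nonzero integral only
  at index -1, which is where the two spectral parts separate.\<close>

lemma G_Suc: "A (G k x) = G (k + 1) x - (if k = -1 then x else 0)"
proof -
  have c: "(\<lambda>t. cis (r * t) *\<^sub>C x) integrable_on {0..2 * pi}" for r
    by (intro integrable_continuous_interval bounded_bilinear.continuous_on[OF bounded_bilinear_scaleC] continuous_intros)
  have eq: "A (cis (of_int (k + 1) * t) *\<^sub>C Rs t x) = cis (of_int (k + 1 + 1) * t) *\<^sub>C Rs t x - cis (of_int (k + 1) * t) *\<^sub>C x" for t
    by (simp add: bounded_clinear_scaleC[OF A] A_Rs scaleC_diff_right scaleC_scaleC cis_mult algebra_simps)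
  have "A (integral {0..2 * pi} (\<lambda>t. cis (of_int (k + 1) * t) *\<^sub>C Rs t x))
      = integral {0..2 * pi} (\<lambda>t. A (cis (of_int (k + 1) * t) *\<^sub>C Rs t x))"
    using integral_linear[OF integrable_G bounded_clinear_bounded_linear[OF A]] by (simp add: o_def)
  also have "\<dots> = integral {0..2 * pi} (\<lambda>t. cis (of_int (k + 1 + 1) * t) *\<^sub>C Rs t x)
      - integral {0..2 * pi} (\<lambda>t. cis (of_int (k + 1) * t) *\<^sub>C x)"
    unfolding eq by (intro integral_diff integrable_G c)
  also have "integral {0..2 * pi} (\<lambda>t. cis (of_int (k + 1) * t) *\<^sub>C x) = (if k + 1 = 0 then (2 * pi) *\<^sub>R x else 0)"
    by (rule integral_cis)
  finally show ?thesis
    unfolding G_def by (auto simp: bounded_clinear_scaleR[OF A] scaleR_diff_right)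
qed

lemma G_A: "G k (A x) = A (G k x)"
proof -
  have "A (integral {0..2 * pi} (\<lambda>t. cis (of_int (k + 1) * t) *\<^sub>C Rs t x))
      = integral {0..2 * pi} (\<lambda>t. A (cis (of_int (k + 1) * t) *\<^sub>C Rs t x))"
    using integral_linear[OF integrable_G bounded_clinear_bounded_linear[OF A]] by (simp add: o_def)
  then show ?thesis by (simp add: G_def Rs_A bounded_clinear_simps[OF A])
qed

lemma G_clinear: "bounded_clinear (G k)"
proof (rule bounded_clinearI)
  fix x y :: 'x and a
  show "G k (x + y) = G k x + G k y"
    unfolding G_def bounded_clinear_add[OF Rs_clinear] scaleC_add_right
    by (simp add: integral_add[OF integrable_G integrable_G] scaleR_add_right)
  have "integral {0..2 * pi} (\<lambda>t. a *\<^sub>C (cis (of_int (k + 1) * t) *\<^sub>C Rs t x))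
      = a *\<^sub>C integral {0..2 * pi} (\<lambda>t. cis (of_int (k + 1) * t) *\<^sub>C Rs t x)"
    using integral_linear[OF integrable_G scaleC_bounded_linear] by (simp add: o_def)
  then show "G k (a *\<^sub>C x) = a *\<^sub>C G k x"
    by (simp add: G_def bounded_clinear_scaleC[OF Rs_clinear] scaleC_scaleC scaleR_scaleC mult.commute)
  show "norm (G k x) \<le> (1 / c) * norm x" using G_bound[of k x] by simp
qed

lemma riesz_eq_G: "riesz_projection A = G 0"
proof
  fix x
  have "integral {0..2 * pi} (\<lambda>t. \<i> *\<^sub>C (cis (of_int (0 + 1) * t) *\<^sub>C Rs t x))
      = \<i> *\<^sub>C integral {0..2 * pi} (\<lambda>t. cis (of_int (0 + 1) * t) *\<^sub>C Rs t x)"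
    using integral_linear[OF integrable_G scaleC_bounded_linear] by (simp only: o_def)
  then show "riesz_projection A x = G 0 x"
    by (simp add: riesz_projection_def G_def Rs_def[symmetric] scaleC_scaleC scaleR_scaleC)
qed

lemma A_pow_G: "(A ^^ n) (G (int k) x) = G (int (k + n)) x"
  by (induction n) (auto simp: G_Suc algebra_simps)

text \<open>All indices at which \<open>A\<close> is applied here lie below -1, so the inhomogeneous
  term of \<open>G_Suc\<close> never appears.\<close>

lemma A_pow_G_neg: "(A ^^ n) (G (- int (Suc (k + n))) x) = G (- int (Suc k)) x"
proof (induction n arbitrary: k)
  case (Suc n)
  have "(A ^^ Suc n) (G (- int (Suc (k + Suc n))) x) = A ((A ^^ n) (G (- int (Suc (Suc k + n))) x))"
    by simp
  also have "\<dots> = A (G (- int (Suc (Suc k))) x)" by (simp only: Suc.IH)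
  also have "\<dots> = G (- int (Suc k)) x" by (simp add: G_Suc)
  finally show ?case .
qed simp

lemma G_bound_nonneg: "real (Suc n) * norm (G (int n) x) \<le> norm x / c\<^sup>2"
  using G_decay[of "int n" x] by (simp add: add.commute)

lemma G_bound_neg: "real (Suc n) * norm (G (- int n) x) \<le> (1 / c\<^sup>2 + 2 / c) * norm x"
proof -
  \<comment> \<open>The extra 2 makes up for the difference between n + 1 and the factor
    \<open>\<bar>1 - n\<bar>\<close> that \<open>G_decay\<close> provides; it is paid for with the
    uniform bound \<open>G_bound\<close>.\<close>
  have "real (Suc n) \<le> \<bar>real_of_int (- int n + 1)\<bar> + 2" by simp
  then have "real (Suc n) * norm (G (- int n) x) \<le> (\<bar>real_of_int (- int n + 1)\<bar> + 2) * norm (G (- int n) x)"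
    by (intro mult_right_mono) auto
  also have "\<dots> \<le> norm x / c\<^sup>2 + 2 * (norm x / c)"
    using G_decay[of "- int n" x] G_bound[of "- int n" x] by (simp add: distrib_right)
  finally show ?thesis by (simp add: algebra_simps)
qed

text \<open>For every m the left side equals \<open>G m\<close> applied to the coefficient of index
  -(k + m + 1), because m factors \<open>A\<close> can be moved from the inner to the outer
  coefficient. The inner one stays bounded and the outer one tends to zero. This takes the place of
  the double contour integral usual in proofs of idempotence.\<close>

lemma P_G_neg: "G 0 (G (- int (Suc k)) x) = 0"
proof -
  have PA: "G 0 ((A ^^ m) y) = G (int m) y" for m y
  proof -
    have "G 0 ((A ^^ m) y) = (A ^^ m) (G 0 y)" by (induction m) (auto simp: G_A)
    then show ?thesis using A_pow_G[of m 0 y] by simp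
  qed
  have le: "norm (G 0 (G (- int (Suc k)) x)) \<le> (norm x / c / c\<^sup>2) * (1 / real (Suc m))" for m
  proof -
    have "G 0 (G (- int (Suc k)) x) = G (int m) (G (- int (Suc (k + m))) x)"
      by (simp only: A_pow_G_neg[of m k x, symmetric] PA)
    moreover have "real (Suc m) * norm (G (int m) (G (- int (Suc (k + m))) x)) \<le> (norm x / c) / c\<^sup>2"
      using G_bound_nonneg[of m "G (- int (Suc (k + m))) x"]
        divide_right_mono[OF G_bound[of "- int (Suc (k + m))" x], of "c\<^sup>2"] by simp
    ultimately have "real (Suc m) * norm (G 0 (G (- int (Suc k)) x)) \<le> norm x / c / c\<^sup>2" by (simp only:)
    then have "norm (G 0 (G (- int (Suc k)) x)) \<le> (norm x / c / c\<^sup>2) / real (Suc m)"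
      by (subst pos_le_divide_eq) (simp_all only: mult.commute of_nat_0_less_iff zero_less_Suc)
    then show ?thesis by simp
  qed
  have "(\<lambda>m. (norm x / c / c\<^sup>2) * (1 / real (Suc m))) \<longlonglongrightarrow> (norm x / c / c\<^sup>2) * 0"
    using LIMSEQ_Suc[OF lim_inverse_n'] by (intro tendsto_intros) simp
  then have "norm (G 0 (G (- int (Suc k)) x)) \<le> (norm x / c / c\<^sup>2) * 0"
    by (rule LIMSEQ_le_const) (use le in blast)
  then show ?thesis by simp
qed

end

text \<open>Decay of order 1/n makes \<open>f N\<close> a contraction with factor 1/2 for one large
  N, and the semigroup law iterates it.\<close>

lemma semigroup_exponential_decay:
  fixes f :: "nat \<Rightarrow> 'a::real_normed_vector \<Rightarrow> 'a"
  assumes semi: "\<And>m n x. f (m + n) x = f m (f n x)"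
    and bound: "\<And>n x. real (Suc n) * norm (f n x) \<le> C * norm x" and C: "C > 0"
  shows "\<exists>K \<rho>. K > 0 \<and> 0 < \<rho> \<and> \<rho> < 1 \<and> (\<forall>n x. norm (f n x) \<le> K * \<rho> ^ n * norm x)"
proof -
  obtain N where N: "2 * C \<le> real N" using real_arch_simple by blast
  then have Npos: "N > 0" using C by (cases N) auto
  have bd: "norm (f n x) \<le> C * norm x" for n x
  proof -
    have "1 * norm (f n x) \<le> real (Suc n) * norm (f n x)" by (intro mult_right_mono) auto
    then show ?thesis using bound[of n x] by linarith
  qed
  have half: "norm (f N x) \<le> norm x / 2" for x
  proof -
    have "2 * C * norm (f N x) \<le> real (Suc N) * norm (f N x)" using N by (intro mult_right_mono) auto
    then have "C * (2 * norm (f N x)) \<le> C * norm x" using bound[of N x] by simp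
    then show ?thesis using C by simp
  qed
  have pw: "norm (f (q * N + r) x) \<le> (1/2) ^ q * (C * norm x)" for q r x
  proof (induction q)
    case (Suc q)
    have "f (Suc q * N + r) x = f N (f (q * N + r) x)" by (simp add: semi[symmetric] add.assoc)
    then show ?case using half[of "f (q * N + r) x"] Suc by simp
  qed (simp add: bd)
  \<comment> \<open>The rate is fixed by \<open>\<rho> ^ N = 1/2\<close>. The incomplete block of n
    mod N steps costs at most a factor 2, whence the constant \<open>2 * C\<close>.\<close>
  define \<rho> where "\<rho> = root N (1/2)"
  have r: "0 < \<rho>" "\<rho> < 1" "\<rho> ^ N = 1/2" using Npos by (auto simp: \<rho>_def real_root_pow_pos2)
  have "norm (f n x) \<le> (2 * C) * \<rho> ^ n * norm x" for n x
  proof -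
    have n: "n = (n div N) * N + n mod N" by simp
    have "(1/2) ^ (n div N) = \<rho> ^ ((n div N) * N)" by (simp add: mult.commute[of _ N] power_mult r)
    also have "\<dots> \<le> 2 * \<rho> ^ n"
    proof -
      have "\<rho> ^ N \<le> \<rho> ^ (n mod N)" using r Npos by (intro power_decreasing) auto
      then have "\<rho> ^ ((n div N) * N) * 1 \<le> \<rho> ^ ((n div N) * N) * (2 * \<rho> ^ (n mod N))"
        using r by (intro mult_left_mono) auto
      also have "\<dots> = 2 * \<rho> ^ n" by (simp add: power_add[symmetric])
      finally show ?thesis by simp
    qed
    finally have "(1/2) ^ (n div N) * (C * norm x) \<le> 2 * \<rho> ^ n * (C * norm x)"
      using C by (intro mult_right_mono) auto
    with pw[of "n div N" "n mod N" x] show ?thesis by (simp add: mult_ac)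
  qed
  then show ?thesis using r C by (intro exI[of _ "2 * C"] exI[of _ \<rho>]) auto
qed

text \<open>\<open>J\<close> is the inverse of \<open>A\<close> on the kernel of \<open>P\<close>,
  extended by zero to the range of \<open>P\<close>. Negative powers of \<open>A\<close> on the
  unstable subspace thus become powers of an operator on the whole space.\<close>

locale exp_dichotomy =
  fixes A P J :: "'x::complex_hilbert \<Rightarrow> 'x" and K \<rho> :: real
  assumes A_clinear: "bounded_clinear A" and P_clinear: "bounded_clinear P" and J_clinear: "bounded_clinear J"
    and P_idem: "P (P x) = P x" and A_P: "A (P x) = P (A x)"
    and A_J: "A (J x) = x - P x" and J_A: "J (A x) = x - P x" and P_J: "P (J x) = 0" and J_P: "J (P x) = 0"
    and K_pos: "K > 0" and rho_pos: "0 < \<rho>" and rho_less: "\<rho> < 1"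
    and decay_plus: "norm ((A ^^ n) (P x)) \<le> K * \<rho> ^ n * norm x"
    and decay_minus: "norm ((J ^^ n) (x - P x)) \<le> K * \<rho> ^ n * norm x"

theorem dichotomy_imp_exp_dichotomy:
  fixes A :: "'x::complex_hilbert \<Rightarrow> 'x"
  assumes "bounded_clinear A" "has_dichotomy A"
  obtains J K \<rho> where "exp_dichotomy A (riesz_projection A) J K \<rho>"
proof -
  obtain c where c: "c > 0" "\<And>z v. cmod z = 1 \<Longrightarrow> c * norm v \<le> norm (z *\<^sub>C v - A v)"
    using resolvent_lower_bound[OF assms] by blast
  interpret circle_resolvent A c by unfold_locales (use assms c in auto)
  define P where "P = G 0"
  \<comment> \<open>By \<open>G_Suc\<close> at index -1, \<open>A (G (-1) x) = P x - x\<close>; the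
    negative sign turns this into an inverse of \<open>A\<close> on the complement.\<close>
  define J where "J x = - G (-1) x" for x
  have PJ: "P (J x) = 0" for x
    using P_G_neg[of 0 x] by (simp add: P_def J_def bounded_clinear_minus[OF G_clinear])
  have AJ: "A (J x) = x - P x" for x
    by (simp add: J_def bounded_clinear_minus[OF A] G_Suc P_def)
  have JA: "J (A x) = x - P x" for x
    using AJ by (simp add: J_def G_A bounded_clinear_minus[OF A])
  have AP: "A (P x) = P (A x)" for x by (simp add: P_def G_A)
  have Pcl: "bounded_clinear P" unfolding P_def by (rule G_clinear)
  have Jcl: "bounded_clinear J" unfolding J_def by (rule bounded_clinear_minus_op[OF G_clinear])
  \<comment> \<open>P (x - P x) = P A J x = A P J x = 0, so idempotence reduces to
    \<open>P_G_neg\<close>.\<close>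
  have PP: "P (P x) = P x" for x
  proof -
    have "P (x - P x) = A (P (J x))" by (simp add: AP AJ[symmetric])
    then show ?thesis by (simp add: PJ bounded_clinear_simps[OF A] bounded_clinear_diff[OF Pcl])
  qed
  have JP: "J (P x) = 0" for x
  proof -
    have "A (J (P x)) = 0" by (simp add: AJ PP)
    then have "J (A (J (P x))) = 0" by (simp add: bounded_clinear_zero[OF Jcl])
    then show ?thesis by (simp add: JA PJ)
  qed
  have APn: "(A ^^ n) (P x) = P ((A ^^ n) x)" for n x by (induction n) (auto simp: AP)
  have JQ: "J (x - P x) = J x - P (J x)" for x by (simp add: bounded_clinear_diff[OF Jcl] JP PJ)
  have JQn: "(J ^^ n) (x - P x) = (J ^^ n) x - P ((J ^^ n) x)" for n x by (induction n) (auto simp: JQ)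
  have fA: "(A ^^ n) (P x) = G (int n) x" for n x using A_pow_G[of n 0 x] by (simp add: P_def)
  \<comment> \<open>Powers of \<open>J\<close> on the complement are, up to sign, negative Fourier
    coefficients, which brings in their decay. The exponent 0 is separate because \<open>G 0\<close>
    is \<open>P\<close> and not the complementary projection.\<close>
  have fJ: "(J ^^ n) (x - P x) = (if n = 0 then x - P x else - G (- int n) x)" for n x
  proof (cases n)
    case (Suc k)
    define y where "y = G (- int (Suc k)) x"
    have Py: "P y = 0" unfolding y_def P_def by (rule P_G_neg)
    have "(J ^^ m) ((A ^^ m) y) = y" for m
    proof (induction m)
      case (Suc m)
      have "J ((A ^^ Suc m) y) = (A ^^ m) y - P ((A ^^ m) y)" by (simp add: JA)
      also have "\<dots> = (A ^^ m) y" by (simp only: APn[symmetric] Py bounded_clinear_zero[OF bounded_clinear_funpow[OF A]]) simp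
      finally show ?case using Suc by (simp add: funpow_swap1)
    qed simp
    from this[of "Suc k"] have "(J ^^ Suc k) (A ((A ^^ k) y)) = y" by simp
    moreover have "(A ^^ k) y = G (- int (Suc 0)) x" using A_pow_G_neg[of k 0 x] by (simp add: y_def)
    ultimately have "(J ^^ Suc k) (- (x - P x)) = y" by (simp add: G_Suc P_def)
    then have "- (J ^^ Suc k) (x - P x) = y"
      by (simp only: bounded_clinear_minus[OF bounded_clinear_funpow[OF Jcl]])
    then show ?thesis using Suc by (simp add: y_def del: funpow.simps) (metis minus_minus)
  qed simp
  have "\<exists>K \<rho>. K > 0 \<and> 0 < \<rho> \<and> \<rho> < 1 \<and> (\<forall>n x. norm ((A ^^ n) (P x)) \<le> K * \<rho> ^ n * norm x)"
  proof (rule semigroup_exponential_decay)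
    show "(A ^^ (m + n)) (P x) = (A ^^ m) (P ((A ^^ n) (P x)))" for m n x
      by (simp add: funpow_add APn PP)
    show "real (Suc n) * norm ((A ^^ n) (P x)) \<le> (1 / c\<^sup>2) * norm x" for n x
      using G_bound_nonneg[of n x] by (simp add: fA)
  qed (use c in simp)
  then obtain K1 \<rho>1 where 1: "K1 > 0" "0 < \<rho>1" "\<rho>1 < 1" "\<And>n x. norm ((A ^^ n) (P x)) \<le> K1 * \<rho>1 ^ n * norm x"
    by blast
  have "\<exists>K \<rho>. K > 0 \<and> 0 < \<rho> \<and> \<rho> < 1 \<and> (\<forall>n x. norm ((J ^^ n) (x - P x)) \<le> K * \<rho> ^ n * norm x)"
  proof (rule semigroup_exponential_decay)
    show "(J ^^ (m + n)) (x - P x) = (J ^^ m) ((J ^^ n) (x - P x) - P ((J ^^ n) (x - P x)))" for m n x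
    proof -
      have "P ((J ^^ n) (x - P x)) = 0" by (cases n) (auto simp: PJ PP bounded_clinear_diff[OF Pcl])
      then show ?thesis by (simp add: funpow_add)
    qed
    \<comment> \<open>The summand 1 in the constant pays for n = 0, where norm (x - P x) is at most
      (1 + 1 / c) norm x.\<close>
    show "real (Suc n) * norm ((J ^^ n) (x - P x)) \<le> (1 / c\<^sup>2 + 2 / c + 1) * norm x" for n x
    proof (cases n)
      case 0
      have "norm (x - P x) \<le> norm x + norm x / c"
        using norm_triangle_ineq4[of x "P x"] G_bound[of 0 x] by (simp add: P_def)
      also have "\<dots> \<le> (1 / c\<^sup>2 + 2 / c + 1) * norm x" using c by (simp add: field_simps)
      finally show ?thesis using 0 by simp
    next
      case (Suc k)
      have "real (Suc n) * norm ((J ^^ n) (x - P x)) = real (Suc n) * norm (G (- int n) x)"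
        unfolding fJ using Suc by simp
      also have "\<dots> \<le> (1 / c\<^sup>2 + 2 / c) * norm x" by (rule G_bound_neg)
      also have "\<dots> \<le> (1 / c\<^sup>2 + 2 / c + 1) * norm x" by (intro mult_right_mono) auto
      finally show ?thesis .
    qed
  qed (use c in \<open>simp add: add_pos_pos\<close>)
  then obtain K2 \<rho>2 where 2: "K2 > 0" "0 < \<rho>2" "\<rho>2 < 1" "\<And>n x. norm ((J ^^ n) (x - P x)) \<le> K2 * \<rho>2 ^ n * norm x"
    by blast
  have "exp_dichotomy A P J (max K1 K2) (max \<rho>1 \<rho>2)"
  proof
    fix n x
    have "K1 * \<rho>1 ^ n \<le> max K1 K2 * max \<rho>1 \<rho>2 ^ n" using 1 by (intro mult_mono power_mono) auto
    then show "norm ((A ^^ n) (P x)) \<le> max K1 K2 * max \<rho>1 \<rho>2 ^ n * norm x"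
      using 1(4)[of n x] mult_right_mono[OF _ norm_ge_zero] by (meson order_trans)
    have "K2 * \<rho>2 ^ n \<le> max K1 K2 * max \<rho>1 \<rho>2 ^ n" using 2 by (intro mult_mono power_mono) auto
    then show "norm ((J ^^ n) (x - P x)) \<le> max K1 K2 * max \<rho>1 \<rho>2 ^ n * norm x"
      using 2(4)[of n x] mult_right_mono[OF _ norm_ge_zero] by (meson order_trans)
  qed (use A Pcl Jcl PP AP AJ JA PJ JP 1 2 in auto)
  then show ?thesis using that by (simp add: riesz_eq_G P_def)
qed

section \<open>Trajectories\<close>

definition unit_root :: "nat \<Rightarrow> int \<Rightarrow> complex" where
  "unit_root N m = cis (2 * pi * of_int m / of_nat N)"

lemma unit_root_add: "unit_root N (a + b) = unit_root N a * unit_root N b"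
  by (simp add: unit_root_def cis_mult ring_distribs add_divide_distrib)

lemma unit_root_0 [simp]: "unit_root N 0 = 1"
  by (simp add: unit_root_def)

lemma norm_unit_root [simp]: "cmod (unit_root N m) = 1"
  by (simp add: unit_root_def)

lemma cnj_unit_root: "cnj (unit_root N m) = unit_root N (- m)"
  by (simp add: unit_root_def cis_cnj)

lemma unit_root_multiple: "N > 0 \<Longrightarrow> unit_root N (int N * m) = 1"
  using cis_multiple_2pi[of "of_int m"] by (simp add: unit_root_def mult_ac)

lemma unit_root_eq_1:
  assumes "N > 0" "unit_root N d = 1" shows "int N dvd d"
proof -
  have "cos (2 * pi * of_int d / of_nat N) = 1" using assms(2) by (simp add: unit_root_def complex_eq_iff)
  then obtain m :: int where "2 * pi * of_int d / of_nat N = of_int m * 2 * pi"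
    using cos_one_2pi_int by blast
  then have "real_of_int d = of_int (int N * m)" using assms(1) by (simp add: field_simps)
  then have "d = int N * m" by linarith
  then show ?thesis by simp
qed

text \<open>Multiplication by \<open>unit_root N d\<close> moves the summation window by one, which
  only exchanges two equal end terms; so the sum vanishes unless that root is 1.\<close>

lemma sum_unit_root:
  assumes N: "N > 0"
  shows "(\<Sum>n\<in>{a..<a + int N}. unit_root N (d * n)) = (if int N dvd d then of_nat N else 0)"
proof (cases "int N dvd d")
  case True
  then obtain q where "d = int N * q" by blast
  then have "unit_root N (d * n) = 1" for n using unit_root_multiple[OF N, of "q * n"] by (simp add: mult.assoc)
  then show ?thesis using True by simp
next
  case False
  let ?S = "\<Sum>n\<in>{a..<a + int N}. unit_root N (d * n)"
  have "unit_root N d * ?S = (\<Sum>n\<in>{a..<a + int N}. unit_root N (d * (n + 1)))"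
    by (simp add: sum_distrib_left unit_root_add[symmetric] algebra_simps)
  also have "\<dots> = (\<Sum>n\<in>{a + 1..<a + int N + 1}. unit_root N (d * n))"
    by (rule sum.reindex_bij_witness[of _ "\<lambda>n. n - 1" "\<lambda>n. n + 1"]) auto
  also have "\<dots> = ?S"
  proof -
    have "{a..<a + int N + 1} = insert (a + int N) {a..<a + int N}" using N by auto
    moreover have "{a..<a + int N + 1} = insert a {a + 1..<a + int N + 1}" using N by auto
    ultimately have "unit_root N (d * (a + int N)) + ?S = unit_root N (d * a) + (\<Sum>n\<in>{a + 1..<a + int N + 1}. unit_root N (d * n))"
      by (metis (no_types, lifting) add.commute atLeastLessThan_iff finite_atLeastLessThan_int less_irrefl sum.insert zless_add1_eq not_le)
    moreover have "unit_root N (d * (a + int N)) = unit_root N (d * a)"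
      using unit_root_multiple[OF N, of d] by (simp add: ring_distribs unit_root_add mult.commute)
    ultimately show ?thesis by simp
  qed
  finally have "(unit_root N d - 1) * ?S = 0" by (simp add: algebra_simps)
  then show ?thesis using False unit_root_eq_1[OF N] by auto
qed

lemma discrete_parseval:
  fixes a :: "int \<Rightarrow> 'a::complex_hilbert"
  assumes N: "N > 0"
  shows "(\<Sum>n\<in>{b..<b + int N}. (norm (\<Sum>k\<in>{0..<int N}. unit_root N (- (k * n)) *\<^sub>C a k))\<^sup>2)
    = of_nat N * (\<Sum>k\<in>{0..<int N}. (norm (a k))\<^sup>2)" (is "?L = ?R")
proof -
  have dvd: "int N dvd (l - k) \<longleftrightarrow> k = l" if "k \<in> {0..<int N}" "l \<in> {0..<int N}" for k l
  proof
    assume "int N dvd l - k"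
    moreover have "\<bar>l - k\<bar> < int N" using that by auto
    ultimately show "k = l" by (metis dvd_imp_le_int eq_iff_diff_eq_0 leD abs_of_nat)
  qed simp
  have "complex_of_real ?L = (\<Sum>n\<in>{b..<b + int N}. \<Sum>k\<in>{0..<int N}. \<Sum>l\<in>{0..<int N}.
      unit_root N ((l - k) * n) * cinner (a k) (a l))"
    unfolding of_real_sum cinner_self[symmetric]
  proof (rule sum.cong[OF refl])
    fix n
    have eq: "unit_root N ((l - k) * n) = unit_root N (- (k * n)) * cnj (unit_root N (- (l * n)))" for k l
      by (simp add: cnj_unit_root unit_root_add[symmetric] left_diff_distrib)
    show "cinner (\<Sum>k\<in>{0..<int N}. unit_root N (- (k * n)) *\<^sub>C a k) (\<Sum>k\<in>{0..<int N}. unit_root N (- (k * n)) *\<^sub>C a k)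
      = (\<Sum>k\<in>{0..<int N}. \<Sum>l\<in>{0..<int N}. unit_root N ((l - k) * n) * cinner (a k) (a l))"
      unfolding eq cinner_sum_left
      by (simp only: cinner_sum_right cinner_scaleC_left cinner_scaleC_right sum_distrib_left)
         (simp only: mult_ac)
  qed
  also have "\<dots> = (\<Sum>k\<in>{0..<int N}. \<Sum>l\<in>{0..<int N}. (\<Sum>n\<in>{b..<b + int N}. unit_root N ((l - k) * n)) * cinner (a k) (a l))"
    unfolding sum_distrib_right
    by (rule trans[OF sum.swap]) (rule sum.cong[OF refl], rule sum.swap)
  also have "\<dots> = (\<Sum>k\<in>{0..<int N}. \<Sum>l\<in>{0..<int N}. if k = l then of_nat N * cinner (a k) (a k) else 0)"
    unfolding sum_unit_root[OF N] by (intro sum.cong refl) (auto simp: dvd)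
  also have "\<dots> = (\<Sum>k\<in>{0..<int N}. of_nat N * cinner (a k) (a k))"
    by (intro sum.cong refl) (simp add: sum.delta)
  also have "\<dots> = complex_of_real ?R"
    by (simp add: cinner_self sum_distrib_left)
  finally show ?thesis by (simp only: of_real_eq_iff)
qed

lemma discrete_fourier_inversion:
  fixes u :: "int \<Rightarrow> 'a::complex_hilbert"
  assumes N: "N > 0" and n: "n \<in> {b..<b + int N}"
  shows "(\<Sum>k\<in>{0..<int N}. unit_root N (- (k * n)) *\<^sub>C
      ((1 / of_nat N) *\<^sub>C (\<Sum>m\<in>{b..<b + int N}. unit_root N (k * m) *\<^sub>C u m))) = u n"
proof -
  have dvd: "int N dvd (m - n) \<longleftrightarrow> m = n" if "m \<in> {b..<b + int N}" for m
  proof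
    assume "int N dvd m - n"
    moreover have "\<bar>m - n\<bar> < int N" using that n by auto
    ultimately show "m = n" by (metis dvd_imp_le_int eq_iff_diff_eq_0 leD abs_of_nat)
  qed simp
  have "(\<Sum>k\<in>{0..<int N}. unit_root N (- (k * n)) *\<^sub>C
      ((1 / of_nat N) *\<^sub>C (\<Sum>m\<in>{b..<b + int N}. unit_root N (k * m) *\<^sub>C u m)))
     = (\<Sum>k\<in>{0..<int N}. \<Sum>m\<in>{b..<b + int N}. ((1 / of_nat N) * unit_root N ((m - n) * k)) *\<^sub>C u m)"
    by (intro sum.cong refl) (simp add: scaleC_sum_right scaleC_scaleC mult_ac unit_root_add[symmetric] algebra_simps)
  also have "\<dots> = (\<Sum>m\<in>{b..<b + int N}. ((1 / of_nat N) * (\<Sum>k\<in>{0..<0 + int N}. unit_root N ((m - n) * k))) *\<^sub>C u m)"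
    by (subst sum.swap) (simp add: scaleC_sum_left sum_distrib_left)
  also have "\<dots> = (\<Sum>m\<in>{b..<b + int N}. if m = n then u m else 0)"
    unfolding sum_unit_root[OF N] using N by (intro sum.cong refl) (auto simp: dvd)
  also have "\<dots> = u n" using n by (simp add: sum.delta)
  finally show ?thesis .
qed

context exp_dichotomy
begin

lemma P_A_pow: "P ((A ^^ n) x) = (A ^^ n) (P x)"
  by (induction n) (auto simp: A_P[symmetric])

lemma J_pow_A_pow: "(J ^^ n) ((A ^^ n) v - P ((A ^^ n) v)) = v - P v"
proof (induction n)
  case (Suc n)
  let ?y = "(A ^^ n) v"
  have "J (A ?y - P (A ?y)) = ?y - P ?y"
    by (simp add: A_P[symmetric] bounded_clinear_diff[OF J_clinear] J_A P_idem)
  with Suc show ?case by (simp add: funpow_swap1)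
qed simp

text \<open>The solution is squeezed from both ends of the window: its stable part at n is m forward
  steps away from the left end, its unstable part m backward steps away from the right end. Errors
  at the ends are therefore damped in the middle.\<close>

lemma homogeneous_solution_bound:
  fixes d :: "int \<Rightarrow> 'x"
  assumes rec: "\<And>i. n - int m \<le> i \<Longrightarrow> i < n + int m \<Longrightarrow> d (i + 1) = A (d i)"
    and M: "norm (d (n - int m)) \<le> M" "norm (d (n + int m)) \<le> M"
  shows "norm (d n) \<le> 2 * K * \<rho> ^ m * M"
proof -
  have "d (n - int m + int i) = (A ^^ i) (d (n - int m))" if "i \<le> 2 * m" for i
    using that
  proof (induction i)
    case (Suc i)
    have "d (n - int m + int i + 1) = A (d (n - int m + int i))" using Suc.prems by (intro rec) auto
    then show ?case using Suc by (simp add: algebra_simps)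
  qed simp
  note step = this
  have 1: "d n = (A ^^ m) (d (n - int m))" using step[of m] by simp
  have "d (n + int m) = (A ^^ (m + m)) (d (n - int m))"
    using step[of "m + m"] by (simp add: algebra_simps)
  then have 2: "d (n + int m) = (A ^^ m) (d n)" by (simp add: funpow_add 1)
  have "norm (P (d n)) \<le> K * \<rho> ^ m * norm (d (n - int m))"
    unfolding 1 P_A_pow by (rule decay_plus)
  also have "\<dots> \<le> K * \<rho> ^ m * M" using M K_pos rho_pos by (intro mult_left_mono) auto
  finally have a: "norm (P (d n)) \<le> K * \<rho> ^ m * M" .
  have "norm (d n - P (d n)) \<le> K * \<rho> ^ m * norm (d (n + int m))"
    unfolding J_pow_A_pow[of m "d n", symmetric] 2 by (rule decay_minus)
  also have "\<dots> \<le> K * \<rho> ^ m * M" using M K_pos rho_pos by (intro mult_left_mono) auto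
  finally have "norm (d n - P (d n)) \<le> K * \<rho> ^ m * M" .
  with a show ?thesis using norm_triangle_ineq[of "d n - P (d n)" "P (d n)"] by simp
qed

end

section \<open>Bounded trajectories, periodic inputs and reachable states\<close>

locale dichotomous_system = exp_dichotomy A P J K \<rho>
  for A P J :: "'x::complex_hilbert \<Rightarrow> 'x" and K \<rho> :: real +
  fixes B :: "'u::complex_hilbert \<Rightarrow> 'x" and C :: "'x \<Rightarrow> 'y::complex_hilbert" and D :: "'u \<Rightarrow> 'y"
  assumes B_clinear: "bounded_clinear B" and C_clinear: "bounded_clinear C" and D_clinear: "bounded_clinear D"
begin

definition trajectory :: "(int \<Rightarrow> 'u) \<Rightarrow> (int \<Rightarrow> 'x) \<Rightarrow> bool" where
  "trajectory u x \<longleftrightarrow> (\<forall>n. x (n + 1) = A (x n) + B (u n)) \<and> (\<exists>M. \<forall>n. norm (x n) \<le> M)"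

definition out_seq :: "(int \<Rightarrow> 'u) \<Rightarrow> (int \<Rightarrow> 'x) \<Rightarrow> int \<Rightarrow> 'y" where
  "out_seq u x n = C (x n) + D (u n)"

text \<open>The \<open>N\<close>-periodic input that agrees with \<open>u\<close> on a window of length \<open>N\<close> has an \<open>N\<close>-periodic
  trajectory, on which the transfer function acts as a Fourier multiplier at the \<open>N\<close>-th roots of unity.\<close>

lemma periodic_trajectory:
  assumes contr: "\<And>z v. cmod z = 1 \<Longrightarrow>
      \<exists>w. w - z *\<^sub>C A w = B v \<and> norm w \<le> c * norm v \<and> norm (D v + z *\<^sub>C C w) \<le> norm v"
    and c: "c \<ge> 0" and ub: "\<And>n. norm (u n) \<le> U"
  shows "\<exists>x. (\<forall>n\<in>{-int M..<int M}. x (n + 1) = A (x n) + B (u n)) \<and> (\<forall>n. norm (x n) \<le> real (2 * M) * (c * U))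
    \<and> (\<Sum>n\<in>{-int M..<int M}. (norm (out_seq u x n))\<^sup>2) \<le> (\<Sum>n\<in>{-int M..<int M}. (norm (u n))\<^sup>2)"
proof (cases "M = 0")
  case True
  have "norm (u 0) \<ge> 0" by simp
  then show ?thesis using True by (intro exI[of _ "\<lambda>_. 0"]) auto
next
  case False
  define N where "N = 2 * M"
  have N: "N > 0" using False by (simp add: N_def)
  define W where "W = {- int M..<- int M + int N}"
  have W: "W = {- int M..<int M}" by (auto simp: W_def N_def)
  define I where "I = {0..<int N}"
  define h where "h k = (1 / of_nat N) *\<^sub>C (\<Sum>m\<in>W. unit_root N (k * m) *\<^sub>C u m)" for k
  have "U \<ge> 0" using ub[of 0] norm_ge_zero order_trans by blast
  have hU: "norm (h k) \<le> U" for k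
  proof -
    have "norm (\<Sum>m\<in>W. unit_root N (k * m) *\<^sub>C u m) \<le> (\<Sum>m\<in>W. U)"
      by (rule sum_norm_le) (simp add: ub)
    then show ?thesis using N by (simp add: h_def W_def norm_divide field_simps)
  qed
  obtain w where w: "\<And>z v. cmod z = 1 \<Longrightarrow> w z v - z *\<^sub>C A (w z v) = B v"
      "\<And>z v. cmod z = 1 \<Longrightarrow> norm (w z v) \<le> c * norm v"
      "\<And>z v. cmod z = 1 \<Longrightarrow> norm (D v + z *\<^sub>C C (w z v)) \<le> norm v"
    using contr by metis
  define g where "g k = w (unit_root N k) (h k)" for k
  \<comment> \<open>Each frequency contributes z^(-n) z w, where z = \<open>unit_root N k\<close>
    and w - z A w = B v. One time step takes z w to w = A (z w) + B v, which is the origin of the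
    extra factor \<open>unit_root N k\<close>.\<close>
  define x where "x n = (\<Sum>k\<in>I. unit_root N (- (k * n)) *\<^sub>C (unit_root N k *\<^sub>C g k))" for n
  have inv: "(\<Sum>k\<in>I. unit_root N (- (k * n)) *\<^sub>C h k) = u n" if "n \<in> W" for n
    using discrete_fourier_inversion[OF N, of n "- int M" u] that unfolding I_def h_def W_def by simp
  have rec: "x (n + 1) = A (x n) + B (u n)" if "n \<in> W" for n
  proof -
    have "A (x n) + B (u n) = (\<Sum>k\<in>I. unit_root N (- (k * n)) *\<^sub>C (unit_root N k *\<^sub>C A (g k) + B (h k)))"
      unfolding inv[OF that, symmetric] x_def
      by (simp add: bounded_clinear_sum[OF A_clinear] bounded_clinear_sum[OF B_clinear] sum.distrib
          bounded_clinear_scaleC[OF A_clinear] bounded_clinear_scaleC[OF B_clinear] scaleC_add_right)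
    also have "\<dots> = (\<Sum>k\<in>I. unit_root N (- (k * n)) *\<^sub>C g k)"
    proof (intro sum.cong refl)
      fix k
      have "B (h k) = g k - unit_root N k *\<^sub>C A (g k)"
        using w(1)[of "unit_root N k" "h k"] by (simp add: g_def)
      then show "unit_root N (- (k * n)) *\<^sub>C (unit_root N k *\<^sub>C A (g k) + B (h k)) = unit_root N (- (k * n)) *\<^sub>C g k"
        by simp
    qed
    also have "\<dots> = x (n + 1)"
      unfolding x_def by (intro sum.cong refl) (simp add: scaleC_scaleC unit_root_add[symmetric] algebra_simps)
    finally show ?thesis by simp
  qed
  \<comment> \<open>Estimating frequency by frequency loses a factor N. The loss is harmless, since
    the comparison with the true trajectory gains an exponential factor.\<close>
  have bd: "norm (x n) \<le> real N * (c * U)" for n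
  proof -
    have "norm (x n) \<le> (\<Sum>k\<in>I. c * U)"
      unfolding x_def
    proof (rule sum_norm_le)
      fix k
      have "norm (g k) \<le> c * norm (h k)" unfolding g_def by (rule w) simp
      also have "\<dots> \<le> c * U" using hU c by (intro mult_left_mono) auto
      finally show "norm (unit_root N (- (k * n)) *\<^sub>C unit_root N k *\<^sub>C g k) \<le> c * U" by simp
    qed
    then show ?thesis by (simp add: I_def)
  qed
  have out: "out_seq u x n = (\<Sum>k\<in>I. unit_root N (- (k * n)) *\<^sub>C (D (h k) + unit_root N k *\<^sub>C C (g k)))" if "n \<in> W" for n
    unfolding out_seq_def inv[OF that, symmetric] x_def
    by (simp add: bounded_clinear_sum[OF C_clinear] bounded_clinear_sum[OF D_clinear] sum.distrib
        bounded_clinear_scaleC[OF C_clinear] bounded_clinear_scaleC[OF D_clinear] scaleC_add_right add.commute)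
  have "(\<Sum>n\<in>W. (norm (out_seq u x n))\<^sup>2)
      = (\<Sum>n\<in>W. (norm (\<Sum>k\<in>I. unit_root N (- (k * n)) *\<^sub>C (D (h k) + unit_root N k *\<^sub>C C (g k))))\<^sup>2)"
    by (intro sum.cong refl) (simp add: out)
  also have "\<dots> = real N * (\<Sum>k\<in>I. (norm (D (h k) + unit_root N k *\<^sub>C C (g k)))\<^sup>2)"
    unfolding W_def I_def by (rule discrete_parseval[OF N])
  also have "\<dots> \<le> real N * (\<Sum>k\<in>I. (norm (h k))\<^sup>2)"
    unfolding g_def by (intro mult_left_mono sum_mono power_mono w) auto
  also have "\<dots> = (\<Sum>n\<in>W. (norm (\<Sum>k\<in>I. unit_root N (- (k * n)) *\<^sub>C h k))\<^sup>2)"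
    unfolding W_def I_def by (rule discrete_parseval[OF N, symmetric])
  also have "\<dots> = (\<Sum>n\<in>W. (norm (u n))\<^sup>2)" by (intro sum.cong refl) (simp add: inv)
  finally show ?thesis using rec bd unfolding W N_def by blast
qed

text \<open>On a window of radius M the given trajectory and the periodic one differ by a
  homogeneous solution whose size grows at most linearly in M. The dichotomy damps it exponentially
  in the interior, so the periodic states converge pointwise, and the energy bound on a finite set
  of times survives the limit.\<close>

theorem trajectory_contractive:
  assumes contr: "\<And>z v. cmod z = 1 \<Longrightarrow>
      \<exists>w. w - z *\<^sub>C A w = B v \<and> norm w \<le> c * norm v \<and> norm (D v + z *\<^sub>C C w) \<le> norm v"
    and c: "c \<ge> 0" and traj: "trajectory u x"
    and S: "\<And>F. finite F \<Longrightarrow> (\<Sum>n\<in>F. (norm (u n))\<^sup>2) \<le> S" and F: "finite F"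
  shows "(\<Sum>n\<in>F. (norm (out_seq u x n))\<^sup>2) \<le> S"
proof -
  have ub: "norm (u n) \<le> sqrt S" for n using S[of "{n}"] by (simp add: real_le_rsqrt)
  have "S \<ge> 0" using S[of "{}"] by simp
  obtain X where X: "\<And>n. norm (x n) \<le> X" using traj unfolding trajectory_def by blast
  define Q where "Q M z \<longleftrightarrow> (\<forall>n\<in>{-int M..<int M}. z (n + 1) = A (z n) + B (u n)) \<and> (\<forall>n. norm (z n) \<le> real (2 * M) * (c * sqrt S))
    \<and> (\<Sum>n\<in>{-int M..<int M}. (norm (out_seq u z n))\<^sup>2) \<le> (\<Sum>n\<in>{-int M..<int M}. (norm (u n))\<^sup>2)" for M z
  have "\<forall>M. \<exists>z. Q M z" unfolding Q_def by (intro allI periodic_trajectory[OF contr c ub])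
  then obtain xs where "\<forall>M. Q M (xs M)" using choice by blast
  then have xs: "\<And>M n. n \<in> {-int M..<int M} \<Longrightarrow> xs M (n + 1) = A (xs M n) + B (u n)"
     "\<And>M n. norm (xs M n) \<le> real (2 * M) * (c * sqrt S)"
     "\<And>M. (\<Sum>n\<in>{-int M..<int M}. (norm (out_seq u (xs M) n))\<^sup>2) \<le> (\<Sum>n\<in>{-int M..<int M}. (norm (u n))\<^sup>2)"
    unfolding Q_def by blast+
  have lim: "(\<lambda>M. xs M n) \<longlonglongrightarrow> x n" for n
  proof -
    \<comment> \<open>Around the fixed time n the equation holds on a window of radius M - k, which
      lies inside the periodic window of radius M.\<close>
    define k where "k = nat \<bar>n\<bar>"
    define b where "b M = 2 * K * \<rho> ^ (M - k) * (X + real (2 * M) * (c * sqrt S))" for M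
    have le: "norm (xs M n - x n) \<le> b M" if M: "M \<ge> k" for M
    proof -
      define d where "d i = xs M i - x i" for i
      have dn: "norm (d i) \<le> X + real (2 * M) * (c * sqrt S)" for i
        using norm_triangle_ineq4[of "xs M i" "x i"] xs(2)[of M i] X[of i] by (simp add: d_def)
      have "norm (d n) \<le> 2 * K * \<rho> ^ (M - k) * (X + real (2 * M) * (c * sqrt S))"
      proof (rule homogeneous_solution_bound)
        fix i assume "n - int (M - k) \<le> i" "i < n + int (M - k)"
        then have "i \<in> {-int M..<int M}" using M unfolding k_def by auto
        then show "d (i + 1) = A (d i)"
          using traj by (simp add: d_def xs(1) trajectory_def bounded_clinear_diff[OF A_clinear])
      qed (rule dn)+
      then show ?thesis by (simp add: d_def b_def)
    qed
    have eq: "b M = (2 * K / \<rho> ^ k * X) * \<rho> ^ M + (4 * K / \<rho> ^ k * c * sqrt S) * (real M * \<rho> ^ M)" if "M \<ge> k" for M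
      using that rho_pos unfolding b_def by (simp add: power_diff field_simps)
    have "(\<lambda>M. (2 * K / \<rho> ^ k * X) * \<rho> ^ M + (4 * K / \<rho> ^ k * c * sqrt S) * (real M * \<rho> ^ M)) \<longlonglongrightarrow>
        (2 * K / \<rho> ^ k * X) * 0 + (4 * K / \<rho> ^ k * c * sqrt S) * 0"
      using rho_pos rho_less powser_times_n_limit_0[of \<rho>]
      by (intro tendsto_intros LIMSEQ_realpow_zero) auto
    then have "b \<longlonglongrightarrow> 0"
      by (intro Lim_transform_eventually[where g = b]) (auto intro!: eventually_sequentiallyI[of k] simp: eq)
    then have "(\<lambda>M. xs M n - x n) \<longlonglongrightarrow> 0"
      by (rule Lim_null_comparison[rotated]) (auto intro!: eventually_sequentiallyI[of k] le)
    then show ?thesis by (simp add: LIM_zero_iff)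
  qed
  have "(\<lambda>M. \<Sum>n\<in>F. (norm (out_seq u (xs M) n))\<^sup>2) \<longlonglongrightarrow> (\<Sum>n\<in>F. (norm (out_seq u x n))\<^sup>2)"
    unfolding out_seq_def
    by (intro tendsto_intros bounded_linear.tendsto[OF bounded_clinear_bounded_linear[OF C_clinear]] lim)
  moreover have "\<exists>N. \<forall>M\<ge>N. (\<Sum>n\<in>F. (norm (out_seq u (xs M) n))\<^sup>2) \<le> S"
  proof -
    obtain k where k: "\<And>n. n \<in> F \<Longrightarrow> \<bar>n\<bar> < k"
      using finite_imageI[OF F, of abs] Max_ge[of "abs ` F"] by (metis image_eqI less_add_one order_le_less_trans zle_add1_eq_le)
    show ?thesis
    proof (intro exI[of _ "nat k"] allI impI)
      fix M assume M: "nat k \<le> M"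
      have "F \<subseteq> {-int M..<int M}" using k M by force
      then have "(\<Sum>n\<in>F. (norm (out_seq u (xs M) n))\<^sup>2) \<le> (\<Sum>n\<in>{-int M..<int M}. (norm (out_seq u (xs M) n))\<^sup>2)"
        by (intro sum_mono2) auto
      also have "\<dots> \<le> S" using xs(3)[of M] S[of "{-int M..<int M}"] by simp
      finally show "(\<Sum>n\<in>F. (norm (out_seq u (xs M) n))\<^sup>2) \<le> S" .
    qed
  qed
  ultimately show ?thesis by (rule LIMSEQ_le_const2)
qed

text \<open>Value at time zero of the bounded trajectory driven by \<open>u\<close>: the stable part is summed from
  the past and the unstable part from the future.\<close>

definition reach_plus :: "(int \<Rightarrow> 'u) \<Rightarrow> 'x" where
  "reach_plus u = (\<Sum>j. (A ^^ j) (P (B (u (- int j - 1)))))"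

definition reach_minus :: "(int \<Rightarrow> 'u) \<Rightarrow> 'x" where
  "reach_minus u = (\<Sum>j. - (J ^^ Suc j) (B (u (int j)) - P (B (u (int j)))))"

definition reach :: "(int \<Rightarrow> 'u) \<Rightarrow> 'x" where
  "reach u = reach_plus u + reach_minus u"

lemma reach_terms:
  obtains R where "R > 0"
    "\<And>j v. norm ((A ^^ j) (P (B v))) \<le> R * \<rho> ^ j * norm v"
    "\<And>j v. norm (- (J ^^ Suc j) (B v - P (B v))) \<le> R * \<rho> ^ j * norm v"
proof -
  obtain b where b: "b > 0" "\<And>v. norm (B v) \<le> b * norm v" using bounded_clinear_bound[OF B_clinear] by blast
  have 1: "norm ((A ^^ j) (P (B v))) \<le> K * b * \<rho> ^ j * norm v" for j v
  proof -
    have "norm ((A ^^ j) (P (B v))) \<le> K * \<rho> ^ j * norm (B v)" by (rule decay_plus)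
    also have "\<dots> \<le> K * \<rho> ^ j * (b * norm v)" using K_pos rho_pos by (intro mult_left_mono b) auto
    finally show ?thesis by (simp add: mult_ac)
  qed
  have 2: "norm (- (J ^^ Suc j) (B v - P (B v))) \<le> K * b * \<rho> ^ j * norm v" for j v
  proof -
    have "norm (- (J ^^ Suc j) (B v - P (B v))) \<le> K * \<rho> ^ Suc j * norm (B v)"
      unfolding norm_minus_cancel by (rule decay_minus)
    also have "\<dots> \<le> K * \<rho> ^ j * norm (B v)"
      using K_pos rho_pos rho_less by (intro mult_right_mono mult_left_mono power_decreasing) auto
    also have "\<dots> \<le> K * \<rho> ^ j * (b * norm v)" using K_pos rho_pos by (intro mult_left_mono b) auto
    finally show ?thesis by (simp add: mult_ac)
  qed
  show ?thesis using that[of "K * b"] K_pos b 1 2 by simp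
qed

lemma reach_summable:
  assumes u: "\<And>n. norm (u n) \<le> U"
  shows "summable (\<lambda>j. norm ((A ^^ j) (P (B (u (f j))))))"
    and "summable (\<lambda>j. norm (- (J ^^ Suc j) (B (u (f j)) - P (B (u (f j))))))"
proof -
  obtain R where R: "R > 0"
    "\<And>j v. norm ((A ^^ j) (P (B v))) \<le> R * \<rho> ^ j * norm v"
    "\<And>j v. norm (- (J ^^ Suc j) (B v - P (B v))) \<le> R * \<rho> ^ j * norm v"
    using reach_terms by blast
  have s: "summable (\<lambda>j. R * \<rho> ^ j * U)"
    using rho_pos rho_less by (intro summable_mult summable_mult2 summable_geometric) auto
  have m: "R * \<rho> ^ j * norm (u n) \<le> R * \<rho> ^ j * U" for j n
    using R rho_pos u by (intro mult_left_mono) auto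
  show "summable (\<lambda>j. norm ((A ^^ j) (P (B (u (f j))))))"
    by (rule summable_comparison_test'[OF s, of 0]) (subst real_norm_def, subst abs_norm_cancel, rule order_trans[OF R(2) m])
  show "summable (\<lambda>j. norm (- (J ^^ Suc j) (B (u (f j)) - P (B (u (f j))))))"
    by (rule summable_comparison_test'[OF s, of 0]) (subst real_norm_def, subst abs_norm_cancel, rule order_trans[OF R(3) m])
qed

lemma reach_bound:
  obtains R where "R > 0" "\<And>u U. (\<And>n. norm (u n) \<le> U) \<Longrightarrow> norm (reach u) \<le> R * U"
proof -
  obtain R where R: "R > 0"
    "\<And>j v. norm ((A ^^ j) (P (B v))) \<le> R * \<rho> ^ j * norm v"
    "\<And>j v. norm (- (J ^^ Suc j) (B v - P (B v))) \<le> R * \<rho> ^ j * norm v"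
    using reach_terms by blast
  have "norm (reach u) \<le> (2 * R / (1 - \<rho>)) * U" if u: "\<And>n. norm (u n) \<le> U" for u U
  proof -
    have s: "(\<lambda>j. R * \<rho> ^ j * U) sums (R * (1 / (1 - \<rho>)) * U)"
      using rho_pos rho_less by (intro sums_mult sums_mult2 geometric_sums) auto
    have m: "R * \<rho> ^ j * norm (u n) \<le> R * \<rho> ^ j * U" for j n
      using R rho_pos u by (intro mult_left_mono) auto
    have "norm (reach_plus u) \<le> R * (1 / (1 - \<rho>)) * U"
      unfolding reach_plus_def sums_unique[OF s]
      by (rule order_trans[OF summable_norm[OF reach_summable(1)[OF u]]
            suminf_le[OF order_trans[OF R(2) m] reach_summable(1)[OF u] sums_summable[OF s]]])
    moreover have "norm (reach_minus u) \<le> R * (1 / (1 - \<rho>)) * U"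
      unfolding reach_minus_def sums_unique[OF s]
      by (rule order_trans[OF summable_norm[OF reach_summable(2)[OF u]]
            suminf_le[OF order_trans[OF R(3) m] reach_summable(2)[OF u] sums_summable[OF s]]])
    ultimately show ?thesis using norm_triangle_ineq[of "reach_plus u" "reach_minus u"] by (simp add: reach_def)
  qed
  then show ?thesis using that[of "2 * R / (1 - \<rho>)"] R(1) rho_less by simp
qed

lemma reach_diff:
  assumes "\<And>n. norm (u n) \<le> U" "\<And>n. norm (v n) \<le> V"
  shows "reach (\<lambda>n. u n - v n) = reach u - reach v"
proof -
  note s = summable_norm_cancel[OF reach_summable(1)[OF assms(1)]] summable_norm_cancel[OF reach_summable(1)[OF assms(2)]]
    summable_norm_cancel[OF reach_summable(2)[OF assms(1)]] summable_norm_cancel[OF reach_summable(2)[OF assms(2)]]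
  note JS = bounded_clinear_funpow[OF J_clinear] and AS = bounded_clinear_funpow[OF A_clinear]
  have "reach_plus (\<lambda>n. u n - v n) = reach_plus u - reach_plus v"
    unfolding reach_plus_def by (subst suminf_diff[OF s(1,2)])
      (simp add: bounded_clinear_diff[OF B_clinear] bounded_clinear_diff[OF P_clinear] bounded_clinear_diff[OF AS])
  moreover have "reach_minus (\<lambda>n. u n - v n) = reach_minus u - reach_minus v"
    unfolding reach_minus_def by (subst suminf_diff[OF s(3,4)])
      (simp add: bounded_clinear_diff[OF B_clinear] bounded_clinear_diff[OF P_clinear] bounded_clinear_diff[OF JS]
        bounded_clinear_diff[OF J_clinear] bounded_clinear_add[OF JS] bounded_clinear_add[OF J_clinear] algebra_simps)
  ultimately show ?thesis by (simp add: reach_def)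
qed

lemma reach_scaleR:
  assumes "\<And>n. norm (u n) \<le> U" shows "reach (\<lambda>n. c *\<^sub>R u n) = c *\<^sub>R reach u"
proof -
  note s = summable_norm_cancel[OF reach_summable(1)[OF assms(1)]] summable_norm_cancel[OF reach_summable(2)[OF assms(1)]]
  note JS = bounded_clinear_funpow[OF J_clinear] and AS = bounded_clinear_funpow[OF A_clinear]
  have "reach_plus (\<lambda>n. c *\<^sub>R u n) = c *\<^sub>R reach_plus u"
    unfolding reach_plus_def by (subst suminf_scaleR_right[OF s(1)])
      (simp add: bounded_clinear_scaleR[OF B_clinear] bounded_clinear_scaleR[OF P_clinear] bounded_clinear_scaleR[OF AS])
  moreover have "reach_minus (\<lambda>n. c *\<^sub>R u n) = c *\<^sub>R reach_minus u"
    unfolding reach_minus_def by (subst suminf_scaleR_right[OF s(2)])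
      (simp add: bounded_clinear_scaleR[OF B_clinear] bounded_clinear_scaleR[OF P_clinear] bounded_clinear_scaleR[OF JS]
        bounded_clinear_scaleR[OF J_clinear] scaleR_diff_right[symmetric])
  ultimately show ?thesis by (simp add: reach_def scaleR_add_right)
qed

lemma reach_trajectory:
  assumes u: "\<And>n. norm (u n) \<le> U"
  shows "trajectory u (\<lambda>n. reach (\<lambda>i. u (n + i)))"
  unfolding trajectory_def
proof (intro conjI allI)
  obtain R where R: "R > 0" "\<And>u U. (\<And>n. norm (u n) \<le> U) \<Longrightarrow> norm (reach u) \<le> R * U"
    using reach_bound by blast
  show "\<exists>M. \<forall>n. norm (reach (\<lambda>i. u (n + i))) \<le> M"
    using R(2)[of "\<lambda>i. u (_ + i)" U] u by blast
  fix n
  let ?Q = "\<lambda>v. B v - P (B v)"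
  have u': "norm (u (m + i)) \<le> U" for m i by (rule u)
  have s: "summable (\<lambda>j. (A ^^ j) (P (B (u (m + f j)))))" "summable (\<lambda>j. - (J ^^ Suc j) (?Q (u (m + f j))))" for m f
    using summable_norm_cancel[OF reach_summable(1)[of "\<lambda>i. u (m + i)", OF u']]
      summable_norm_cancel[OF reach_summable(2)[of "\<lambda>i. u (m + i)", OF u']] by blast+
  \<comment> \<open>Advancing the clock by one puts the newest input at the head of the past series
    and applies \<open>A\<close> to the rest.\<close>
  have "reach_plus (\<lambda>i. u (n + 1 + i)) = A (reach_plus (\<lambda>i. u (n + i))) + P (B (u n))"
  proof -
    have s': "summable (\<lambda>j. (A ^^ j) (P (B (u (n + 1 + (- int j - 1))))))" by (rule s(1))
    have "reach_plus (\<lambda>i. u (n + 1 + i)) = (\<Sum>j. (A ^^ Suc j) (P (B (u (n + 1 + (- int (Suc j) - 1)))))) + P (B (u n))"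
      unfolding reach_plus_def using suminf_split_head[OF s'] by simp
    also have "(\<Sum>j. (A ^^ Suc j) (P (B (u (n + 1 + (- int (Suc j) - 1)))))) = A (reach_plus (\<lambda>i. u (n + i)))"
      unfolding reach_plus_def
      by (subst bounded_linear.suminf[OF bounded_clinear_bounded_linear[OF A_clinear] s(1)]) (simp add: algebra_simps)
    finally show ?thesis .
  qed
  moreover have "A (reach_minus (\<lambda>i. u (n + i))) = reach_minus (\<lambda>i. u (n + 1 + i)) - ?Q (u n)"
  proof -
    \<comment> \<open>\<open>A\<close> undoes one factor \<open>J\<close>, so the future series
      loses its first input, which reappears as the term \<open>- ?Q (u n)\<close>.\<close>
    have AJ: "A (- (J ^^ Suc j) (?Q v)) = - (J ^^ j) (?Q v)" for j v
    proof -
      have "P ((J ^^ j) (?Q v)) = 0" by (cases j) (auto simp: P_J P_idem bounded_clinear_diff[OF P_clinear])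
      then show ?thesis by (simp add: A_J bounded_clinear_minus[OF A_clinear])
    qed
    have sm: "summable (\<lambda>j. - (J ^^ j) (?Q (u (n + int j))))"
      by (subst summable_Suc_iff[symmetric]) (use s(2)[of "n + 1" int] in \<open>simp add: algebra_simps\<close>)
    have "A (reach_minus (\<lambda>i. u (n + i))) = (\<Sum>j. - (J ^^ j) (?Q (u (n + int j))))"
      unfolding reach_minus_def
      by (subst bounded_linear.suminf[OF bounded_clinear_bounded_linear[OF A_clinear] s(2)]) (simp only: AJ)
    also have "\<dots> = (\<Sum>j. - (J ^^ Suc j) (?Q (u (n + int (Suc j))))) - ?Q (u n)"
      using suminf_split_head[OF sm] by simp
    also have "(\<Sum>j. - (J ^^ Suc j) (?Q (u (n + int (Suc j))))) = reach_minus (\<lambda>i. u (n + 1 + i))"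
      unfolding reach_minus_def by (simp add: algebra_simps)
    finally show ?thesis .
  qed
  ultimately show "reach (\<lambda>i. u (n + 1 + i)) = A (reach (\<lambda>i. u (n + i))) + B (u n)"
    by (simp add: reach_def bounded_clinear_add[OF A_clinear])
qed

end

section \<open>The available storage\<close>

lemma infsum_diff_real:
  fixes f g :: "'i \<Rightarrow> real"
  assumes "f summable_on S" "g summable_on S"
  shows "(\<lambda>i. f i - g i) summable_on S" "infsum (\<lambda>i. f i - g i) S = infsum f S - infsum g S"
proof -
  have g: "(\<lambda>i. - g i) summable_on S" using assms(2) summable_on_cmult_right[of g S "-1"] by simp
  show "(\<lambda>i. f i - g i) summable_on S" using summable_on_add[OF assms(1) g] by simp
  show "infsum (\<lambda>i. f i - g i) S = infsum f S - infsum g S"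
    using infsum_add[OF assms(1) g] by (simp add: infsum_uminus)
qed

definition square_summable :: "(int \<Rightarrow> 'a::real_normed_vector) \<Rightarrow> bool" where
  "square_summable u \<longleftrightarrow> (\<lambda>n. (norm (u n))\<^sup>2) summable_on UNIV"

definition energy :: "(int \<Rightarrow> 'a::real_normed_vector) \<Rightarrow> real" where
  "energy u = (\<Sum>\<^sub>\<infinity>n. (norm (u n))\<^sup>2)"

lemma square_summable_on: "square_summable u \<Longrightarrow> (\<lambda>n. (norm (u n))\<^sup>2) summable_on S"
  unfolding square_summable_def by (rule summable_on_subset_banach) auto

lemma square_summable_add:
  assumes "square_summable u" "square_summable v" shows "square_summable (\<lambda>n. u n + v n)"
  unfolding square_summable_def
proof (rule summable_on_comparison_test)
  show "(\<lambda>n. 2 * (norm (u n))\<^sup>2 + 2 * (norm (v n))\<^sup>2) summable_on UNIV"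
    using assms unfolding square_summable_def by (intro summable_on_add summable_on_cmult_right)
  fix n
  have "(norm (u n + v n))\<^sup>2 \<le> (norm (u n) + norm (v n))\<^sup>2"
    by (intro power_mono norm_triangle_ineq) simp
  also have "\<dots> \<le> 2 * (norm (u n))\<^sup>2 + 2 * (norm (v n))\<^sup>2"
    using sum_squares_bound[of "norm (u n)" "norm (v n)"] by (simp add: power2_sum)
  finally show "(norm (u n + v n))\<^sup>2 \<le> 2 * (norm (u n))\<^sup>2 + 2 * (norm (v n))\<^sup>2" .
qed simp

lemma square_summable_minus: "square_summable u \<Longrightarrow> square_summable (\<lambda>n. - u n)"
  by (simp add: square_summable_def)

lemma square_summable_diff:
  assumes "square_summable u" "square_summable v" shows "square_summable (\<lambda>n. u n - v n)"
  using square_summable_add[OF assms(1) square_summable_minus[OF assms(2)]] by simp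

lemma square_summable_scaleC: "square_summable u \<Longrightarrow> square_summable (\<lambda>n. c *\<^sub>C (u n :: 'a::complex_hilbert))"
  by (simp add: square_summable_def power_mult_distrib summable_on_cmult_right)

lemma energy_nonneg: "energy u \<ge> 0"
  by (simp add: energy_def infsum_nonneg)

lemma energy_finite: "square_summable u \<Longrightarrow> finite F \<Longrightarrow> (\<Sum>n\<in>F. (norm (u n))\<^sup>2) \<le> energy u"
  unfolding energy_def square_summable_def by (rule finite_sum_le_infsum) auto

lemma energy_leI:
  assumes "\<And>F. finite F \<Longrightarrow> (\<Sum>n\<in>F. (norm (u n))\<^sup>2) \<le> S"
  shows "square_summable u" "energy u \<le> S"
proof -
  show s: "square_summable u" unfolding square_summable_def
    by (rule nonneg_bdd_above_summable_on) (use assms in \<open>auto intro!: bdd_aboveI[of _ S]\<close>)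
  show "energy u \<le> S" using s assms unfolding energy_def square_summable_def by (intro infsum_le_finite_sums)
qed

lemma square_summable_bounded: "square_summable u \<Longrightarrow> norm (u n) \<le> sqrt (energy u)"
  using energy_finite[of u "{n}"] by (simp add: real_le_rsqrt)

lemma infsum_le_energy:
  assumes "square_summable u" shows "(\<Sum>\<^sub>\<infinity>n\<in>S. (norm (u n))\<^sup>2) \<le> energy u"
  unfolding energy_def
  by (rule infsum_mono2) (use assms square_summable_on[OF assms] in auto)

lemma square_summable_splice:
  assumes "square_summable u" "square_summable v"
  shows "square_summable (\<lambda>n. if n < (k::int) then u n else v n)"
  unfolding square_summable_def
  by (rule summable_on_comparison_test[of "\<lambda>n. (norm (u n))\<^sup>2 + (norm (v n))\<^sup>2"])
     (use assms in \<open>auto simp: square_summable_def intro: summable_on_add\<close>)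

lemma square_summable_upd:
  assumes "square_summable u" shows "square_summable (u(k := v))"
  unfolding square_summable_def
proof (rule summable_on_comparison_test[of "\<lambda>n. (norm (u n))\<^sup>2 + (if n = k then (norm v)\<^sup>2 else 0)"])
  have "(\<lambda>n. if n = k then (norm v)\<^sup>2 else 0) summable_on UNIV"
    by (rule finite_nonzero_values_imp_summable_on) (auto intro: finite_subset[of _ "{k}"])
  then show "(\<lambda>n. (norm (u n))\<^sup>2 + (if n = k then (norm v)\<^sup>2 else 0)) summable_on UNIV"
    using assms unfolding square_summable_def by (intro summable_on_add)
qed auto

lemma square_summable_shift:
  assumes "square_summable u" shows "square_summable (\<lambda>n. u (n + k))"
  using assms summable_on_reindex_bij_betw[of "\<lambda>n. n + k" UNIV UNIV "\<lambda>n. (norm (u n))\<^sup>2"]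
  unfolding square_summable_def by (metis (no_types) bij_plus_right)

text \<open>The symmetric form obtained by polarization is additive by the Jordan--von Neumann identity;
  boundedness makes it real-homogeneous.\<close>

lemma additive_bounded_imp_homogeneous:
  fixes f :: "real \<Rightarrow> real"
  assumes add: "\<And>s t. f (s + t) = f s + f t" and bound: "\<And>t. 0 \<le> t \<Longrightarrow> t \<le> 1 \<Longrightarrow> \<bar>f t\<bar> \<le> M"
  shows "f t = t * f 1"
proof -
  \<comment> \<open>The deviation from linearity is additive and vanishes on the integers, hence is
    periodic. Bounded on the unit interval, it is bounded everywhere, and a bounded additive
    function is zero.\<close>
  define g where "g t = f t - t * f 1" for t
  have gadd: "g (s + t) = g s + g t" for s t by (simp add: g_def add algebra_simps)
  have g0: "g 0 = 0" using gadd[of 0 0] by simp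
  have g1: "g 1 = 0" by (simp add: g_def)
  have gn: "g (of_nat n * t) = of_nat n * g t" for n t
    by (induction n) (auto simp: g0 gadd algebra_simps)
  have gm: "g (- t) = - g t" for t using gadd[of t "-t"] g0 by simp
  have gi: "g (of_int i) = 0" for i
  proof (cases i rule: int_cases2)
    case (nonneg n) then show ?thesis using gn[of n 1] g1 by simp
  next
    case (nonpos n) then show ?thesis using gn[of n 1] g1 gm[of "of_nat n"] by simp
  qed
  have gf: "g t = g (frac t)" for t
    using gadd[of "frac t" "of_int \<lfloor>t\<rfloor>"] gi by (simp add: frac_def)
  have gb: "\<bar>g t\<bar> \<le> M + \<bar>f 1\<bar>" for t
  proof -
    have fr: "0 \<le> frac t" "frac t \<le> 1" using frac_lt_1[of t] by auto
    have "\<bar>frac t * f 1\<bar> \<le> \<bar>f 1\<bar>" using fr by (simp add: abs_mult mult_left_le_one_le)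
    moreover have "g t = f (frac t) - frac t * f 1" using gf[of t] by (simp only: g_def)
    ultimately show ?thesis using bound[OF fr] by linarith
  qed
  have "g t = 0"
  proof (rule ccontr)
    assume nz: "g t \<noteq> 0"
    obtain n :: nat where n: "(M + \<bar>f 1\<bar>) / \<bar>g t\<bar> < of_nat n" using reals_Archimedean2 by blast
    then have "M + \<bar>f 1\<bar> < of_nat n * \<bar>g t\<bar>" using nz by (simp add: field_simps)
    also have "\<dots> = \<bar>g (of_nat n * t)\<bar>" by (simp add: gn abs_mult)
    also have "\<dots> \<le> M + \<bar>f 1\<bar>" by (rule gb)
    finally show False by simp
  qed
  then show ?thesis by (simp add: g_def)
qed

text \<open>Polarization gives the real part \<open>b\<close> of the sesquilinear form. Invariance
  under multiplication by \<i>, a case of \<open>scale\<close>, supplies the imaginary part, and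
  Riesz representation turns the form into an operator.\<close>

lemma quadratic_form_operator:
  fixes S :: "'a::complex_hilbert \<Rightarrow> real"
  assumes para: "\<And>x y. S (x + y) + S (x - y) = 2 * S x + 2 * S y"
    and scale: "\<And>c x. S (c *\<^sub>C x) = (cmod c)\<^sup>2 * S x"
    and bound: "\<And>x. \<bar>S x\<bar> \<le> M * (norm x)\<^sup>2" and M: "M \<ge> 0"
  shows "\<exists>H. selfadjoint H \<and> (\<forall>x. Re (cinner (H x) x) = S x)"
proof -
  define b where "b x y = (S (x + y) - S (x - y)) / 4" for x y
  have S0: "S 0 = 0" using scale[of 0 0] by simp
  have Sm: "S (- x) = S x" for x using scale[of "-1" x] by simp
  have b0: "b 0 y = 0" for y by (simp add: b_def Sm)
  have bxx: "b x x = S x" for x using para[of x x] S0 by (simp add: b_def)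
  have sym: "b x y = b y x" for x y using Sm[of "x - y"] by (simp add: b_def add.commute)
  have jvn: "b (x + z) y + b (x - z) y = 2 * b x y" for x y z
  proof -
    have e: "x + z + y = x + y + z" "x + z - y = x - y + z" "x - z + y = x + y - z" "x - z - y = x - y - z"
      by simp_all
    show ?thesis unfolding b_def e using para[of "x + y" z] para[of "x - y" z] by (simp add: field_simps)
  qed
  have b2: "b (2 *\<^sub>R x) y = 2 * b x y" for x y using jvn[of x x y] b0 by (simp add: scaleR_2)
  \<comment> \<open>With p and q written as midpoint plus and minus half their difference,
    \<open>jvn\<close> expresses the sum through the midpoint alone.\<close>
  have badd: "b (p + q) y = b p y + b q y" for p q y
  proof -
    let ?m = "(1/2) *\<^sub>R (p + q)" and ?d = "(1/2) *\<^sub>R (p - q)"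
    have e: "?m + ?d = p" "?m - ?d = q" "2 *\<^sub>R ?m = p + q"
      by (simp_all add: scaleR_add_right scaleR_diff_right) (simp_all flip: scaleR_add_left)
    have "b p y + b q y = 2 * b ?m y" using jvn[of ?m ?d y] unfolding e by simp
    also have "\<dots> = b (p + q) y" unfolding b2[symmetric] e ..
    finally show ?thesis by simp
  qed
  have bbd0: "\<bar>b x y\<bar> \<le> (M / 2) * ((norm x)\<^sup>2 + (norm y)\<^sup>2)" for x y
  proof -
    have "\<bar>b x y\<bar> \<le> (\<bar>S (x + y)\<bar> + \<bar>S (x - y)\<bar>) / 4" unfolding b_def by simp
    also have "\<dots> \<le> (M * (norm (x + y))\<^sup>2 + M * (norm (x - y))\<^sup>2) / 4"
      using bound[of "x + y"] bound[of "x - y"] by simp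
    also have "\<dots> = M * ((norm (x + y))\<^sup>2 + (norm (x - y))\<^sup>2) / 4" by (simp add: distrib_left)
    also have "\<dots> = (M / 2) * ((norm x)\<^sup>2 + (norm y)\<^sup>2)"
      unfolding parallelogram_law by (simp add: field_simps)
    finally show ?thesis .
  qed
  have bR: "b (t *\<^sub>R x) y = t * b x y" for t x y
  proof -
    have "b (t *\<^sub>R x) y = t * b (1 *\<^sub>R x) y"
    proof (rule additive_bounded_imp_homogeneous[where f = "\<lambda>t. b (t *\<^sub>R x) y" and M = "(M / 2) * ((norm x)\<^sup>2 + (norm y)\<^sup>2)"])
      fix t :: real assume t: "0 \<le> t" "t \<le> 1"
      have "\<bar>b (t *\<^sub>R x) y\<bar> \<le> (M / 2) * ((norm (t *\<^sub>R x))\<^sup>2 + (norm y)\<^sup>2)" by (rule bbd0)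
      also have "\<dots> \<le> (M / 2) * ((norm x)\<^sup>2 + (norm y)\<^sup>2)"
        using t M by (intro mult_left_mono add_right_mono power_mono) (auto simp: mult_left_le_one_le)
      finally show "\<bar>b (t *\<^sub>R x) y\<bar> \<le> (M / 2) * ((norm x)\<^sup>2 + (norm y)\<^sup>2)" .
    qed (simp add: scaleR_add_left badd)
    then show ?thesis by simp
  qed
  \<comment> \<open>Normalizing both vectors turns the quadratic bound \<open>bbd0\<close> into a
    bilinear one.\<close>
  have bbd: "\<bar>b x y\<bar> \<le> M * norm x * norm y" for x y
  proof (cases "x = 0 \<or> y = 0")
    case True
    then show ?thesis using b0 sym[of x y] by auto
  next
    case False
    then have n: "norm x > 0" "norm y > 0" by auto
    have "b ((1 / norm x) *\<^sub>R x) ((1 / norm y) *\<^sub>R y) = b x y / (norm x * norm y)"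
      by (simp add: bR sym[of _ "_ *\<^sub>R y"] sym[of y])
    moreover have "\<bar>b ((1 / norm x) *\<^sub>R x) ((1 / norm y) *\<^sub>R y)\<bar> \<le> M"
      using bbd0[of "(1 / norm x) *\<^sub>R x" "(1 / norm y) *\<^sub>R y"] n by simp
    ultimately show ?thesis using n by (simp add: abs_divide field_simps)
  qed
  have bii: "b (\<i> *\<^sub>C x) (\<i> *\<^sub>C y) = b x y" for x y
    using scale[of \<i> "x + y"] scale[of \<i> "x - y"] by (simp add: b_def scaleC_add_right scaleC_diff_right)
  have bm: "b (- x) y = - b x y" for x y using bR[of "-1" x y] by simp
  have bmr: "b x (- y) = - b x y" for x y using bm[of y x] sym by metis
  have ii: "\<i> *\<^sub>C \<i> *\<^sub>C x = - x" for x :: 'a by (simp add: scaleC_scaleC)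
  have bi: "b (\<i> *\<^sub>C x) y = - b x (\<i> *\<^sub>C y)" for x y
    using bii[of "\<i> *\<^sub>C x" y] by (simp add: ii bm)
  \<comment> \<open>The imaginary part of \<open>cinner (H x) y\<close> is the real part of
    \<open>cinner (H x) (\<i> *\<^sub>C y)\<close>, as the inner product is antilinear in its second
    argument.\<close>
  define h where "h x y = Complex (b x y) (b x (\<i> *\<^sub>C y))" for x y
  have hadd: "h (x + x') y = h x y + h x' y" for x x' y by (simp add: h_def badd complex_eq_iff)
  have hR: "h (of_real r *\<^sub>C x) y = of_real r * h x y" for r x y
    by (simp add: h_def scaleR_scaleC[symmetric] bR complex_eq_iff)
  have hi: "h (\<i> *\<^sub>C x) y = \<i> * h x y" for x y by (simp add: h_def bi ii bmr complex_eq_iff)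
  have hscale: "h (c *\<^sub>C x) y = c * h x y" for c x y
  proof -
    have "c *\<^sub>C x = of_real (Re c) *\<^sub>C x + of_real (Im c) *\<^sub>C (\<i> *\<^sub>C x)"
      by (simp add: scaleC_scaleC scaleC_add_left[symmetric] mult.commute[of _ \<i>] flip: complex_eq)
    then have "h (c *\<^sub>C x) y = of_real (Re c) * h x y + of_real (Im c) * (\<i> * h x y)"
      by (simp add: hadd hR hi)
    then show ?thesis by (metis complex_eq distrib_right mult.assoc mult.commute)
  qed
  have hherm: "h y x = cnj (h x y)" for x y
    using bi[of x y] sym[of x y] sym[of y "\<i> *\<^sub>C x"] by (simp add: h_def complex_eq_iff)
  have hbd: "cmod (h x y) \<le> (2 * M * norm y) * norm x" for x y
    using cmod_le[of "h x y"] bbd[of x y] bbd[of x "\<i> *\<^sub>C y"] by (simp add: h_def mult_ac)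
  have ex: "\<exists>!w. w \<in> UNIV \<and> (\<forall>v\<in>UNIV. h v y = cinner v w)" for y
    by (rule riesz_representation[where K = "2 * M * norm y"]) (use hadd hscale hbd in auto)
  then obtain H where H: "\<And>v y. h v y = cinner v (H y)" by (metis UNIV_I)
  have Hl: "cinner (H y) v = h y v" for y v
  proof -
    have "cinner (H y) v = cnj (h v y)" unfolding H by (rule cinner_commute)
    also have "\<dots> = h y v" by (rule hherm[symmetric])
    finally show ?thesis .
  qed
  have "bounded_clinear H"
  proof (rule bounded_clinearI)
    fix x y c
    show "H (x + y) = H x + H y"
      by (rule cinner_extensionality) (simp add: cinner_add_right H[symmetric] hherm[of _ "_ + _"] hadd, metis hherm complex_cnj_add hadd)
    show "H (c *\<^sub>C x) = c *\<^sub>C H x"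
      by (rule cinner_extensionality) (simp add: cinner_scaleC_right H[symmetric], metis hherm complex_cnj_mult hscale)
    have "(norm (H x))\<^sup>2 = Re (h (H x) x)" by (simp add: norm_sq_eq_cinner H)
    also have "\<dots> \<le> (2 * M * norm x) * norm (H x)" using hbd[of "H x" x] complex_Re_le_cmod[of "h (H x) x"] by linarith
    finally have "norm (H x) * norm (H x) \<le> (2 * M * norm x) * norm (H x)" by (simp add: power2_eq_square)
    then show "norm (H x) \<le> (2 * M) * norm x" using M by (cases "H x = 0") auto
  qed
  moreover have "cinner (H x) y = cinner x (H y)" for x y by (simp add: Hl H)
  moreover have "Re (cinner (H x) x) = S x" for x by (simp add: Hl h_def bxx)
  ultimately show ?thesis unfolding selfadjoint_iff by blast
qed

context dichotomous_system
begin

lemma trajectory_add: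
  assumes "trajectory u x" "trajectory v y"
  shows "trajectory (\<lambda>n. u n + v n) (\<lambda>n. x n + y n)"
proof -
  obtain M N where "\<And>n. norm (x n) \<le> M" "\<And>n. norm (y n) \<le> N"
    using assms unfolding trajectory_def by blast
  then have "norm (x n + y n) \<le> M + N" for n by (rule norm_add_rule_thm[OF _ _, of "x n" M "y n" N, simplified]) 
  then show ?thesis using assms unfolding trajectory_def
    by (auto simp: bounded_clinear_add[OF A_clinear] bounded_clinear_add[OF B_clinear])
qed

lemma trajectory_scaleC:
  assumes "trajectory u x" shows "trajectory (\<lambda>n. c *\<^sub>C u n) (\<lambda>n. c *\<^sub>C x n)"
proof -
  obtain M where "\<And>n. norm (x n) \<le> M" using assms unfolding trajectory_def by blast
  then have "norm (c *\<^sub>C x n) \<le> cmod c * M" for n by (simp add: mult_left_mono)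
  then show ?thesis using assms unfolding trajectory_def
    by (auto simp: bounded_clinear_scaleC[OF A_clinear] bounded_clinear_scaleC[OF B_clinear] scaleC_add_right)
qed

lemma trajectory_diff:
  assumes "trajectory u x" "trajectory v y"
  shows "trajectory (\<lambda>n. u n - v n) (\<lambda>n. x n - y n)"
  using trajectory_add[OF assms(1) trajectory_scaleC[OF assms(2), of "-1"]] by simp

lemma trajectory_splice:
  assumes x: "trajectory u x" and y: "trajectory v y" and eq: "x k = y k"
  shows "trajectory (\<lambda>n. if n < k then u n else v n) (\<lambda>n. if n < k then x n else y n)"
  unfolding trajectory_def
proof (intro conjI allI)
  obtain M N where "\<And>n. norm (x n) \<le> M" "\<And>n. norm (y n) \<le> N"
    using assms unfolding trajectory_def by blast
  then show "\<exists>M. \<forall>n. norm (if n < k then x n else y n) \<le> M"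
    by (intro exI[of _ "max M N"]) (auto intro: le_max_iff_disj[THEN iffD2])
  fix n
  have "n + 1 = k \<or> (n + 1 < k \<longleftrightarrow> n < k)" by arith
  then show "(if n + 1 < k then x (n + 1) else y (n + 1))
      = A (if n < k then x n else y n) + B (if n < k then u n else v n)"
    using x y eq unfolding trajectory_def by (metis (full_types) less_add_one less_irrefl)
qed

text \<open>Steering cost: representations of states by square summable inputs are sums of series, so
  Zabreiko's lemma bounds the cost by the norm.\<close>

lemma reach_series:
  fixes us :: "nat \<Rightarrow> int \<Rightarrow> 'u"
  assumes ss: "\<And>k. square_summable (us k)" and en: "\<And>k. sqrt (energy (us k)) \<le> r k"
    and r: "\<And>k. r k \<ge> 0" "summable r" and x: "summable x" "\<And>k. reach (us k) = x k"
  shows "\<exists>u. square_summable u \<and> sqrt (energy u) \<le> (\<Sum>k. r k) \<and> reach u = (\<Sum>k. x k)"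
proof -
  have ub: "norm (us k n) \<le> r k" for k n using square_summable_bounded[OF ss] en order_trans by blast
  have su: "summable (\<lambda>k. norm (us k n))" for n
    by (rule summable_comparison_test'[OF r(2), of 0]) (simp add: ub)
  note su' = summable_norm_cancel[OF su]
  define u where "u n = (\<Sum>k. us k n)" for n
  define s where "s N n = (\<Sum>k<N. us k n)" for N n
  have lim: "(\<lambda>N. s N n) \<longlonglongrightarrow> u n" for n unfolding s_def u_def by (rule summable_LIMSEQ[OF su'])
  \<comment> \<open>Minkowski's inequality on finite sets of times; letting N tend to infinity gives
    the energy bound for u.\<close>
  have L2: "L2_set (\<lambda>n. norm (s N n)) F \<le> (\<Sum>k<N. r k)" for N F
  proof (induction N)
    case (Suc N)
    have "L2_set (\<lambda>n. norm (s (Suc N) n)) F \<le> L2_set (\<lambda>n. norm (s N n) + norm (us N n)) F"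
      by (rule L2_set_mono) (auto simp: s_def norm_triangle_ineq)
    also have "\<dots> \<le> L2_set (\<lambda>n. norm (s N n)) F + L2_set (\<lambda>n. norm (us N n)) F"
      by (rule L2_set_triangle_ineq)
    also have "L2_set (\<lambda>n. norm (us N n)) F \<le> r N"
    proof (cases "finite F")
      case True
      then show ?thesis using energy_finite[OF ss True] en[of N]
        unfolding L2_set_def by (meson order_trans real_sqrt_le_iff)
    qed (simp add: r)
    finally show ?case using Suc by simp
  qed (simp add: s_def L2_set_def)
  have fin: "(\<Sum>n\<in>F. (norm (u n))\<^sup>2) \<le> (\<Sum>k. r k)\<^sup>2" if F: "finite F" for F
  proof -
    have "(\<lambda>N. \<Sum>n\<in>F. (norm (s N n))\<^sup>2) \<longlonglongrightarrow> (\<Sum>n\<in>F. (norm (u n))\<^sup>2)" by (intro tendsto_intros lim)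
    moreover have "(\<Sum>n\<in>F. (norm (s N n))\<^sup>2) \<le> (\<Sum>k. r k)\<^sup>2" for N
    proof -
      have "sqrt (\<Sum>n\<in>F. (norm (s N n))\<^sup>2) \<le> (\<Sum>k. r k)"
        using L2[of N F] sum_le_suminf[OF r(2), of "{..<N}"] r(1) unfolding L2_set_def by simp
      then show ?thesis by (rule sqrt_le_D)
    qed
    ultimately show ?thesis by (intro LIMSEQ_le_const2) auto
  qed
  have ssu: "square_summable u" "energy u \<le> (\<Sum>k. r k)\<^sup>2" using energy_leI[OF fin] by auto
  have sum_nn: "(\<Sum>k. r k) \<ge> 0" using r by (intro suminf_nonneg) auto
  obtain R where R: "R > 0" "\<And>u U. (\<And>n. norm (u n) \<le> U) \<Longrightarrow> norm (reach u) \<le> R * U"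
    using reach_bound by blast
  \<comment> \<open>The costs dominate the sup norms, so the partial sums converge uniformly. Since
    \<open>reach\<close> is bounded in the sup norm, the reached states converge along with
    them.\<close>
  have tail: "norm (u n - s N n) \<le> (\<Sum>k. r k) - (\<Sum>k<N. r k)" for n N
  proof -
    have "u n - s N n = (\<Sum>k. us (k + N) n)"
      unfolding u_def s_def using suminf_minus_initial_segment[OF su'[of n], of N] by simp
    also have "norm \<dots> \<le> (\<Sum>k. r (k + N))"
      using su[of n] r ub
      by (intro order_trans[OF summable_norm suminf_le]) (auto intro: summable_ignore_initial_segment summable_ignore_initial_segment[of "\<lambda>k. norm (us k n)"])
    also have "\<dots> = (\<Sum>k. r k) - (\<Sum>k<N. r k)" by (rule suminf_minus_initial_segment[OF r(2)])
    finally show ?thesis .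
  qed
  have step: "reach (\<lambda>n. u n - s N n) = reach u - (\<Sum>k<N. x k)" for N
  proof (induction N)
    case (Suc N)
    have "reach (\<lambda>n. u n - s (Suc N) n) = reach (\<lambda>n. (u n - s N n) - us N n)"
      by (simp add: s_def diff_diff_eq)
    also have "\<dots> = reach (\<lambda>n. u n - s N n) - reach (us N)"
      by (rule reach_diff[OF tail ub])
    finally show ?case using Suc x(2) by simp
  qed (simp add: s_def)
  have "(\<lambda>N. reach u - (\<Sum>k<N. x k)) \<longlonglongrightarrow> 0"
  proof (rule Lim_null_comparison)
    show "\<forall>\<^sub>F N in sequentially. norm (reach u - (\<Sum>k<N. x k)) \<le> R * ((\<Sum>k. r k) - (\<Sum>k<N. r k))"
      unfolding step[symmetric] using R(2)[OF tail] by (auto intro: always_eventually)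
    have "(\<lambda>N. R * ((\<Sum>k. r k) - (\<Sum>k<N. r k))) \<longlonglongrightarrow> R * ((\<Sum>k. r k) - (\<Sum>k. r k))"
      by (intro tendsto_intros summable_LIMSEQ r)
    then show "(\<lambda>N. R * ((\<Sum>k. r k) - (\<Sum>k<N. r k))) \<longlonglongrightarrow> 0" by simp
  qed
  moreover have "(\<lambda>N. reach u - (\<Sum>k<N. x k)) \<longlonglongrightarrow> reach u - (\<Sum>k. x k)"
    by (intro tendsto_intros summable_LIMSEQ x)
  ultimately have "reach u = (\<Sum>k. x k)" using LIMSEQ_unique by fastforce
  then show ?thesis using ssu sum_nn by (intro exI[of _ u]) (auto intro: real_le_lsqrt energy_nonneg)
qed

lemma steering_bound:
  assumes ctrl: "\<And>x. \<exists>u. square_summable u \<and> reach u = x"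
  shows "\<exists>M\<ge>0. \<forall>x0. \<exists>u x. square_summable u \<and> trajectory u x \<and> x 0 = x0 \<and> energy u \<le> M * (norm x0)\<^sup>2"
proof -
  define R where "R x r \<longleftrightarrow> (\<exists>u. square_summable u \<and> sqrt (energy u) \<le> r \<and> reach u = x)" for x r
  have "\<exists>M>0. \<forall>x. R x (M * norm x)"
  proof (rule countably_subadditive_bounded)
    show "R x s" if "R x r" "r \<le> s" for x r s
      using that order_trans[OF _ that(2)] unfolding R_def by blast
    show "R (c *\<^sub>R x) (\<bar>c\<bar> * r)" if R: "R x r" for x r c
    proof -
      obtain u where u: "square_summable u" "sqrt (energy u) \<le> r" "reach u = x" using R unfolding R_def by blast
      have e: "energy (\<lambda>n. c *\<^sub>R u n) = c\<^sup>2 * energy u"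
        unfolding energy_def by (simp add: power_mult_distrib infsum_cmult_right')
      have "square_summable (\<lambda>n. c *\<^sub>R u n)" using square_summable_scaleC[OF u(1), of "of_real c"] by (simp add: scaleR_scaleC)
      moreover have "sqrt (energy (\<lambda>n. c *\<^sub>R u n)) \<le> \<bar>c\<bar> * r"
        using u(2) by (simp add: e real_sqrt_mult mult_left_mono)
      moreover have "reach (\<lambda>n. c *\<^sub>R u n) = c *\<^sub>R x"
        using reach_scaleR[OF square_summable_bounded[OF u(1)]] u(3) by simp
      ultimately show ?thesis unfolding R_def by blast
    qed
    show "R (\<Sum>k. x k) (\<Sum>k. r k)"
      if R: "\<And>k. R (x k) (r k)" and r: "\<And>k. r k \<ge> 0" "summable r" "summable x" for x r
    proof -
      obtain us where "\<And>k. square_summable (us k)" "\<And>k. sqrt (energy (us k)) \<le> r k" "\<And>k. reach (us k) = x k"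
        using R unfolding R_def by metis
      then show ?thesis unfolding R_def by (intro reach_series r)
    qed
    show "\<exists>r. R x r" for x using ctrl[of x] unfolding R_def by blast
  qed
  then obtain M where M: "M > 0" "\<And>x. R x (M * norm x)" by blast
  show ?thesis
  proof (intro exI[of _ "M\<^sup>2"] conjI allI)
    fix x0
    obtain u where u: "square_summable u" "sqrt (energy u) \<le> M * norm x0" "reach u = x0" using M(2) unfolding R_def by blast
    have "energy u \<le> (M * norm x0)\<^sup>2" using u(2) by (rule sqrt_le_D)
    then show "\<exists>u x. square_summable u \<and> trajectory u x \<and> x 0 = x0 \<and> energy u \<le> M\<^sup>2 * (norm x0)\<^sup>2"
      using reach_trajectory[OF square_summable_bounded[OF u(1)]] u
      by (intro exI[of _ u] exI[of _ "\<lambda>n. reach (\<lambda>i. u (n + i))"]) (simp add: power_mult_distrib)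
  qed simp
qed

definition gain :: "(int \<Rightarrow> 'u) \<Rightarrow> (int \<Rightarrow> 'x) \<Rightarrow> int \<Rightarrow> real" where
  "gain u x n = (norm (out_seq u x n))\<^sup>2 - (norm (u n))\<^sup>2"

definition future :: "(int \<Rightarrow> 'u) \<Rightarrow> (int \<Rightarrow> 'x) \<Rightarrow> real" where
  "future u x = (\<Sum>\<^sub>\<infinity>n\<in>{0..}. gain u x n)"

definition admissible :: "(int \<Rightarrow> 'u) \<Rightarrow> (int \<Rightarrow> 'x) \<Rightarrow> 'x \<Rightarrow> bool" where
  "admissible u x x0 \<longleftrightarrow> square_summable u \<and> trajectory u x \<and> x 0 = x0"

definition storage :: "'x \<Rightarrow> real" where
  "storage x0 = Sup {future u x | u x. admissible u x x0}"

end

locale contractive_system = dichotomous_system +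
  assumes contractive: "\<And>u x. trajectory u x \<Longrightarrow> square_summable u \<Longrightarrow>
      square_summable (out_seq u x) \<and> energy (out_seq u x) \<le> energy u"
    and controllable: "\<And>x. \<exists>u. square_summable u \<and> reach u = x"
begin

lemma gain_summable: "admissible u x x0 \<Longrightarrow> gain u x summable_on S"
  using contractive unfolding admissible_def gain_def[abs_def]
  by (intro infsum_diff_real square_summable_on) auto

lemma future_lower: "admissible u x x0 \<Longrightarrow> - energy u \<le> future u x"
proof -
  assume a: "admissible u x x0"
  have "- energy u \<le> - (\<Sum>\<^sub>\<infinity>n\<in>{0..}. (norm (u n))\<^sup>2)"
    using infsum_le_energy a unfolding admissible_def by auto
  also have "\<dots> = (\<Sum>\<^sub>\<infinity>n\<in>{0..}. - (norm (u n))\<^sup>2)" by (simp add: infsum_uminus)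
  also have "\<dots> \<le> future u x"
    unfolding future_def using a
    by (intro infsum_mono gain_summable[OF a])
       (auto simp: gain_def admissible_def summable_on_uminus square_summable_on)
  finally show ?thesis .
qed

text \<open>Let the past of any admissible pair for \<open>x0\<close> run into the given future. The
  spliced trajectory has total net gain at most 0, and its past loses at most
  \<open>energy u'\<close>, so the future cannot gain more than that.\<close>

lemma future_upper:
  assumes "admissible u x x0" "admissible u' x' x0" shows "future u x \<le> energy u'"
proof -
  define v where "v n = (if n < 0 then u' n else u n)" for n :: int
  define y where "y n = (if n < 0 then x' n else x n)" for n :: int
  have a: "admissible v y x0"
    using assms trajectory_splice[of u' x' u x 0] square_summable_splice[of u' u 0]
    unfolding admissible_def v_def[abs_def] y_def[abs_def] by auto
  then have "infsum (gain v y) UNIV \<le> 0"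
    using contractive[of v y] infsum_diff_real(2)[of "\<lambda>n. (norm (out_seq v y n))\<^sup>2" UNIV "\<lambda>n. (norm (v n))\<^sup>2"]
    unfolding admissible_def gain_def[abs_def] energy_def square_summable_def by auto
  moreover have "infsum (gain v y) UNIV = infsum (gain v y) {..<0} + infsum (gain v y) {0..}"
  proof -
    have "UNIV = {..<0} \<union> {0::int..}" "{..<0} \<inter> {0::int..} = {}" by auto
    then show ?thesis using infsum_Un_disjoint[OF gain_summable[OF a] gain_summable[OF a], of "{..<0}" "{0..}"] by auto
  qed
  moreover have "infsum (gain v y) {0..} = future u x"
    unfolding future_def by (intro infsum_cong) (auto simp: gain_def out_seq_def v_def y_def)
  moreover have "infsum (gain v y) {..<0} = infsum (gain u' x') {..<0}"
    by (intro infsum_cong) (auto simp: gain_def out_seq_def v_def y_def)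
  moreover have "- energy u' \<le> infsum (gain u' x') {..<0}"
  proof -
    have "- energy u' \<le> - (\<Sum>\<^sub>\<infinity>n\<in>{..<0}. (norm (u' n))\<^sup>2)"
      using infsum_le_energy assms(2) unfolding admissible_def by auto
    also have "\<dots> = (\<Sum>\<^sub>\<infinity>n\<in>{..<0}. - (norm (u' n))\<^sup>2)" by (simp add: infsum_uminus)
    also have "\<dots> \<le> infsum (gain u' x') {..<0}"
      using assms(2)
      by (intro infsum_mono gain_summable[OF assms(2)])
         (auto simp: gain_def admissible_def summable_on_uminus square_summable_on)
    finally show ?thesis .
  qed
  ultimately show ?thesis by linarith
qed

lemma admissible_exists: "\<exists>u x. admissible u x x0"
  using steering_bound[OF controllable] unfolding admissible_def by blast

lemma storage_upper:
  assumes "admissible u x x0" shows "future u x \<le> storage x0"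
  unfolding storage_def
proof (rule cSup_upper)
  show "bdd_above {future u x |u x. admissible u x x0}"
    using future_upper[OF _ assms] by (auto intro!: bdd_aboveI[of _ "energy u"])
qed (use assms in blast)

lemma storage_least:
  assumes "\<And>u x. admissible u x x0 \<Longrightarrow> future u x \<le> b" shows "storage x0 \<le> b"
  unfolding storage_def by (rule cSup_least) (use admissible_exists assms in auto)

text \<open>A single cheaply steered pair serves twice: as a competitor in the supremum and as the
  past in \<open>future_upper\<close>.\<close>

lemma storage_bound: "\<exists>M\<ge>0. \<forall>x0. \<bar>storage x0\<bar> \<le> M * (norm x0)\<^sup>2"
proof -
  obtain M where M: "M \<ge> 0"
    "\<And>x0. \<exists>u x. square_summable u \<and> trajectory u x \<and> x 0 = x0 \<and> energy u \<le> M * (norm x0)\<^sup>2"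
    using steering_bound[OF controllable] by blast
  have "\<bar>storage x0\<bar> \<le> M * (norm x0)\<^sup>2" for x0
  proof -
    obtain u x where u: "admissible u x x0" "energy u \<le> M * (norm x0)\<^sup>2" using M(2) unfolding admissible_def by blast
    have "- energy u \<le> storage x0" using future_lower[OF u(1)] storage_upper[OF u(1)] by linarith
    moreover have "storage x0 \<le> energy u" by (rule storage_least) (rule future_upper[OF _ u(1)])
    ultimately show ?thesis using u(2) by linarith
  qed
  then show ?thesis using M(1) by blast
qed

lemma out_seq_add: "out_seq (\<lambda>n. u n + v n) (\<lambda>n. x n + y n) n = out_seq u x n + out_seq v y n"
  by (simp add: out_seq_def bounded_clinear_add[OF C_clinear] bounded_clinear_add[OF D_clinear])

lemma out_seq_diff: "out_seq (\<lambda>n. u n - v n) (\<lambda>n. x n - y n) n = out_seq u x n - out_seq v y n"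
  by (simp add: out_seq_def bounded_clinear_diff[OF C_clinear] bounded_clinear_diff[OF D_clinear])

text \<open>Sum and difference of two admissible trajectories are admissible for
  \<open>x + y\<close> and \<open>x - y\<close>, and their gains obey the parallelogram law at each
  time.\<close>

lemma storage_superadditive: "2 * storage x + 2 * storage y \<le> storage (x + y) + storage (x - y)"
proof -
  have 1: "2 * future u \<xi> + 2 * future v \<eta> \<le> storage (x + y) + storage (x - y)"
    if u: "admissible u \<xi> x" and v: "admissible v \<eta> y" for u \<xi> v \<eta>
  proof -
    have p: "admissible (\<lambda>n. u n + v n) (\<lambda>n. \<xi> n + \<eta> n) (x + y)"
      using u v unfolding admissible_def by (auto intro: square_summable_add trajectory_add)
    have m: "admissible (\<lambda>n. u n - v n) (\<lambda>n. \<xi> n - \<eta> n) (x - y)"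
      using u v unfolding admissible_def by (auto intro: square_summable_diff trajectory_diff)
    have "future (\<lambda>n. u n + v n) (\<lambda>n. \<xi> n + \<eta> n) + future (\<lambda>n. u n - v n) (\<lambda>n. \<xi> n - \<eta> n)
        = (\<Sum>\<^sub>\<infinity>n\<in>{0..}. gain (\<lambda>n. u n + v n) (\<lambda>n. \<xi> n + \<eta> n) n + gain (\<lambda>n. u n - v n) (\<lambda>n. \<xi> n - \<eta> n) n)"
      unfolding future_def by (rule infsum_add[symmetric, OF gain_summable[OF p] gain_summable[OF m]])
    also have "\<dots> = (\<Sum>\<^sub>\<infinity>n\<in>{0..}. 2 * gain u \<xi> n + 2 * gain v \<eta> n)"
    proof (intro infsum_cong)
      fix n
      show "gain (\<lambda>n. u n + v n) (\<lambda>n. \<xi> n + \<eta> n) n + gain (\<lambda>n. u n - v n) (\<lambda>n. \<xi> n - \<eta> n) n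
          = 2 * gain u \<xi> n + 2 * gain v \<eta> n"
        using parallelogram_law[of "u n" "v n"] parallelogram_law[of "out_seq u \<xi> n" "out_seq v \<eta> n"]
        unfolding gain_def out_seq_add out_seq_diff by (simp add: algebra_simps)
    qed
    also have "\<dots> = 2 * future u \<xi> + 2 * future v \<eta>"
      unfolding future_def
      by (subst infsum_add) (auto intro: summable_on_cmult_right gain_summable[OF u] gain_summable[OF v] simp: infsum_cmult_right')
    finally show ?thesis using storage_upper[OF p] storage_upper[OF m] by linarith
  qed
  \<comment> \<open>The two suprema are taken in succession, first over the pairs for x with v held
    fixed, then over v.\<close>
  have "storage x \<le> (storage (x + y) + storage (x - y) - 2 * future v \<eta>) / 2" if "admissible v \<eta> y" for v \<eta>
    by (rule storage_least) (use 1[OF _ that] in \<open>simp add: field_simps\<close>)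
  then have "storage y \<le> (storage (x + y) + storage (x - y) - 2 * storage x) / 2"
    by (intro storage_least) (simp add: field_simps)
  then show ?thesis by (simp add: field_simps)
qed

text \<open>Scaling trajectories gives one inequality for every nonzero c; the same inequality for
  the inverse of c is the reverse one. At c = 0 the value comes from
  \<open>storage_bound\<close>.\<close>

lemma storage_scale: "storage (c *\<^sub>C x) = (cmod c)\<^sup>2 * storage x"
proof -
  have le: "(cmod c)\<^sup>2 * storage x \<le> storage (c *\<^sub>C x)" if c: "c \<noteq> 0" for c x
  proof -
    have "future u \<xi> \<le> storage (c *\<^sub>C x) / (cmod c)\<^sup>2" if u: "admissible u \<xi> x" for u \<xi>
    proof -
      have a: "admissible (\<lambda>n. c *\<^sub>C u n) (\<lambda>n. c *\<^sub>C \<xi> n) (c *\<^sub>C x)"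
        using u unfolding admissible_def by (auto intro: square_summable_scaleC trajectory_scaleC)
      have "gain (\<lambda>n. c *\<^sub>C u n) (\<lambda>n. c *\<^sub>C \<xi> n) n = (cmod c)\<^sup>2 * gain u \<xi> n" for n
        by (simp add: gain_def out_seq_def bounded_clinear_scaleC[OF C_clinear] bounded_clinear_scaleC[OF D_clinear]
            scaleC_add_right[symmetric] power_mult_distrib right_diff_distrib)
      then have "future (\<lambda>n. c *\<^sub>C u n) (\<lambda>n. c *\<^sub>C \<xi> n) = (cmod c)\<^sup>2 * future u \<xi>"
        unfolding future_def infsum_cmult_right'[symmetric] by (intro infsum_cong)
      with storage_upper[OF a] c show ?thesis by (simp add: field_simps)
    qed
    from storage_least[OF this] c show ?thesis by (simp add: field_simps)
  qed
  show ?thesis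
  proof (cases "c = 0")
    case True
    obtain M where "\<And>x0. \<bar>storage x0\<bar> \<le> M * (norm x0)\<^sup>2" using storage_bound by blast
    from this[of 0] show ?thesis using True by simp
  next
    case False
    have "(cmod (inverse c))\<^sup>2 * storage (c *\<^sub>C x) \<le> storage x"
      using le[of "inverse c" "c *\<^sub>C x"] False by (simp add: scaleC_scaleC)
    then have "(cmod c)\<^sup>2 * ((cmod (inverse c))\<^sup>2 * storage (c *\<^sub>C x)) \<le> (cmod c)\<^sup>2 * storage x"
      by (rule mult_left_mono) simp
    moreover have "(cmod c)\<^sup>2 * (cmod (inverse c))\<^sup>2 = 1"
      using False by (simp only: power_mult_distrib[symmetric] norm_mult[symmetric]) simp
    ultimately have "storage (c *\<^sub>C x) \<le> (cmod c)\<^sup>2 * storage x"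
      by (simp only: mult.assoc[symmetric] mult_1_left)
    with le[OF False, of x] show ?thesis by simp
  qed
qed

text \<open>Superadditivity at \<open>x + y\<close> and \<open>x - y\<close> involves
  \<open>storage\<close> at 2 x and 2 y; the scaling factor 4 turns it into the missing
  inequality.\<close>

lemma storage_parallelogram: "storage (x + y) + storage (x - y) = 2 * storage x + 2 * storage y"
proof -
  have e: "(x + y) + (x - y) = 2 *\<^sub>C x" "(x + y) - (x - y) = 2 *\<^sub>C y"
    using scaleC_add_left[of 1 1 x] scaleC_add_left[of 1 1 y] by auto
  have "2 * storage (x + y) + 2 * storage (x - y) \<le> storage (2 *\<^sub>C x) + storage (2 *\<^sub>C y)"
    unfolding e[symmetric] by (rule storage_superadditive)
  then show ?thesis using storage_superadditive[of x y] by (simp add: storage_scale)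
qed

text \<open>Delaying a trajectory from \<open>A x0 + B v\<close> by one step and applying v at time
  0 gives a competitor for \<open>x0\<close> that collects one additional term of gain.\<close>

lemma storage_dissipation: "storage (A x0 + B v) + (norm (C x0 + D v))\<^sup>2 - (norm v)\<^sup>2 \<le> storage x0"
proof -
  have "future u x \<le> storage x0 - ((norm (C x0 + D v))\<^sup>2 - (norm v)\<^sup>2)" if ad: "admissible u x (A x0 + B v)" for u x
  proof -
    obtain u' x' where ad': "admissible u' x' x0" using admissible_exists by blast
    \<comment> \<open>The splice is at time 1: the auxiliary past extends through time 0, where its
      state is \<open>x0\<close> and its input is overwritten by v.\<close>
    define w where "w n = (if n < 1 then (u'(0 := v)) n else u (n + -1))" for n :: int
    define y where "y n = (if n < 1 then x' n else x (n + -1))" for n :: int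
    have ssw: "square_summable w" unfolding w_def
      by (intro square_summable_splice square_summable_upd square_summable_shift) (use ad ad' in \<open>auto simp: admissible_def\<close>)
    have "trajectory w y"
      unfolding trajectory_def
    proof (intro conjI allI)
      obtain M N where "\<And>n. norm (x n) \<le> M" "\<And>n. norm (x' n) \<le> N"
        using ad ad' unfolding admissible_def trajectory_def by blast
      then show "\<exists>M. \<forall>n. norm (y n) \<le> M"
        by (intro exI[of _ "max M N"]) (auto simp: y_def intro: le_max_iff_disj[THEN iffD2])
      fix n :: int
      have tx: "x (m + 1) = A (x m) + B (u m)" "x' (m + 1) = A (x' m) + B (u' m)" for m
        using ad ad' by (auto simp: admissible_def trajectory_def)
      consider "n < 0" | "n = 0" | "n > 0" by linarith
      then show "y (n + 1) = A (y n) + B (w n)"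
      proof cases
        case 1
        then show ?thesis using tx(2)[of n] by (simp add: y_def w_def)
      next
        case 2
        then show ?thesis using ad ad' by (simp add: y_def w_def admissible_def)
      next
        case 3
        then show ?thesis using tx(1)[of "n - 1"] by (simp add: y_def w_def)
      qed
    qed
    then have a: "admissible w y x0" using ssw ad' by (simp add: admissible_def y_def)
    have "future w y = gain w y 0 + infsum (gain w y) {1..}"
    proof -
      have "{0..} = insert 0 {1::int..}" by auto
      then show ?thesis unfolding future_def using infsum_insert[OF gain_summable[OF a], of 0 "{1..}"] by simp
    qed
    also have "infsum (gain w y) {1..} = (\<Sum>\<^sub>\<infinity>n\<in>{0..}. gain w y (n + 1))"
      by (rule infsum_reindex_bij_betw[symmetric])
         (auto intro!: bij_betwI[where g = "\<lambda>n. n - 1"])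
    also have "\<dots> = future u x"
      unfolding future_def by (intro infsum_cong) (auto simp: gain_def out_seq_def w_def y_def)
    also have "gain w y 0 = (norm (C x0 + D v))\<^sup>2 - (norm v)\<^sup>2"
      using ad' by (simp add: gain_def out_seq_def w_def y_def admissible_def)
    finally show ?thesis using storage_upper[OF a] by linarith
  qed
  from storage_least[OF this, of "A x0 + B v"] show ?thesis by linarith
qed

theorem storage_operator:
  "\<exists>H. selfadjoint H \<and> (\<forall>x v. Re (cinner (H (A x + B v)) (A x + B v)) + (norm (C x + D v))\<^sup>2
      \<le> Re (cinner (H x) x) + (norm v)\<^sup>2)"
proof -
  obtain M where M: "M \<ge> 0" "\<And>x0. \<bar>storage x0\<bar> \<le> M * (norm x0)\<^sup>2" using storage_bound by blast
  obtain H where H: "selfadjoint H" "\<And>x. Re (cinner (H x) x) = storage x"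
    using quadratic_form_operator[OF storage_parallelogram storage_scale M(2) M(1)] by blast
  show ?thesis using storage_dissipation by (intro exI[of _ H]) (simp add: H algebra_simps)
qed

end

section \<open>The KYP inequality\<close>

text \<open>The lower bound makes the kernel trivial and the range closed. A vector orthogonal to
  the range of a selfadjoint operator lies in its kernel, so the range is the whole space.\<close>

lemma selfadjoint_bounded_below_invertible:
  fixes H :: "'a::complex_hilbert \<Rightarrow> 'a"
  assumes H: "selfadjoint H" and m: "m > 0" and low: "\<And>x. m * norm x \<le> norm (H x)"
  shows "boundedly_invertible H"
proof -
  note Hc = selfadjointD(1)[OF H] and Hs = selfadjointD(2)[OF H]
  have inj: "x = 0" if "H x = 0" for x
    using low[of x] that m by (simp add: mult_le_0_iff)
  have "complete (range H)"
    by (rule complete_isometric_image[OF m _ bounded_clinear_bounded_linear[OF Hc]])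
       (use low complete_UNIV in auto)
  then have S: "closed_csubspace (range H)"
    unfolding closed_csubspace_def csubspace_def
    by (auto intro!: complete_imp_closed simp: bounded_clinear_add[OF Hc, symmetric] bounded_clinear_scaleC[OF Hc, symmetric]
        intro: range_eqI[where x = 0] simp: bounded_clinear_zero[OF Hc])
  have surj: "\<exists>x. H x = y" for y
  proof -
    have "\<exists>!s. s \<in> range H \<and> (\<forall>v\<in>range H. cinner v y = cinner v s)"
      by (rule riesz_representation[OF S, where K = "norm y"])
         (auto simp: cinner_add_left cinner_scaleC_left mult.commute intro: cinner_cauchy_schwarz[THEN order_trans])
    then obtain s where s: "s \<in> range H" "\<And>w. cinner (H w) y = cinner (H w) s" by blast
    have "cinner w (H (y - s)) = 0" for w
      using s(2)[of w] by (simp add: Hs bounded_clinear_diff[OF Hc] cinner_diff_right)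
    then have "H (y - s) = 0" by (metis cinner_eq_zero_iff)
    then have "y = s" using inj by fastforce
    then show ?thesis using s(1) by auto
  qed
  define R where "R = inv H"
  have HR: "H (R y) = y" for y unfolding R_def using surj by (metis f_inv_into_f rangeI)
  have injH: "x = y" if "H x = H y" for x y
    using inj[of "x - y"] that by (simp add: bounded_clinear_diff[OF Hc])
  have "bounded_clinear R"
  proof (rule bounded_clinearI)
    fix x y c
    show "R (x + y) = R x + R y" by (rule injH) (simp add: bounded_clinear_add[OF Hc] HR)
    show "R (c *\<^sub>C x) = c *\<^sub>C R x" by (rule injH) (simp add: bounded_clinear_scaleC[OF Hc] HR)
    show "norm (R x) \<le> (1 / m) * norm x" using low[of "R x"] m by (simp add: HR field_simps)
  qed
  moreover have "R \<circ> H = id" "H \<circ> R = id" using HR injH by (auto intro!: ext simp: o_def)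
  ultimately show ?thesis unfolding boundedly_invertible_def using Hc by blast
qed

lemma block_op_clinear:
  assumes "bounded_clinear A" "bounded_clinear B" "bounded_clinear C" "bounded_clinear D"
  shows "bounded_clinear (block_op A B C D)"
proof -
  have "block_op A B C D = (\<lambda>p. (A (fst p) + B (snd p), C (fst p) + D (snd p)))"
    by (auto simp: block_op_def)
  then show ?thesis using assms
    by (auto intro!: bounded_clinear_Pair bounded_clinear_add_op
        bounded_clinear_compose[OF _ bounded_clinear_fst] bounded_clinear_compose[OF _ bounded_clinear_snd])
qed

lemma block_diag_clinear:
  assumes "bounded_clinear G" shows "bounded_clinear (block_op G (\<lambda>_. 0) (\<lambda>_. 0) id)"
  using assms by (intro block_op_clinear) auto

lemma block_diag_symmetric:
  assumes "selfadjoint H"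
  shows "cinner (block_op H (\<lambda>_. 0) (\<lambda>_. 0) id p) q = cinner p (block_op H (\<lambda>_. 0) (\<lambda>_. 0) id q)"
  by (simp add: block_op_def cinner_prod_def selfadjointD(2)[OF assms] split: prod.splits)

lemma block_diag_form:
  "Re (cinner (block_op H (\<lambda>_. 0) (\<lambda>_. 0) id (x, v)) (x, v)) = Re (cinner (H x) x) + (norm v)\<^sup>2"
  by (simp add: block_op_def cinner_prod_def norm_sq_eq_cinner)

text \<open>\<open>loewner_le\<close> demands that the difference be selfadjoint, which follows from
  selfadjointness of \<open>H\<close>; what remains is its quadratic form on pairs
  \<open>(x, v)\<close>.\<close>

lemma KYP_inequality_iff:
  assumes "bounded_clinear A" "bounded_clinear B" "bounded_clinear C" "bounded_clinear D"
    and H: "selfadjoint H"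
  shows "KYP_inequality A B C D H \<longleftrightarrow>
    (\<forall>x v. Re (cinner (H (A x + B v)) (A x + B v)) + (norm (C x + D v))\<^sup>2 \<le> Re (cinner (H x) x) + (norm v)\<^sup>2)"
proof -
  let ?M = "block_op A B C D"
  note M = block_op_clinear[OF assms(1-4)]
  note Hc = selfadjointD(1)[OF H] and Hs = selfadjointD(2)[OF H]
  note Nc = block_diag_clinear[OF Hc] and Ns = block_diag_symmetric[OF H]
  define T where "T p = block_op H (\<lambda>_. 0) (\<lambda>_. 0) id p - hadj ?M (block_op H (\<lambda>_. 0) (\<lambda>_. 0) id (?M p))" for p
  have adj: "cinner (hadj ?M p) q = cinner p (?M q)" for p q
    using cinner_hadj[OF M, of q p] by (metis cinner_commute)
  have sa: "selfadjoint T"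
    unfolding selfadjoint_iff
  proof (intro conjI allI)
    show "bounded_clinear T" unfolding T_def
      by (intro bounded_clinear_diff_op Nc bounded_clinear_compose[OF bounded_clinear_hadj[OF M]]
          bounded_clinear_compose[OF Nc M])
    fix p q
    show "cinner (T p) q = cinner p (T q)"
      by (simp add: T_def cinner_diff_left cinner_diff_right Ns adj cinner_hadj[OF M, symmetric])
  qed
  have q: "Re (cinner (T (x, v)) (x, v)) = Re (cinner (H x) x) + (norm v)\<^sup>2
      - (Re (cinner (H (A x + B v)) (A x + B v)) + (norm (C x + D v))\<^sup>2)" for x v
  proof -
    have "?M (x, v) = (A x + B v, C x + D v)" by (simp add: block_op_def)
    then show ?thesis by (simp add: T_def cinner_diff_left adj block_diag_form)
  qed
  have "KYP_inequality A B C D H \<longleftrightarrow> positive_semidefinite T"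
    unfolding KYP_inequality_def loewner_le_def T_def o_def ..
  also have "\<dots> \<longleftrightarrow> (\<forall>x v. 0 \<le> Re (cinner (T (x, v)) (x, v)))"
    unfolding positive_semidefinite_def using sa by auto
  finally show ?thesis by (simp add: q algebra_simps)
qed

text \<open>Surjectivity of the adjoint of \<open>W\<close> gives weak boundedness of the vectors
  \<open>v / \<parallel>W v\<parallel>\<close>; Zabreiko's lemma then plays the part of the uniform boundedness principle.\<close>

lemma surjective_adjoint_bounded_below:
  fixes Q :: "'x::complex_hilbert \<Rightarrow> 'x" and W :: "'x \<Rightarrow> int \<Rightarrow> 'y::complex_hilbert"
  assumes S: "closed_csubspace S" and Q: "bounded_clinear Q" and QS: "\<And>x. Q x \<in> S" "\<And>x. x \<in> S \<Longrightarrow> Q x = x"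
    and W_add: "\<And>v w i. v \<in> S \<Longrightarrow> w \<in> S \<Longrightarrow> W (v + w) i = W v i + W w i"
    and W_scale: "\<And>v c i. v \<in> S \<Longrightarrow> W (c *\<^sub>C v) i = c *\<^sub>C W v i"
    and g: "\<And>v F. v \<in> S \<Longrightarrow> finite F \<Longrightarrow> F \<subseteq> I \<Longrightarrow> (\<Sum>i\<in>F. (norm (W v i))\<^sup>2) \<le> g v"
    and h: "\<And>v. v \<in> S \<Longrightarrow> g v \<le> h * (norm v)\<^sup>2" and h0: "h \<ge> 0"
    and surj: "adjoint_on S cinner (ell2_inner I) W ` ell2 I = S"
  shows "\<exists>c>0. \<forall>v\<in>S. c * (norm v)\<^sup>2 \<le> g v"
proof -
  have g0: "g v \<ge> 0" if "v \<in> S" for v using g[OF that, of "{}"] by simp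
  have L2: "L2_set (\<lambda>i. norm (W v i)) F \<le> sqrt (g v)" if "v \<in> S" "F \<subseteq> I" for v F
    using g[OF that(1), of F] that g0 by (cases "finite F") (auto simp: L2_set_def)
  \<comment> \<open>By Cauchy-Schwarz, a value x of the adjoint satisfies a bound of
    \<open>cinner v x\<close> by a multiple of \<open>sqrt (g v)\<close>. The majorant
    \<open>g\<close> stands in for the observability Gramian; in the application it is the form of
    \<open>H\<close> up to sign.\<close>
  have adj: "\<exists>x r. r \<ge> 0 \<and> x \<in> S \<and> adjoint_on S cinner (ell2_inner I) W y = x
      \<and> (\<forall>v\<in>S. cmod (cinner v x) \<le> r * sqrt (g v))" if y: "y \<in> ell2 I" for y
  proof -
    define Y where "Y = (\<Sum>\<^sub>\<infinity>i\<in>I. (norm (y i))\<^sup>2)"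
    have ys: "(\<lambda>i. (norm (y i))\<^sup>2) summable_on I" using y by (simp add: ell2_def)
    have Y: "(\<Sum>i\<in>F. (norm (y i))\<^sup>2) \<le> Y" if "finite F" "F \<subseteq> I" for F
      unfolding Y_def using ys that by (intro finite_sum_le_infsum) auto
    have fin: "(\<Sum>i\<in>F. norm (cinner (W v i) (y i))) \<le> sqrt (g v) * sqrt Y" if v: "v \<in> S" "finite F" "F \<subseteq> I" for v F
    proof -
      have "(\<Sum>i\<in>F. norm (cinner (W v i) (y i))) \<le> (\<Sum>i\<in>F. \<bar>norm (W v i)\<bar> * \<bar>norm (y i)\<bar>)"
        by (intro sum_mono) (simp add: cinner_cauchy_schwarz)
      also have "\<dots> \<le> L2_set (\<lambda>i. norm (W v i)) F * L2_set (\<lambda>i. norm (y i)) F" by (rule L2_set_mult_ineq)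
      also have "\<dots> \<le> sqrt (g v) * sqrt Y"
        using L2[OF v(1,3)] Y[OF v(2,3)] g0[OF v(1)]
        by (intro mult_mono) (auto simp: L2_set_def intro: sum_nonneg)
      finally show ?thesis .
    qed
    have as: "(\<lambda>i. norm (cinner (W v i) (y i))) summable_on I" if v: "v \<in> S" for v
      by (rule nonneg_bdd_above_summable_on)
         (use fin[OF v] in \<open>auto intro!: bdd_aboveI[of _ "sqrt (g v) * sqrt Y"]\<close>)
    have s: "(\<lambda>i. cinner (W v i) (y i)) summable_on I" if v: "v \<in> S" for v
      by (rule abs_summable_summable[OF as[OF v]])
    have b: "cmod (ell2_inner I (W v) y) \<le> sqrt (g v) * sqrt Y" if v: "v \<in> S" for v
      unfolding ell2_inner_def
      by (rule order_trans[OF norm_infsum_bound[OF as[OF v]] infsum_le_finite_sums[OF as[OF v] fin[OF v]]])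
    have "\<exists>!x. x \<in> S \<and> (\<forall>v\<in>S. ell2_inner I (W v) y = cinner v x)"
    proof (rule riesz_representation[OF S])
      fix v w assume vw: "v \<in> S" "w \<in> S"
      show "ell2_inner I (W (v + w)) y = ell2_inner I (W v) y + ell2_inner I (W w) y"
        unfolding ell2_inner_def
        by (subst infsum_add[symmetric]) (auto simp: W_add vw cinner_add_left intro!: s infsum_cong)
    next
      fix c v assume v: "v \<in> S"
      show "ell2_inner I (W (c *\<^sub>C v)) y = c * ell2_inner I (W v) y"
        unfolding ell2_inner_def by (subst infsum_cmult_right'[symmetric]) (auto simp: W_scale v cinner_scaleC_left intro!: infsum_cong)
    next
      fix v assume v: "v \<in> S"
      have "sqrt (g v) * sqrt Y \<le> sqrt (h * (norm v)\<^sup>2) * sqrt Y"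
        using h[OF v] Y[of "{}"] by (intro mult_right_mono) auto
      then show "cmod (ell2_inner I (W v) y) \<le> (sqrt h * sqrt Y) * norm v"
        using b[OF v] by (simp add: real_sqrt_mult mult_ac)
    qed
    note ex1 = this
    define x where "x = adjoint_on S cinner (ell2_inner I) W y"
    have x: "x \<in> S" "\<And>v. v \<in> S \<Longrightarrow> ell2_inner I (W v) y = cinner v x"
      using theI'[OF ex1] unfolding x_def adjoint_on_def by blast+
    have "cmod (cinner v x) \<le> sqrt Y * sqrt (g v)" if v: "v \<in> S" for v
      using b[OF v] by (simp only: x(2)[OF v] mult.commute)
    then show ?thesis using x(1) x_def Y[of "{}"] by (intro exI[of _ x] exI[of _ "sqrt Y"]) auto
  qed
  \<comment> \<open>The cost of x is the norm of its functional relative to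
    \<open>sqrt (g v)\<close>. Composition with the projection \<open>Q\<close> extends it from S to
    the whole type, as \<open>countably_subadditive_bounded\<close> requires.\<close>
  define R where "R x r \<longleftrightarrow> (\<forall>v\<in>S. cmod (cinner v (Q x)) \<le> r * sqrt (g v))" for x r
  have "\<exists>M>0. \<forall>x. R x (M * norm x)"
  proof (rule countably_subadditive_bounded)
    show "R x s" if "R x r" "r \<le> s" for x r s
      using that g0 mult_right_mono[OF that(2)] unfolding R_def by (meson order_trans real_sqrt_ge_zero)
    show "R (c *\<^sub>R x) (\<bar>c\<bar> * r)" if "R x r" for x r c
      using that mult_left_mono[OF _ abs_ge_zero[of c]] unfolding R_def
      by (auto simp: bounded_clinear_scaleR[OF Q] cinner_scaleR_right norm_mult mult.assoc)
    show "R (\<Sum>k. x k) (\<Sum>k. r k)"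
      if x: "\<And>k. R (x k) (r k)" and r: "\<And>k. r k \<ge> 0" "summable r" and xs: "summable x" for x r
      unfolding R_def
    proof
      fix v assume v: "v \<in> S"
      have "(\<lambda>n. \<Sum>k<n. Q (x k)) \<longlonglongrightarrow> Q (\<Sum>k. x k)"
        using bounded_linear.tendsto[OF bounded_clinear_bounded_linear[OF Q] summable_LIMSEQ[OF xs]]
        by (simp add: bounded_clinear_sum[OF Q])
      then have "(\<lambda>n. cmod (cinner v (\<Sum>k<n. Q (x k)))) \<longlonglongrightarrow> cmod (cinner v (Q (\<Sum>k. x k)))"
        by (intro tendsto_norm tendsto_cinner tendsto_const)
      moreover have "cmod (cinner v (\<Sum>k<n. Q (x k))) \<le> (\<Sum>k. r k) * sqrt (g v)" for n
      proof -
        have "cmod (cinner v (\<Sum>k<n. Q (x k))) \<le> (\<Sum>k<n. r k * sqrt (g v))"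
          unfolding cinner_sum_right using x v unfolding R_def by (intro sum_norm_le) auto
        also have "\<dots> = (\<Sum>k<n. r k) * sqrt (g v)" by (simp add: sum_distrib_right)
        also have "\<dots> \<le> (\<Sum>k. r k) * sqrt (g v)"
          using sum_le_suminf[OF r(2), of "{..<n}"] r(1) g0[OF v] by (intro mult_right_mono) auto
        finally show ?thesis .
      qed
      ultimately show "cmod (cinner v (Q (\<Sum>k. x k))) \<le> (\<Sum>k. r k) * sqrt (g v)"
        by (intro LIMSEQ_le_const2) auto
    qed
    show "\<exists>r. R x r" for x
    proof -
      have "Q x \<in> adjoint_on S cinner (ell2_inner I) W ` ell2 I" using QS surj by simp
      then obtain y where "y \<in> ell2 I" "Q x = adjoint_on S cinner (ell2_inner I) W y" by blast
      then show ?thesis using adj[of y] unfolding R_def by auto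
    qed
  qed
  then obtain M where M: "M > 0" "\<And>x. R x (M * norm x)" by blast
  \<comment> \<open>The functional of v is tested at v itself.\<close>
  have "(1 / M\<^sup>2) * (norm v)\<^sup>2 \<le> g v" if v: "v \<in> S" for v
  proof (cases "v = 0")
    case False
    have "norm v * norm v = cmod (cinner v (Q v))"
      using QS(2)[OF v] by (simp add: cinner_self power2_eq_square norm_mult)
    also have "\<dots> \<le> (M * norm v) * sqrt (g v)" using M(2)[of v] v unfolding R_def by blast
    finally have "norm v \<le> M * sqrt (g v)" using False by simp
    then have "(norm v)\<^sup>2 \<le> (M * sqrt (g v))\<^sup>2" by (intro power_mono) auto
    also have "\<dots> = M\<^sup>2 * g v" using g0[OF v] by (simp add: power_mult_distrib)
    finally show ?thesis using M(1) by (simp add: field_simps)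
  qed (use g0[OF v] in simp)
  then show ?thesis using M(1) by (intro exI[of _ "1 / M\<^sup>2"]) auto
qed

locale riesz_system = dichotomous_system A P J K \<rho> B C D
  for A P J :: "'x::complex_hilbert \<Rightarrow> 'x" and K \<rho> :: real
    and B :: "'u::complex_hilbert \<Rightarrow> 'x" and C :: "'x \<Rightarrow> 'y::complex_hilbert" and D :: "'u \<Rightarrow> 'y" +
  assumes P_riesz: "P = riesz_projection A"
begin

lemma proj_plus_eq: "proj_plus A = P" by (simp add: proj_plus_def P_riesz)

lemma proj_minus_eq: "proj_minus A = (\<lambda>x. x - P x)" by (simp add: proj_minus_def[abs_def] P_riesz)

lemma mem_X_plus: "x \<in> X_plus A \<longleftrightarrow> P x = x"
  unfolding X_plus_def proj_plus_eq using P_idem by (metis rangeE rangeI)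

lemma mem_X_minus: "x \<in> X_minus A \<longleftrightarrow> P x = 0"
proof
  assume "x \<in> X_minus A"
  then show "P x = 0" unfolding X_minus_def proj_minus_eq
    by (auto simp: bounded_clinear_diff[OF P_clinear] P_idem)
next
  assume "P x = 0"
  then have "x = x - P x" by simp
  then show "x \<in> X_minus A" unfolding X_minus_def proj_minus_eq by blast
qed

lemma closed_csubspace_X_plus: "closed_csubspace (X_plus A)"
proof -
  have "closed {x. P x = x}"
    using bounded_linear.continuous_on[OF bounded_clinear_bounded_linear[OF P_clinear] continuous_on_id]
    by (intro closed_Collect_eq) (auto intro: continuous_on_id)
  moreover have "X_plus A = {x. P x = x}" using mem_X_plus by blast
  ultimately show ?thesis unfolding closed_csubspace_def csubspace_def by (auto simp: bounded_clinear_simps[OF P_clinear])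
qed

lemma closed_csubspace_X_minus: "closed_csubspace (X_minus A)"
proof -
  have "closed {x. P x = 0}"
    using bounded_linear.continuous_on[OF bounded_clinear_bounded_linear[OF P_clinear] continuous_on_id]
    by (intro closed_Collect_eq) auto
  moreover have "X_minus A = {x. P x = 0}" using mem_X_minus by blast
  ultimately show ?thesis unfolding closed_csubspace_def csubspace_def by (auto simp: bounded_clinear_simps[OF P_clinear])
qed

lemma P_J_pow: "P x = 0 \<Longrightarrow> P ((J ^^ n) x) = 0"
  by (cases n) (auto simp: P_J)

lemma inv_into_X_minus: "x \<in> X_minus A \<Longrightarrow> inv_into (X_minus A) A x = J x"
proof (rule inv_into_f_eq)
  show "inj_on A (X_minus A)"
    by (rule inj_on_inverseI[where g = J]) (simp add: J_A mem_X_minus)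
qed (auto simp: mem_X_minus P_J A_J)

lemma restr_power_X_minus:
  assumes x: "x \<in> X_minus A" shows "restr_power (X_minus A) A (- int n) x = (J ^^ n) x"
proof -
  have "(inv_into (X_minus A) A ^^ n) x = (J ^^ n) x"
    by (induction n) (use x P_J_pow in \<open>auto simp: inv_into_X_minus mem_X_minus\<close>)
  then show ?thesis by (cases "n = 0") (auto simp: restr_power_def)
qed

lemma ell2_square_summable:
  assumes "u \<in> ell2 I" shows "square_summable u"
  unfolding square_summable_def
  using assms summable_on_cong_neutral[of I UNIV "\<lambda>i. (norm (u i))\<^sup>2" "\<lambda>i. (norm (u i))\<^sup>2"]
  by (auto simp: ell2_def)

lemma infsum_eq_suminf:
  fixes f :: "nat \<Rightarrow> 'x" assumes "summable (\<lambda>n. norm (f n))" shows "infsum f UNIV = suminf f"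
  using norm_summable_imp_has_sum[OF assms] summable_norm_cancel[OF assms] infsumI by blast

lemma Wc_plus_eq:
  assumes u: "square_summable u" shows "Wc_plus A B u = reach_plus u"
proof -
  have "Wc_plus A B u = (\<Sum>\<^sub>\<infinity>j\<in>{..<0}. (A ^^ nat (- j - 1)) (P (B (u j))))"
    unfolding Wc_plus_def proj_plus_eq by (intro infsum_cong) (auto simp: restr_power_def)
  also have "\<dots> = (\<Sum>\<^sub>\<infinity>n\<in>UNIV. (A ^^ nat (- (- int n - 1) - 1)) (P (B (u (- int n - 1)))))"
    by (rule infsum_reindex_bij_betw[symmetric]) (auto intro!: bij_betwI[where g = "\<lambda>j. nat (- j - 1)"])
  also have "\<dots> = reach_plus u"
    using infsum_eq_suminf[OF reach_summable(1)[OF square_summable_bounded[OF u], of "\<lambda>n. - int n - 1"]]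
    by (simp add: reach_plus_def)
  finally show ?thesis .
qed

lemma Wc_minus_eq:
  assumes u: "square_summable u" shows "Wc_minus A B u = reach_minus u"
proof -
  have m: "v - P v \<in> X_minus A" for v by (simp add: mem_X_minus bounded_clinear_diff[OF P_clinear] P_idem)
  have "Wc_minus A B u = (\<Sum>\<^sub>\<infinity>n\<in>UNIV. - restr_power (X_minus A) A (- int n - 1) (proj_minus A (B (u (int n)))))"
    unfolding Wc_minus_def
  proof (rule infsum_reindex_bij_betw[symmetric])
    have "range int = {0..}" using zero_le_imp_eq_int by force
    then show "bij_betw int UNIV {0..}" by (auto simp: bij_betw_def)
  qed
  also have "\<dots> = (\<Sum>\<^sub>\<infinity>n\<in>UNIV. - (J ^^ Suc n) (B (u (int n)) - P (B (u (int n)))))"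
  proof (rule infsum_cong)
    fix n
    have "restr_power (X_minus A) A (- int n - 1) (B (u (int n)) - P (B (u (int n))))
        = (J ^^ Suc n) (B (u (int n)) - P (B (u (int n))))"
    proof -
      have e: "- int n - 1 = - int (Suc n)" by simp
      show ?thesis unfolding e by (rule restr_power_X_minus[OF m])
    qed
    then show "- restr_power (X_minus A) A (- int n - 1) (proj_minus A (B (u (int n))))
        = - (J ^^ Suc n) (B (u (int n)) - P (B (u (int n))))"
      by (simp only: proj_minus_eq)
  qed
  also have "\<dots> = reach_minus u"
    unfolding reach_minus_def by (rule infsum_eq_suminf[OF reach_summable(2)[OF square_summable_bounded[OF u]]])
  finally show ?thesis .
qed

text \<open>The two controls live on complementary half lines, so in their sum the past one feeds
  only \<open>reach_plus\<close> and the future one only \<open>reach_minus\<close>.\<close>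

lemma exactly_controllable_reach:
  assumes "dichotomously_exactly_controllable A B"
  shows "\<exists>u. square_summable u \<and> reach u = x"
proof -
  have "P x \<in> X_plus A" "x - P x \<in> X_minus A"
    by (auto simp: mem_X_plus mem_X_minus P_idem bounded_clinear_diff[OF P_clinear])
  then have "P x \<in> Wc_plus A B ` ell2 {..<0}" "x - P x \<in> Wc_minus A B ` ell2 {0..}"
    using assms unfolding dichotomously_exactly_controllable_def by simp_all
  then obtain u1 u2 where u1: "u1 \<in> ell2 {..<0}" "Wc_plus A B u1 = P x" and u2: "u2 \<in> ell2 {0..}" "Wc_minus A B u2 = x - P x"
    by (elim imageE) simp
  note s = ell2_square_summable[OF u1(1)] ell2_square_summable[OF u2(1)]
  have z: "u2 (- int j - 1) = 0" "u1 (int j) = 0" for j using u1(1) u2(1) by (auto simp: ell2_def)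
  have "reach (\<lambda>n. u1 n + u2 n) = reach_plus u1 + reach_minus u2"
    by (simp add: reach_def reach_plus_def reach_minus_def z)
  also have "\<dots> = x" using u1 u2 s by (simp add: Wc_plus_eq[symmetric] Wc_minus_eq[symmetric])
  finally show ?thesis using square_summable_add[OF s] by blast
qed

text \<open>Iterating the KYP inequality along the free trajectories forward in the stable and backward
  in the unstable subspace bounds the form of \<open>H\<close> by the observability Gramians.\<close>

lemma KYP_definite:
  assumes H: "selfadjoint H"
    and kyp: "\<And>x v. Re (cinner (H (A x + B v)) (A x + B v)) + (norm (C x + D v))\<^sup>2 \<le> Re (cinner (H x) x) + (norm v)\<^sup>2"
    and obs: "dichotomously_exactly_observable A C"
  shows "\<exists>c>0. (\<forall>x\<in>X_plus A. c * (norm x)\<^sup>2 \<le> Re (cinner (H x) x)) \<and>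
    (\<forall>x\<in>X_minus A. c * (norm x)\<^sup>2 \<le> - Re (cinner (H x) x))"
proof -
  define E where "E x = Re (cinner (H x) x)" for x
  obtain h where h: "h > 0" "\<And>x. norm (H x) \<le> h * norm x" using bounded_clinear_bound[OF selfadjointD(1)[OF H]] by blast
  have Eb: "\<bar>E x\<bar> \<le> h * (norm x)\<^sup>2" for x
  proof -
    have "\<bar>E x\<bar> \<le> norm (H x) * norm x"
      unfolding E_def using abs_Re_le_cmod[of "cinner (H x) x"] cinner_cauchy_schwarz[of "H x" x] by linarith
    also have "\<dots> \<le> h * norm x * norm x" by (intro mult_right_mono h) simp
    finally show ?thesis by (simp add: power2_eq_square)
  qed
  \<comment> \<open>The KYP inequality with zero input: along \<open>A\<close> the form decreases by
    at least the output energy.\<close>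
  have step: "E (A x) + (norm (C x))\<^sup>2 \<le> E x" for x
    using kyp[of x 0] by (simp add: E_def bounded_clinear_zero[OF B_clinear] bounded_clinear_zero[OF D_clinear])
  have Elim: "(\<lambda>n. E (y n)) \<longlonglongrightarrow> 0" if y: "\<And>n. norm (y n) \<le> K * \<rho> ^ n * norm x" for y and x :: 'x
  proof -
    have "(\<lambda>n. K * \<rho> ^ n * norm x) \<longlonglongrightarrow> K * 0 * norm x"
      using rho_pos rho_less by (intro tendsto_intros LIMSEQ_realpow_zero) auto
    then have "y \<longlonglongrightarrow> 0" by (intro Lim_null_comparison[of y "\<lambda>n. K * \<rho> ^ n * norm x"]) (auto intro: always_eventually y)
    then have "(\<lambda>n. h * (norm (y n))\<^sup>2) \<longlonglongrightarrow> h * (norm (0::'x))\<^sup>2" by (intro tendsto_intros)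
    then show ?thesis by (intro Lim_null_comparison[of "\<lambda>n. E (y n)" "\<lambda>n. h * (norm (y n))\<^sup>2"]) (auto intro: always_eventually simp: Eb)
  qed
  have plus: "(\<Sum>i<N. (norm (C ((A ^^ i) x)))\<^sup>2) \<le> E x" if x: "x \<in> X_plus A" for x N
  proof -
    have le: "(\<Sum>i<n. (norm (C ((A ^^ i) x)))\<^sup>2) \<le> E x - E ((A ^^ n) x)" for n
    proof (induction n)
      case (Suc n)
      then show ?case using step[of "(A ^^ n) x"] by simp
    qed simp
    have "(\<Sum>i<N. (norm (C ((A ^^ i) x)))\<^sup>2) \<le> E x - E ((A ^^ n) x)" if "n \<ge> N" for n
      by (rule order_trans[OF sum_mono2 le]) (use that in auto)
    moreover have "(\<lambda>n. E x - E ((A ^^ n) x)) \<longlonglongrightarrow> E x - 0"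
      using decay_plus[of _ x] x by (intro tendsto_intros Elim[of _ x]) (simp add: mem_X_plus)
    ultimately show ?thesis by (intro LIMSEQ_le_const[of "\<lambda>n. E x - E ((A ^^ n) x)"]) auto
  qed
  \<comment> \<open>Here the orbit runs backward under \<open>J\<close>. The form at the far past
    tends to zero, and \<open>- E x\<close> remains of the telescoped sum.\<close>
  have minus: "(\<Sum>i<N. (norm (C ((J ^^ Suc i) x)))\<^sup>2) \<le> - E x" if x: "x \<in> X_minus A" for x N
  proof -
    have AJ: "A ((J ^^ Suc i) x) = (J ^^ i) x" for i
      using x P_J_pow[of x i] by (simp add: A_J mem_X_minus)
    have le: "(\<Sum>i<n. (norm (C ((J ^^ Suc i) x)))\<^sup>2) \<le> E ((J ^^ n) x) - E x" for n
    proof (induction n)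
      case (Suc n)
      then show ?case using step[of "(J ^^ Suc n) x"] unfolding AJ by simp
    qed simp
    have "(\<Sum>i<N. (norm (C ((J ^^ Suc i) x)))\<^sup>2) \<le> E ((J ^^ n) x) - E x" if "n \<ge> N" for n
      by (rule order_trans[OF sum_mono2 le]) (use that in auto)
    moreover have "(\<lambda>n. E ((J ^^ n) x) - E x) \<longlonglongrightarrow> 0 - E x"
      using decay_minus[of _ x] x by (intro tendsto_intros Elim[of _ x]) (simp add: mem_X_minus)
    ultimately show ?thesis by (intro LIMSEQ_le_const[of "\<lambda>n. E ((J ^^ n) x) - E x"]) auto
  qed
  have "\<exists>c>0. \<forall>x\<in>X_plus A. c * (norm x)\<^sup>2 \<le> E x"
  proof (rule surjective_adjoint_bounded_below[OF closed_csubspace_X_plus P_clinear])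
    show "(\<Sum>i\<in>F. (norm (Wo_plus A C v i))\<^sup>2) \<le> E v" if v: "v \<in> X_plus A" and F: "finite F" "F \<subseteq> {0..}" for v F
    proof -
      obtain N where N: "nat ` F \<subseteq> {..<N}" using finite_nat_iff_bounded[of "nat ` F"] F by blast
      have "(\<Sum>i\<in>F. (norm (Wo_plus A C v i))\<^sup>2) = (\<Sum>i\<in>nat ` F. (norm (C ((A ^^ i) v)))\<^sup>2)"
        using F by (subst sum.reindex) (auto simp: inj_on_def eq_nat_nat_iff Wo_plus_def restr_power_def subset_iff intro!: sum.cong)
      also have "\<dots> \<le> (\<Sum>i<N. (norm (C ((A ^^ i) v)))\<^sup>2)" using N by (intro sum_mono2) auto
      also have "\<dots> \<le> E v" by (rule plus[OF v])
      finally show ?thesis .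
    qed
    show "adjoint_on (X_plus A) cinner (ell2_inner {0..}) (Wo_plus A C) ` ell2 {0..} = X_plus A"
      using obs by (simp add: dichotomously_exactly_observable_def)
    show "E v \<le> h * (norm v)\<^sup>2" for v using Eb[of v] by linarith
    note AS = bounded_clinear_funpow[OF A_clinear]
    show "Wo_plus A C (v + w) i = Wo_plus A C v i + Wo_plus A C w i" for v w i
      by (simp add: Wo_plus_def restr_power_def bounded_clinear_add[OF AS] bounded_clinear_add[OF C_clinear])
    show "Wo_plus A C (c *\<^sub>C v) i = c *\<^sub>C Wo_plus A C v i" for c v i
      by (simp add: Wo_plus_def restr_power_def bounded_clinear_scaleC[OF AS] bounded_clinear_scaleC[OF C_clinear])
  qed (use h in \<open>auto simp: mem_X_plus P_idem\<close>)
  then obtain c1 where c1: "c1 > 0" "\<And>x. x \<in> X_plus A \<Longrightarrow> c1 * (norm x)\<^sup>2 \<le> E x" by blast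
  have Wom: "Wo_minus A C v i = (if i < 0 then - C ((J ^^ nat (- i)) v) else 0)" if "v \<in> X_minus A" for v i
  proof (cases "i < 0")
    case True
    then have "i = - int (nat (- i))" by simp
    then have "restr_power (X_minus A) A i v = (J ^^ nat (- i)) v" by (metis restr_power_X_minus[OF that])
    then show ?thesis using True by (simp add: Wo_minus_def)
  qed (simp add: Wo_minus_def)
  have "\<exists>c>0. \<forall>x\<in>X_minus A. c * (norm x)\<^sup>2 \<le> - E x"
  proof (rule surjective_adjoint_bounded_below[OF closed_csubspace_X_minus bounded_clinear_diff_op[OF bounded_clinear_ident(1) P_clinear]])
    show "(\<Sum>i\<in>F. (norm (Wo_minus A C v i))\<^sup>2) \<le> - E v" if v: "v \<in> X_minus A" and F: "finite F" "F \<subseteq> {..<0}" for v F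
    proof -
      \<comment> \<open>The times -1, -2, ... are renumbered 0, 1, ...; the output at time i
        involves the power -i = \<open>f i\<close> + 1 of \<open>J\<close>.\<close>
      define f where "f i = nat (- i - 1)" for i :: int
      obtain N where N: "f ` F \<subseteq> {..<N}" using finite_nat_iff_bounded[of "f ` F"] F by blast
      have "(\<Sum>i\<in>F. (norm (Wo_minus A C v i))\<^sup>2) = (\<Sum>i\<in>f ` F. (norm (C ((J ^^ Suc i) v)))\<^sup>2)"
      proof (subst sum.reindex)
        show "inj_on f F"
          by (rule inj_on_inverseI[where g = "\<lambda>n. - int n - 1"]) (use F in \<open>auto simp: f_def subset_iff\<close>)
        have "nat (- i) = Suc (f i)" if "i \<in> F" for i using that F by (auto simp: f_def subset_iff)
        then show "(\<Sum>i\<in>F. (norm (Wo_minus A C v i))\<^sup>2) = sum ((\<lambda>i. (norm (C ((J ^^ Suc i) v)))\<^sup>2) \<circ> f) F"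
          using F by (intro sum.cong refl) (auto simp: Wom[OF v] subset_iff)
      qed
      also have "\<dots> \<le> (\<Sum>i<N. (norm (C ((J ^^ Suc i) v)))\<^sup>2)" using N by (intro sum_mono2) auto
      also have "\<dots> \<le> - E v" by (rule minus[OF v])
      finally show ?thesis .
    qed
    show "adjoint_on (X_minus A) cinner (ell2_inner {..<0}) (Wo_minus A C) ` ell2 {..<0} = X_minus A"
      using obs by (simp add: dichotomously_exactly_observable_def)
    show "- E v \<le> h * (norm v)\<^sup>2" for v using Eb[of v] by linarith
    note JS = bounded_clinear_funpow[OF J_clinear]
    show "Wo_minus A C (v + w) i = Wo_minus A C v i + Wo_minus A C w i" if "v \<in> X_minus A" "w \<in> X_minus A" for v w i
      using that closed_csubspace_X_minus unfolding closed_csubspace_def csubspace_def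
      by (simp add: Wom bounded_clinear_add[OF JS] bounded_clinear_add[OF C_clinear])
    show "Wo_minus A C (c *\<^sub>C v) i = c *\<^sub>C Wo_minus A C v i" if "v \<in> X_minus A" for c v i
      using that closed_csubspace_X_minus unfolding closed_csubspace_def csubspace_def
      by (simp add: Wom bounded_clinear_scaleC[OF JS] bounded_clinear_scaleC[OF C_clinear])
  qed (use h in \<open>auto simp: mem_X_minus P_idem bounded_clinear_diff[OF P_clinear]\<close>)
  then obtain c2 where c2: "c2 > 0" "\<And>x. x \<in> X_minus A \<Longrightarrow> c2 * (norm x)\<^sup>2 \<le> - E x" by blast
  have m: "min c1 c2 * (norm x)\<^sup>2 \<le> c1 * (norm x)\<^sup>2" "min c1 c2 * (norm x)\<^sup>2 \<le> c2 * (norm x)\<^sup>2" for x :: 'x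
    by (intro mult_right_mono; simp)+
  show ?thesis
    using c1(1) c2(1) order_trans[OF m(1) c1(2)] order_trans[OF m(2) c2(2)]
    unfolding E_def by (intro exI[of _ "min c1 c2"]) simp
qed

text \<open>The form \<open>Re \<langle>H x, (2 P - I) x\<rangle>\<close> is coercive, since the mixed terms are imaginary.\<close>

lemma definite_imp_invertible:
  assumes H: "selfadjoint H" and c: "c > 0"
    and plus: "\<And>x. x \<in> X_plus A \<Longrightarrow> c * (norm x)\<^sup>2 \<le> Re (cinner (H x) x)"
    and minus: "\<And>x. x \<in> X_minus A \<Longrightarrow> c * (norm x)\<^sup>2 \<le> - Re (cinner (H x) x)"
  shows "boundedly_invertible H"
proof -
  note Hc = selfadjointD(1)[OF H]
  obtain k where k: "k > 0" "\<And>x. norm (P x) \<le> k * norm x" using bounded_clinear_bound[OF P_clinear] by blast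
  \<comment> \<open>The factor 2 stems from (a + b)^2 \<le> 2 (a^2 + b^2), and 2 k + 1 bounds the
    norm of 2 P - I.\<close>
  have "(c / (2 * (2 * k + 1))) * norm x \<le> norm (H x)" for x
  proof (cases "x = 0")
    case False
    define p q where "p = P x" and "q = x - P x"
    have pq: "x = p + q" "p \<in> X_plus A" "q \<in> X_minus A"
      by (auto simp: p_def q_def mem_X_plus mem_X_minus P_idem bounded_clinear_diff[OF P_clinear])
    have "norm x \<le> norm p + norm q" unfolding pq(1) by (rule norm_triangle_ineq)
    then have "(norm x)\<^sup>2 \<le> (norm p + norm q)\<^sup>2" by (intro power_mono) auto
    also have "\<dots> \<le> 2 * ((norm p)\<^sup>2 + (norm q)\<^sup>2)"
      using sum_squares_bound[of "norm p" "norm q"] by (simp add: power2_sum)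
    finally have 1: "c * (norm x)\<^sup>2 \<le> 2 * (c * (norm p)\<^sup>2 + c * (norm q)\<^sup>2)"
      using mult_left_mono[of "(norm x)\<^sup>2" _ c] c by (fastforce simp: algebra_simps)
    have "Re (cinner (H q) p) = Re (cinner (H p) q)"
      unfolding selfadjointD(2)[OF H, of q p] by (rule Re_cinner_commute)
    then have "Re (cinner (H x) (p - q)) = Re (cinner (H p) p) - Re (cinner (H q) q)"
      unfolding pq(1) bounded_clinear_add[OF Hc] by (simp add: cinner_add_left cinner_diff_right)
    then have "c * (norm x)\<^sup>2 \<le> 2 * Re (cinner (H x) (p - q))" using 1 plus[OF pq(2)] minus[OF pq(3)] by simp
    also have "\<dots> \<le> 2 * (norm (H x) * norm (p - q))" using Re_cinner_le[of "H x" "p - q"] by simp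
    also have "\<dots> \<le> 2 * (norm (H x) * ((2 * k + 1) * norm x))"
    proof (intro mult_left_mono)
      have "p - q = 2 *\<^sub>R P x - x" by (simp add: p_def q_def scaleR_2)
      then have "norm (p - q) \<le> 2 * norm (P x) + norm x" using norm_triangle_ineq4[of "2 *\<^sub>R P x" x] by simp
      then show "norm (p - q) \<le> (2 * k + 1) * norm x" using k(2)[of x] by (simp add: algebra_simps)
    qed auto
    finally have "c * norm x * norm x \<le> (2 * (2 * k + 1) * norm (H x)) * norm x" by (simp add: power2_eq_square algebra_simps)
    then have "c * norm x \<le> 2 * (2 * k + 1) * norm (H x)" using False by simp
    then show ?thesis using k by (simp add: field_simps)
  qed (simp add: bounded_clinear_zero[OF Hc])
  then show ?thesis using c k by (intro selfadjoint_bounded_below_invertible[OF H, of "c / (2 * (2 * k + 1))"]) auto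
qed

end

text \<open>On the circle the inverse of z is \<open>cnj z\<close>, so I - z A is z times the
  operator \<open>cnj z\<close> I - A, and \<open>cnj z\<close> lies on the circle too.\<close>

lemma transfer_resolvent_invertible:
  fixes A :: "'x::complex_hilbert \<Rightarrow> 'x"
  assumes A: "bounded_clinear A" and dich: "has_dichotomy A" and z: "cmod z = 1"
  shows "boundedly_invertible (\<lambda>x. x - z *\<^sub>C A x)"
proof -
  have z0: "cnj z * z = 1" "z * cnj z = 1" using z by (auto simp: complex_norm_square[symmetric] mult.commute[of "cnj z"])
  have "cnj z \<in> sphere 0 1" using z by simp
  with dich have "cnj z \<notin> op_spectrum A" unfolding has_dichotomy_def by blast
  then have i: "boundedly_invertible (\<lambda>x. cnj z *\<^sub>C x - A x)" unfolding op_spectrum_def by simp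
  define R where "R x = inv (\<lambda>x. cnj z *\<^sub>C x - A x) (cnj z *\<^sub>C x)" for x
  have e: "x - z *\<^sub>C A x = z *\<^sub>C (cnj z *\<^sub>C x - A x)" for x
    by (simp add: scaleC_diff_right scaleC_scaleC z0)
  have "bounded_clinear R" unfolding R_def
    by (rule bounded_clinear_compose[OF boundedly_invertible_inv(1)[OF i] bounded_clinear_scaleC_op]) simp
  moreover have "R \<circ> (\<lambda>x. x - z *\<^sub>C A x) = id"
    unfolding e by (auto simp: R_def scaleC_scaleC z0 boundedly_invertible_inv(2)[OF i])
  moreover have "(\<lambda>x. x - z *\<^sub>C A x) \<circ> R = id"
    unfolding e by (auto simp: R_def scaleC_scaleC z0 boundedly_invertible_inv(3)[OF i])
  moreover have "bounded_clinear (\<lambda>x. x - z *\<^sub>C A x)"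
    by (intro bounded_clinear_diff_op bounded_clinear_scaleC_op A) simp
  ultimately show ?thesis unfolding boundedly_invertible_def by blast
qed

lemma transfer_norm_le_1_iff:
  fixes A :: "'x::complex_hilbert \<Rightarrow> 'x"
  assumes A: "bounded_clinear A" and B: "bounded_clinear B" and C: "bounded_clinear C" and D: "bounded_clinear D"
    and dich: "has_dichotomy A"
  shows "transfer_norm A B C D \<le> 1 \<longleftrightarrow>
    (\<forall>z v. cmod z = 1 \<longrightarrow> norm (transfer_function A B C D z v) \<le> norm v)"
proof -
  have bl: "bounded_linear (transfer_function A B C D z)" if "cmod z = 1" for z
    unfolding transfer_function_def[abs_def]
    by (intro bounded_clinear_bounded_linear bounded_clinear_add_op D bounded_clinear_scaleC_op
        bounded_clinear_compose[OF C] bounded_clinear_compose[OF boundedly_invertible_inv(1)[OF transfer_resolvent_invertible[OF A dich that]] B])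
  have "onorm (transfer_function A B C D z) \<le> 1 \<longleftrightarrow> (\<forall>v. norm (transfer_function A B C D z v) \<le> norm v)"
    if z: "cmod z = 1" for z
  proof
    assume o: "onorm (transfer_function A B C D z) \<le> 1"
    show "\<forall>v. norm (transfer_function A B C D z v) \<le> norm v"
    proof
      fix v
      have "norm (transfer_function A B C D z v) \<le> onorm (transfer_function A B C D z) * norm v" by (rule onorm[OF bl[OF z]])
      also have "\<dots> \<le> 1 * norm v" by (rule mult_right_mono[OF o]) simp
      finally show "norm (transfer_function A B C D z v) \<le> norm v" by simp
    qed
  next
    assume "\<forall>v. norm (transfer_function A B C D z v) \<le> norm v"
    then show "onorm (transfer_function A B C D z) \<le> 1" by (intro onorm_bound) auto
  qed
  then show ?thesis unfolding transfer_norm_def by (auto simp: SUP_le_iff one_ereal_def)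
qed

text \<open>One step suffices: with w from the resolvent, the state z w and the input v lead to w.
  Both states have the same value of the form of \<open>H\<close> since \<open>cmod z = 1\<close>,
  so only output and input remain.\<close>

lemma KYP_imp_contractive:
  fixes A :: "'x::complex_hilbert \<Rightarrow> 'x"
  assumes A: "bounded_clinear A" and dich: "has_dichotomy A" and H: "bounded_clinear H" and z: "cmod z = 1"
    and kyp: "\<And>x v. Re (cinner (H (A x + B v)) (A x + B v)) + (norm (C x + D v))\<^sup>2 \<le> Re (cinner (H x) x) + (norm v)\<^sup>2"
    and C: "bounded_clinear C"
  shows "norm (transfer_function A B C D z v) \<le> norm v"
proof -
  define w where "w = inv (\<lambda>x. x - z *\<^sub>C A x) (B v)"
  have w: "w - z *\<^sub>C A w = B v"
    unfolding w_def by (rule boundedly_invertible_inv(3)[OF transfer_resolvent_invertible[OF A dich z]])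
  have s: "A (z *\<^sub>C w) + B v = w" using w by (simp add: bounded_clinear_scaleC[OF A] algebra_simps)
  have zz: "z * cnj z = 1" using z by (simp add: complex_norm_square[symmetric])
  have "Re (cinner (H w) w) + (norm (C (z *\<^sub>C w) + D v))\<^sup>2 \<le> Re (cinner (H w) w) + (norm v)\<^sup>2"
    using kyp[of "z *\<^sub>C w" v] unfolding s
    by (simp only: bounded_clinear_scaleC[OF H] cinner_scaleC_left cinner_scaleC_right mult.assoc[symmetric] zz
        mult.commute[of "cnj z"] mult_1_left)
  then have "(norm (C (z *\<^sub>C w) + D v))\<^sup>2 \<le> (norm v)\<^sup>2" by simp
  then have "norm (C (z *\<^sub>C w) + D v) \<le> norm v" by (rule power2_le_imp_le) simp
  then show ?thesis by (simp add: transfer_function_def w_def bounded_clinear_scaleC[OF C] add.commute)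
qed

context riesz_system
begin

theorem contractive_imp_KYP:
  assumes dich: "has_dichotomy A"
    and ctrl: "dichotomously_exactly_controllable A B" and obs: "dichotomously_exactly_observable A C"
    and contr: "\<And>z v. cmod z = 1 \<Longrightarrow> norm (transfer_function A B C D z v) \<le> norm v"
  shows "\<exists>H. selfadjoint H \<and> boundedly_invertible H \<and> KYP_inequality A B C D H"
proof -
  obtain c where c: "c > 0" "\<And>z v. cmod z = 1 \<Longrightarrow> c * norm v \<le> norm (z *\<^sub>C v - A v)"
    using resolvent_lower_bound[OF A_clinear dich] by blast
  obtain b where b: "b > 0" "\<And>v. norm (B v) \<le> b * norm v" using bounded_clinear_bound[OF B_clinear] by blast
  \<comment> \<open>The constant \<open>b / c\<close> combines the norm bound of \<open>B\<close>
    with the lower bound for the resolvent, and is the same for all z on the circle.\<close>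
  have sol: "\<exists>w. w - z *\<^sub>C A w = B v \<and> norm w \<le> (b / c) * norm v \<and> norm (D v + z *\<^sub>C C w) \<le> norm v"
    if z: "cmod z = 1" for z v
  proof (intro exI conjI)
    let ?w = "inv (\<lambda>x. x - z *\<^sub>C A x) (B v)"
    show e: "?w - z *\<^sub>C A ?w = B v"
      by (rule boundedly_invertible_inv(3)[OF transfer_resolvent_invertible[OF A_clinear dich z]])
    have z0: "cnj z * z = 1" using z by (auto simp: complex_norm_square[symmetric] mult.commute[of "cnj z"])
    have "cnj z *\<^sub>C ?w - A ?w = cnj z *\<^sub>C (?w - z *\<^sub>C A ?w)"
      by (simp add: scaleC_diff_right scaleC_scaleC z0)
    then have "cnj z *\<^sub>C ?w - A ?w = cnj z *\<^sub>C B v" by (simp only: e)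
    then have "c * norm ?w \<le> norm (B v)" using c(2)[of "cnj z" ?w] z by simp
    then have "c * norm ?w \<le> b * norm v" using b(2)[of v] by linarith
    then show "norm ?w \<le> (b / c) * norm v" using c(1) by (simp add: field_simps)
    show "norm (D v + z *\<^sub>C C ?w) \<le> norm v" using contr[OF z, of v] by (simp add: transfer_function_def)
  qed
  interpret contractive_system A P J K \<rho> B C D
  proof
    fix u x assume t: "trajectory u x" and u: "square_summable u"
    have "(\<Sum>n\<in>F. (norm (out_seq u x n))\<^sup>2) \<le> energy u" if F: "finite F" for F
      using b c by (intro trajectory_contractive[OF sol _ t energy_finite[OF u] F]) auto
    from energy_leI[OF this] show "square_summable (out_seq u x) \<and> energy (out_seq u x) \<le> energy u" by blast
  next
    fix x show "\<exists>u. square_summable u \<and> reach u = x" by (rule exactly_controllable_reach[OF ctrl])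
  qed
  obtain H where H: "selfadjoint H" and kyp: "\<And>x v. Re (cinner (H (A x + B v)) (A x + B v)) + (norm (C x + D v))\<^sup>2
      \<le> Re (cinner (H x) x) + (norm v)\<^sup>2"
    using storage_operator by blast
  have "KYP_inequality A B C D H"
    using KYP_inequality_iff[OF A_clinear B_clinear C_clinear D_clinear H] kyp by blast
  moreover have "boundedly_invertible H"
    using KYP_definite[OF H kyp obs] definite_imp_invertible[OF H] by blast
  ultimately show ?thesis using H by blast
qed

end

section \<open>Hilbert dimension and inertia\<close>

lemma vector_space_scaleC: "vector_space (scaleC :: complex \<Rightarrow> 'a::complex_hilbert \<Rightarrow> 'a)"
  by unfold_locales (auto simp: scaleC_add_right scaleC_add_left scaleC_scaleC)

lemma csubspace_range: "bounded_clinear T \<Longrightarrow> csubspace (range T)"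
  unfolding csubspace_def
  by (auto simp flip: bounded_clinear_add bounded_clinear_scaleC intro: range_eqI[where x = 0] simp: bounded_clinear_zero)

definition orthonormal :: "'a::complex_hilbert set \<Rightarrow> bool" where
  "orthonormal E \<longleftrightarrow> (\<forall>e\<in>E. \<forall>f\<in>E. cinner e f = (if e = f then 1 else 0))"

text \<open>A maximal orthonormal subset of S, found by Zorn's lemma, is complete in S: a nonzero
  vector of S orthogonal to it could be normalized and added. Hence the \<open>SOME\<close> in
  \<open>hilbert_dim\<close> denotes a basis.\<close>

lemma orthonormal_basis_exists:
  assumes S: "csubspace S" shows "\<exists>E. orthonormal_basis_of S E"
proof -
  have "\<exists>M\<in>{E. E \<subseteq> S \<and> orthonormal E}. \<forall>X\<in>{E. E \<subseteq> S \<and> orthonormal E}. M \<subseteq> X \<longrightarrow> X = M"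
  proof (rule Zorn_Lemma, rule ballI)
    fix \<C> assume C: "\<C> \<in> chains {E. E \<subseteq> S \<and> orthonormal E}"
    have "orthonormal (\<Union>\<C>)"
      unfolding orthonormal_def
    proof (intro ballI)
      fix e f assume "e \<in> \<Union>\<C>" "f \<in> \<Union>\<C>"
      then obtain X Y where XY: "X \<in> \<C>" "Y \<in> \<C>" "e \<in> X" "f \<in> Y" by blast
      then have "X \<subseteq> Y \<or> Y \<subseteq> X" using C by (auto simp: chains_def chain_subset_def)
      then obtain Z where Z: "Z \<in> \<C>" "e \<in> Z" "f \<in> Z" using XY by blast
      then have "orthonormal Z" using C unfolding chains_def by blast
      then show "cinner e f = (if e = f then 1 else 0)" using Z unfolding orthonormal_def by blast
    qed
    then show "\<Union>\<C> \<in> {E. E \<subseteq> S \<and> orthonormal E}" using C by (auto simp: chains_def)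
  qed
  then obtain E where "E \<in> {E. E \<subseteq> S \<and> orthonormal E}"
    and max0: "\<forall>X\<in>{E. E \<subseteq> S \<and> orthonormal E}. E \<subseteq> X \<longrightarrow> X = E" by (rule bexE)
  then have E: "E \<subseteq> S" "orthonormal E" by simp_all
  have max: "X = E" if "X \<subseteq> S" "orthonormal X" "E \<subseteq> X" for X using max0 that by simp
  have "x = 0" if x: "x \<in> S" "\<And>e. e \<in> E \<Longrightarrow> cinner x e = 0" for x
  proof (rule ccontr)
    assume nz: "x \<noteq> 0"
    define y where "y = of_real (1 / norm x) *\<^sub>C x"
    have yy: "cinner y y = 1"
      using nz by (simp add: cinner_self y_def norm_divide)
    have ye: "cinner y e = 0" "cinner e y = 0" if "e \<in> E" for e
      using x(2)[OF that] cinner_commute[of e x] by (auto simp: y_def cinner_scaleC_left cinner_scaleC_right)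
    have yE: "y \<notin> E" using ye yy by force
    then have "orthonormal (insert y E)" using E(2) yy ye unfolding orthonormal_def by auto
    moreover have "insert y E \<subseteq> S" using E(1) S x(1) unfolding csubspace_def y_def by auto
    ultimately have "y \<in> E" using max[of "insert y E"] by blast
    with yE show False ..
  qed
  then have "orthonormal_basis_of S E"
    using E unfolding orthonormal_basis_of_def orthonormal_def[symmetric] by simp
  then show ?thesis ..
qed

lemma bessel_inequality:
  assumes "orthonormal E" "finite F" "F \<subseteq> E"
  shows "(\<Sum>e\<in>F. (cmod (cinner e x))\<^sup>2) \<le> (norm x)\<^sup>2"
proof -
  define s where "s = (\<Sum>e\<in>F. cinner x e *\<^sub>C e)"
  have se: "cinner e s = cinner e x" if "e \<in> F" for e
  proof -
    have "cinner e s = (\<Sum>f\<in>F. if f = e then cnj (cinner x e) else 0)"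
      unfolding s_def cinner_sum_right cinner_scaleC_right
      using assms that by (intro sum.cong refl) (auto simp: orthonormal_def subset_iff)
    then show ?thesis using assms(2) that by (simp add: cinner_commute[of e x])
  qed
  have "cinner s s = (\<Sum>e\<in>F. cinner x e * cinner e x)"
    using se by (subst s_def) (simp add: cinner_sum_left cinner_scaleC_left)
  also have "\<dots> = (\<Sum>e\<in>F. of_real ((cmod (cinner e x))\<^sup>2))"
  proof (rule sum.cong[OF refl])
    fix e show "cinner x e * cinner e x = of_real ((cmod (cinner e x))\<^sup>2)"
      unfolding complex_norm_square by (subst cinner_commute[of x e]) (rule mult.commute)
  qed
  finally have ss: "(norm s)\<^sup>2 = (\<Sum>e\<in>F. (cmod (cinner e x))\<^sup>2)"
    by (simp add: norm_sq_eq_cinner flip: of_real_sum)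
  have "cinner s x = (\<Sum>e\<in>F. cinner x e * cinner e x)"
    unfolding s_def by (simp add: cinner_sum_left cinner_scaleC_left)
  then have "cinner s x = cinner s s" using \<open>cinner s s = (\<Sum>e\<in>F. cinner x e * cinner e x)\<close> by simp
  then have "Re (cinner x s) = (norm s)\<^sup>2" using Re_cinner_commute[of x s] by (simp add: norm_sq_eq_cinner)
  then have "(norm (x - s))\<^sup>2 = (norm x)\<^sup>2 - (norm s)\<^sup>2" by (simp add: norm_diff_sq)
  then show ?thesis using ss zero_le_power2[of "norm (x - s)"] by linarith
qed

text \<open>By Bessel's inequality the squared coefficients are summable, so only countably many are
  nonzero.\<close>

lemma countable_nonorthogonal:
  assumes E: "orthonormal E" shows "countable {e \<in> E. cinner e x \<noteq> 0}"
proof -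
  have "(\<lambda>e. (cmod (cinner e x))\<^sup>2) summable_on E"
    by (rule nonneg_bdd_above_summable_on)
       (use bessel_inequality[OF E] in \<open>auto intro!: bdd_aboveI[of _ "(norm x)\<^sup>2"]\<close>)
  from summable_countable_real[OF this] show ?thesis by simp
qed

text \<open>For infinite dimension, an orthonormal basis of the source is a union, indexed by a basis of
  the target, of countable sets.\<close>

lemma orthonormal_basis_ordLeq:
  fixes T :: "'a::complex_hilbert \<Rightarrow> 'a"
  assumes T: "bounded_clinear T" and K: "csubspace K" and L: "csubspace L"
    and TKL: "\<And>x. x \<in> K \<Longrightarrow> T x \<in> L" and inj: "\<And>x. x \<in> K \<Longrightarrow> T x = 0 \<Longrightarrow> x = 0"
    and E: "orthonormal_basis_of K E" and F: "orthonormal_basis_of L F"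
  shows "(card_of E, card_of F) \<in> ordLeq"
proof -
  have EK: "E \<subseteq> K" "orthonormal E" and FL: "F \<subseteq> L" "orthonormal F"
    and Fc: "\<And>x. x \<in> L \<Longrightarrow> (\<forall>e\<in>F. cinner x e = 0) \<Longrightarrow> x = 0"
    using E F unfolding orthonormal_basis_of_def orthonormal_def by auto
  have nz: "e \<noteq> 0" if "e \<in> E" for e using that EK(2) unfolding orthonormal_def by force
  show ?thesis
  proof (cases "finite F")
    case False
    \<comment> \<open>For e in E, \<open>T e\<close> is a nonzero vector of L and so not orthogonal
      to all of F. The adjoint turns its coefficient into one of e against a fixed vector.\<close>
    have cov: "E \<subseteq> (\<Union>f\<in>F. {e \<in> E. cinner e (hadj T f) \<noteq> 0})"
    proof
      fix e assume e: "e \<in> E"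
      have "T e \<in> L" "T e \<noteq> 0" using e EK TKL inj nz by auto
      then obtain f where "f \<in> F" "cinner (T e) f \<noteq> 0" using Fc by blast
      then show "e \<in> (\<Union>f\<in>F. {e \<in> E. cinner e (hadj T f) \<noteq> 0})"
        using e by (auto simp: cinner_hadj[OF T])
    qed
    have "(card_of (\<Union>f\<in>F. {e \<in> E. cinner e (hadj T f) \<noteq> 0}), card_of F) \<in> ordLeq"
    proof (rule card_of_UNION_ordLeq_infinite[OF False])
      show "(card_of F, card_of F) \<in> ordLeq" by (rule card_of_mono1) simp
      show "\<forall>f\<in>F. (card_of {e \<in> E. cinner e (hadj T f) \<noteq> 0}, card_of F) \<in> ordLeq"
      proof
        fix f
        have "(card_of {e \<in> E. cinner e (hadj T f) \<noteq> 0}, card_of (UNIV :: nat set)) \<in> ordLeq"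
          using countable_nonorthogonal[OF EK(2)] unfolding countable_def card_of_ordLeq[symmetric] by blast
        moreover have "(card_of (UNIV :: nat set), card_of F) \<in> ordLeq"
          using False infinite_iff_card_of_nat by blast
        ultimately show "(card_of {e \<in> E. cinner e (hadj T f) \<noteq> 0}, card_of F) \<in> ordLeq"
          using ordLeq_transitive by blast
      qed
    qed
    then show ?thesis using card_of_mono1[OF cov] ordLeq_transitive by blast
  next
    case True
    \<comment> \<open>A finite orthonormal basis of L spans it algebraically, and \<open>T\<close>
      maps E to independent vectors, so the exchange lemma compares the cardinalities.\<close>
    interpret cv: vector_space "scaleC :: complex \<Rightarrow> 'a \<Rightarrow> 'a" by (rule vector_space_scaleC)
    have span: "L \<subseteq> cv.span F"
    proof
      fix y assume y: "y \<in> L"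
      define s where "s = (\<Sum>f\<in>F. cinner y f *\<^sub>C f)"
      have sL: "s \<in> L" unfolding s_def using L FL(1) by (intro csubspace_sum) (auto simp: csubspace_def)
      have "cinner s f = cinner y f" if "f \<in> F" for f
      proof -
        have "cinner s f = (\<Sum>g\<in>F. if g = f then cinner y f else 0)"
          unfolding s_def cinner_sum_left cinner_scaleC_left
          using FL(2) that by (intro sum.cong refl) (auto simp: orthonormal_def)
        then show ?thesis using True that by simp
      qed
      then have "y - s = 0" using csubspace_diff[OF L y sL] by (intro Fc) (auto simp: cinner_diff_left)
      then have "y = s" by simp
      moreover have "s \<in> cv.span F"
        unfolding s_def by (rule cv.span_sum) (rule cv.span_scale, rule cv.span_base)
      ultimately show "y \<in> cv.span F" by simp
    qed
    have injE: "inj_on T E"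
    proof (rule inj_onI)
      fix a b assume ab: "a \<in> E" "b \<in> E" "T a = T b"
      have "a - b \<in> K" using csubspace_diff[OF K] ab EK by blast
      moreover have "T (a - b) = 0" using ab by (simp add: bounded_clinear_diff[OF T])
      ultimately show "a = b" using inj by fastforce
    qed
    \<comment> \<open>Stated for finite subsets, since E is not yet known to be finite.\<close>
    have card: "card E0 \<le> card F" if E0: "E0 \<subseteq> E" "finite E0" for E0
    proof -
      have ind: "cv.independent (T ` E0)"
        unfolding cv.independent_explicit_finite_subsets
      proof (intro allI impI ballI)
        fix S u v assume S: "S \<subseteq> T ` E0" "finite S" "(\<Sum>v\<in>S. u v *\<^sub>C v) = 0" and v: "v \<in> S"
        define E1 where "E1 = {e \<in> E0. T e \<in> S}"
        have S1: "S = T ` E1" using S(1) by (auto simp: E1_def)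
        have E1: "E1 \<subseteq> E" "finite E1" using E0 by (auto simp: E1_def)
        define w where "w = (\<Sum>e\<in>E1. u (T e) *\<^sub>C e)"
        have "T w = (\<Sum>v\<in>S. u v *\<^sub>C v)"
          unfolding S1 w_def using inj_on_subset[OF injE E1(1)]
          by (simp add: sum.reindex bounded_clinear_sum[OF T] bounded_clinear_scaleC[OF T])
        moreover have "w \<in> K" unfolding w_def using K EK(1) E1 by (intro csubspace_sum) (auto simp: csubspace_def)
        ultimately have w0: "w = 0" using S(3) inj by simp
        obtain e where e: "e \<in> E1" "v = T e" using v S1 by blast
        have "cinner w e = (\<Sum>f\<in>E1. if f = e then u (T e) else 0)"
          unfolding w_def cinner_sum_left cinner_scaleC_left
          using EK(2) E1 e by (intro sum.cong refl) (auto simp: orthonormal_def subset_iff)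
        then show "u v = 0" using w0 E1 e by simp
      qed
      have "T ` E0 \<subseteq> cv.span F" using E0 EK(1) TKL span by blast
      from cv.independent_span_bound[OF True ind this]
      show ?thesis using card_image[OF inj_on_subset[OF injE E0(1)]] by simp
    qed
    have "finite E \<and> card E \<le> card F" by (rule finite_if_finite_subsets_card_bdd) (use card in auto)
    then obtain g where "g ` E \<subseteq> F" "inj_on g E" using True card_le_inj[of E F] by blast
    then show ?thesis using card_of_ordLeq by blast
  qed
qed

lemma hilbert_dim_ordLeq:
  fixes T :: "'a::complex_hilbert \<Rightarrow> 'a"
  assumes "bounded_clinear T" "csubspace K" "csubspace L"
    and "\<And>x. x \<in> K \<Longrightarrow> T x \<in> L" "\<And>x. x \<in> K \<Longrightarrow> T x = 0 \<Longrightarrow> x = 0"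
  shows "(hilbert_dim K, hilbert_dim L) \<in> ordLeq"
  unfolding hilbert_dim_def
  by (rule orthonormal_basis_ordLeq[OF assms someI_ex[OF orthonormal_basis_exists[OF assms(2)]]
        someI_ex[OF orthonormal_basis_exists[OF assms(3)]]])

section \<open>Consequences of having a spectral measure\<close>

context
  fixes H :: "'a::complex_hilbert \<Rightarrow> 'a" and E :: "real set \<Rightarrow> 'a \<Rightarrow> 'a"
  assumes E: "spectral_measure_of H E"
begin

lemma spectral_measure_projection: "S \<in> sets borel \<Longrightarrow> orthogonal_projection (E S)"
  using E by (simp add: spectral_measure_of_def)

lemma spectral_measure_clinear: "S \<in> sets borel \<Longrightarrow> bounded_clinear (E S)"
  using spectral_measure_projection by (simp add: orthogonal_projection_def selfadjoint_def)

lemma spectral_measure_idem: "S \<in> sets borel \<Longrightarrow> E S (E S x) = E S x"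
  using spectral_measure_projection[of S] unfolding orthogonal_projection_def by (metis o_apply)

lemma spectral_measure_form: "S \<in> sets borel \<Longrightarrow> Re (cinner (E S x) x) = (norm (E S x))\<^sup>2"
  using spectral_measure_projection[of S] spectral_measure_idem[of S x] selfadjointD(2)[of "E S" "E S x" x]
  by (simp add: orthogonal_projection_def norm_sq_eq_cinner Re_cinner_commute)

lemma spectral_measure_sums:
  "range F \<subseteq> sets borel \<Longrightarrow> disjoint_family F \<Longrightarrow> (\<lambda>n. E (F n) x) sums E (\<Union>n. F n) x"
  using E by (simp add: spectral_measure_of_def)

text \<open>Countable additivity for the constant sequence of empty sets yields a convergent
  constant series, whose terms must vanish.\<close>

lemma spectral_measure_empty: "E {} x = 0"
proof -
  have "(\<lambda>n. E {} x) sums E (\<Union>n::nat. {}) x"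
    by (rule spectral_measure_sums) (auto simp: disjoint_family_on_def)
  then show ?thesis by (auto dest: sums_summable simp: summable_const_iff)
qed

lemma spectral_measure_union:
  assumes "S \<in> sets borel" "T \<in> sets borel" "S \<inter> T = {}"
  shows "E (S \<union> T) x = E S x + E T x"
proof -
  define F where "F n = (if n = 0 then S else if n = (1::nat) then T else {})" for n
  have "(\<lambda>n. E (F n) x) sums E (\<Union>n. F n) x"
    by (rule spectral_measure_sums) (use assms in \<open>auto simp: F_def disjoint_family_on_def\<close>)
  moreover have "(\<Union>n. F n) = S \<union> T" by (auto simp: F_def split: if_splits)
  moreover have "(\<lambda>n. E (F n) x) sums (\<Sum>n\<in>{0, 1}. E (F n) x)"
    by (rule sums_finite) (auto simp: F_def spectral_measure_empty)
  ultimately show ?thesis using sums_unique2 by (fastforce simp: F_def)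
qed

lemma sets_scalar_measure [simp]: "sets (scalar_measure E x) = sets borel" "space (scalar_measure E x) = UNIV"
  unfolding scalar_measure_def using sets.sigma_sets_eq[of "borel :: real measure"]
  by (simp_all add: sets_measure_of space_measure_of)

text \<open>\<open>measure_of\<close> returns the intended values only for a countably additive set
  function; this property is inherited from the strong additivity of \<open>E\<close>.\<close>

lemma emeasure_scalar_measure:
  assumes "S \<in> sets borel" shows "emeasure (scalar_measure E x) S = ennreal ((norm (E S x))\<^sup>2)"
proof -
  have "emeasure (scalar_measure E x) S = ennreal (Re (cinner (E S x) x))"
    unfolding scalar_measure_def
  proof (rule emeasure_measure_of_sigma)
    show "sigma_algebra UNIV (sets (borel :: real measure))"
      using sets.sigma_algebra_axioms[of "borel :: real measure"] by simp
    show "positive (sets borel) (\<lambda>S. ennreal (Re (cinner (E S x) x)))"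
      by (simp add: positive_def spectral_measure_empty)
    show "countably_additive (sets borel) (\<lambda>S. ennreal (Re (cinner (E S x) x)))"
    proof (rule countably_additiveI)
      fix F :: "nat \<Rightarrow> real set" assume F: "range F \<subseteq> sets borel" "disjoint_family F"
      have "(\<lambda>n. Re (cinner (E (F n) x) x)) sums Re (cinner (E (\<Union>n. F n) x) x)"
        by (intro sums_Re bounded_linear.sums[OF bounded_bilinear.bounded_linear_left[OF bounded_bilinear_cinner]]
            spectral_measure_sums F)
      then show "(\<Sum>n. ennreal (Re (cinner (E (F n) x) x))) = ennreal (Re (cinner (E (\<Union>(range F)) x) x))"
      proof (subst suminf_ennreal2)
        show "0 \<le> Re (cinner (E (F n) x) x)" for n using F(1) by (subst spectral_measure_form) auto
      qed (auto simp: sums_iff)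
    qed
  qed fact
  then show ?thesis by (simp add: spectral_measure_form assms)
qed

lemma spectral_measure_AE: "S \<in> sets borel \<Longrightarrow> E S x = 0 \<Longrightarrow> AE t in scalar_measure E x. t \<notin> S"
  by (rule AE_I[where N = S]) (auto simp: emeasure_scalar_measure)

lemma spectral_measure_quadratic: "Re (cinner (H x) x) = (\<integral>t. t \<partial>scalar_measure E x)"
  using E by (simp add: spectral_measure_of_def)

lemma spectral_measure_nonneg:
  assumes "E {..<0} x = 0" shows "Re (cinner (H x) x) \<ge> 0"
  unfolding spectral_measure_quadratic
  using spectral_measure_AE[OF _ assms] by (intro integral_nonneg_AE) auto

lemma spectral_measure_nonpos:
  assumes "E {0<..} x = 0" shows "Re (cinner (H x) x) \<le> 0"
proof -
  have "(\<integral>t. - t \<partial>scalar_measure E x) \<ge> 0"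
    using spectral_measure_AE[OF _ assms] by (intro integral_nonneg_AE) auto
  then show ?thesis unfolding spectral_measure_quadratic by simp
qed

text \<open>Positivity takes the place of multiplicativity: the part of x over \<open>- S\<close>
  vanishes, and it is the sum of two parts whose forms are nonnegative.\<close>

lemma spectral_measure_disjoint:
  assumes S: "S \<in> sets borel" and T: "T \<in> sets borel" "S \<inter> T = {}" and x: "E S x = x"
  shows "E T x = 0"
proof -
  have "E UNIV x = E S x + E (- S) x" using spectral_measure_union[of S "- S" x] S by (simp add: Compl_partition)
  then have "E (- S) x = 0" using E x by (simp add: spectral_measure_of_def)
  moreover have "E (T \<union> (- S - T)) x = E T x + E (- S - T) x" using S T by (intro spectral_measure_union) auto
  moreover have "T \<union> (- S - T) = - S" using T by auto
  ultimately have "cinner (E T x) x + cinner (E (- S - T) x) x = 0"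
    by (simp add: cinner_add_left[symmetric])
  then have "Re (cinner (E T x) x) + Re (cinner (E (- S - T) x) x) = 0" by (metis plus_complex.sel(1) zero_complex.sel(1))
  then have "(norm (E T x))\<^sup>2 + (norm (E (- S - T) x))\<^sup>2 = 0" using S T by (simp add: spectral_measure_form)
  then show ?thesis by (simp add: add_nonneg_eq_0_iff)
qed

end

context riesz_system
begin

text \<open>A vector in the kernel of one of the four restricted maps lies in a Riesz subspace,
  where the form of \<open>H\<close> is definite, and also where the form has the opposite weak
  sign; so it is zero. Antisymmetry of the cardinal order gives equality of the dimensions.\<close>

theorem inertia:
  assumes ex: "\<exists>E. spectral_measure_of H E" and c: "c > 0"
    and plus: "\<And>x. x \<in> X_plus A \<Longrightarrow> c * (norm x)\<^sup>2 \<le> Re (cinner (H x) x)"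
    and minus: "\<And>x. x \<in> X_minus A \<Longrightarrow> c * (norm x)\<^sup>2 \<le> - Re (cinner (H x) x)"
  shows "(hilbert_dim (X_plus A), hilbert_dim (spectral_subspace H {0<..})) \<in> ordIso"
    and "(hilbert_dim (X_minus A), hilbert_dim (spectral_subspace H {..<0})) \<in> ordIso"
proof -
  define E where "E = (SOME E. spectral_measure_of H E)"
  have E: "spectral_measure_of H E" unfolding E_def by (rule someI_ex[OF ex])
  have sub: "spectral_subspace H S = range (E S)" for S
    by (simp add: spectral_subspace_def spectral_projection_def[abs_def] E_def)
  have Q: "bounded_clinear (\<lambda>x. x - P x)" by (intro bounded_clinear_diff_op P_clinear) simp
  have cs: "csubspace (X_plus A)" "csubspace (X_minus A)"
    using closed_csubspace_X_plus closed_csubspace_X_minus by (auto simp: closed_csubspace_def)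
  note Ecl = spectral_measure_clinear[OF E]
  have zero: "x = 0" if "c * (norm x)\<^sup>2 \<le> 0" for x :: 'x
    using that c by (simp add: mult_le_0_iff)
  have pos: "Re (cinner (H x) x) \<ge> 0" if "x \<in> range (E {0<..})" for x
    using that spectral_measure_idem[OF E, of "{0<..}"]
    by (intro spectral_measure_nonneg[OF E] spectral_measure_disjoint[OF E, of "{0<..}"]) auto
  have neg: "Re (cinner (H x) x) \<le> 0" if "x \<in> range (E {..<0})" for x
    using that spectral_measure_idem[OF E, of "{..<0}"]
    by (intro spectral_measure_nonpos[OF E] spectral_measure_disjoint[OF E, of "{..<0}"]) auto
  have "(hilbert_dim (X_plus A), hilbert_dim (spectral_subspace H {0<..})) \<in> ordLeq"
    unfolding sub
  proof (rule hilbert_dim_ordLeq[OF _ cs(1) csubspace_range])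
    show "bounded_clinear (E {0<..})" "bounded_clinear (E {0<..})" by (rule Ecl, simp)+
    fix x assume "x \<in> X_plus A" "E {0<..} x = 0"
    then show "x = 0" using plus[of x] spectral_measure_nonpos[OF E, of x] by (intro zero) simp
  qed simp
  moreover have "(hilbert_dim (spectral_subspace H {0<..}), hilbert_dim (X_plus A)) \<in> ordLeq"
    unfolding sub
  proof (rule hilbert_dim_ordLeq[OF P_clinear csubspace_range cs(1)])
    show "bounded_clinear (E {0<..})" by (rule Ecl) simp
    fix x assume x: "x \<in> range (E {0<..})" "P x = 0"
    then show "x = 0" using minus[of x] pos[of x] by (intro zero) (simp add: mem_X_minus)
  qed (simp add: mem_X_plus P_idem)
  ultimately show "(hilbert_dim (X_plus A), hilbert_dim (spectral_subspace H {0<..})) \<in> ordIso"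
    by (simp add: ordIso_iff_ordLeq)
  have "(hilbert_dim (X_minus A), hilbert_dim (spectral_subspace H {..<0})) \<in> ordLeq"
    unfolding sub
  proof (rule hilbert_dim_ordLeq[OF _ cs(2) csubspace_range])
    show "bounded_clinear (E {..<0})" "bounded_clinear (E {..<0})" by (rule Ecl, simp)+
    fix x assume "x \<in> X_minus A" "E {..<0} x = 0"
    then show "x = 0" using minus[of x] spectral_measure_nonneg[OF E, of x] by (intro zero) simp
  qed simp
  moreover have "(hilbert_dim (spectral_subspace H {..<0}), hilbert_dim (X_minus A)) \<in> ordLeq"
    unfolding sub
  proof (rule hilbert_dim_ordLeq[OF Q csubspace_range cs(2)])
    show "bounded_clinear (E {..<0})" by (rule Ecl) simp
    fix x assume x: "x \<in> range (E {..<0})" "x - P x = 0"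
    then show "x = 0" using plus[of x] neg[of x] by (intro zero) (simp add: mem_X_plus)
  qed (simp add: mem_X_minus P_idem bounded_clinear_diff[OF P_clinear])
  ultimately show "(hilbert_dim (X_minus A), hilbert_dim (spectral_subspace H {..<0})) \<in> ordIso"
    by (simp add: ordIso_iff_ordLeq)
qed

end

section \<open>The Hausdorff moment problem\<close>

lemma poly_eq_sum_powers: "(p :: real poly) = (\<Sum>i\<le>degree p. smult (coeff p i) ([:0, 1:] ^ i))"
  by (rule poly_as_sum_of_monoms[symmetric, THEN trans]) (simp add: monom_altdef)

text \<open>The Bernstein weights of the functional are discrete probability
  measures on the unit interval, and a weak limit exists by Helly's selection theorem.\<close>

context
  fixes L :: "real poly \<Rightarrow> real"
  assumes L_add: "\<And>p q. L (p + q) = L p + L q" and L_smult: "\<And>c p. L (smult c p) = c * L p"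
    and L_pos: "\<And>k m. L ([:0, 1:] ^ k * [:1, -1:] ^ m) \<ge> 0"
begin

lemma L_sum: "L (\<Sum>i\<in>I. f i) = (\<Sum>i\<in>I. L (f i))"
proof (induction I rule: infinite_finite_induct)
  case (infinite I) then show ?case using L_smult[of 0 0] by simp
next
  case empty then show ?case using L_smult[of 0 0] by simp
qed (simp add: L_add)

text \<open>The index i stands for the functional that maps p to the value of \<open>L\<close> at
  x^i p, with x the variable. The induction on moments trades a factor k / n for an increase of
  i.\<close>

definition bernstein_weight :: "nat \<Rightarrow> nat \<Rightarrow> nat \<Rightarrow> real" where
  "bernstein_weight i n k = real (n choose k) * L ([:0, 1:] ^ (i + k) * [:1, -1:] ^ (n - k))"

lemma bernstein_weight_nonneg: "bernstein_weight i n k \<ge> 0"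
  by (simp add: bernstein_weight_def L_pos)

lemma sum_bernstein_weight: "(\<Sum>k\<le>n. bernstein_weight i n k) = L ([:0, 1:] ^ i)"
proof -
  have "(\<Sum>k\<le>n. bernstein_weight i n k)
      = L ([:0, 1:] ^ i * (\<Sum>k\<le>n. of_nat (n choose k) * [:0, 1:] ^ k * [:1, -1:] ^ (n - k)))"
    by (simp add: bernstein_weight_def L_smult[symmetric] L_sum[symmetric] sum_distrib_left power_add of_nat_poly mult_ac)
  also have "(\<Sum>k\<le>n. of_nat (n choose k) * [:0, 1:] ^ k * [:1, -1:] ^ (n - k)) = ([:0, 1:] + [:1, -1:] :: real poly) ^ n"
    by (rule binomial_ring[symmetric])
  also have "[:0, 1:] + [:1, -1:] = (1 :: real poly)" by (simp add: one_pCons)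
  finally show ?thesis by simp
qed

lemma bernstein_moments:
  "(\<lambda>n. \<Sum>k\<le>n. (real k / real n) ^ j * bernstein_weight i n k) \<longlonglongrightarrow> L ([:0, 1:] ^ (i + j))"
proof (induction j arbitrary: i)
  case 0
  then show ?case by (simp add: sum_bernstein_weight)
next
  case (Suc j)
  define S where "S j i n = (\<Sum>k\<le>n. (real k / real n) ^ j * bernstein_weight i n k)" for j i n
  \<comment> \<open>The absorption identity for binomial coefficients turns the factor (k + 1) / (m
    + 1) into a raised index i.\<close>
  have shift: "(real (Suc k) / real (Suc m)) * bernstein_weight i (Suc m) (Suc k) = bernstein_weight (Suc i) m k" for k m
  proof -
    have "real (Suc k) * real (Suc m choose Suc k) = real (Suc m) * real (m choose k)"
      using Suc_times_binomial[of k m] by (simp only: of_nat_mult[symmetric])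
    then have "(real (Suc k) / real (Suc m)) * real (Suc m choose Suc k) = real (m choose k)"
      by (simp only: times_divide_eq_left) (simp del: of_nat_Suc binomial_Suc_Suc)
    then show ?thesis unfolding bernstein_weight_def mult.assoc[symmetric] by (simp del: of_nat_Suc binomial_Suc_Suc)
  qed
  have S1: "S (Suc j) i (Suc m) = (\<Sum>k\<le>m. (real (Suc k) / real (Suc m)) ^ j * bernstein_weight (Suc i) m k)" for m
    unfolding S_def by (subst sum.atMost_Suc_shift) (simp add: shift[symmetric] mult_ac del: of_nat_Suc)
  \<comment> \<open>After the shift the nodes are (k + 1) / (m + 1) in place of k / m. They differ
    by at most 1 / (m + 1), and their j-th powers by at most j times that.\<close>
  have le: "\<bar>S (Suc j) i (Suc m) - S j (Suc i) m\<bar> \<le> (real j * L ([:0, 1:] ^ Suc i)) * (1 / real (Suc m))" for m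
  proof -
    have "\<bar>S (Suc j) i (Suc m) - S j (Suc i) m\<bar>
        = \<bar>\<Sum>k\<le>m. ((real (Suc k) / real (Suc m)) ^ j - (real k / real m) ^ j) * bernstein_weight (Suc i) m k\<bar>"
      unfolding S1 by (simp add: S_def sum_subtractf left_diff_distrib del: of_nat_Suc)
    also have "\<dots> \<le> (\<Sum>k\<le>m. \<bar>((real (Suc k) / real (Suc m)) ^ j - (real k / real m) ^ j) * bernstein_weight (Suc i) m k\<bar>)"
      by (rule sum_abs)
    also have "\<dots> \<le> (\<Sum>k\<le>m. (real j * (1 / real (Suc m))) * bernstein_weight (Suc i) m k)"
    proof (rule sum_mono)
      fix k assume "k \<in> {..m}"
      then have k: "k \<le> m" by simp
      have d: "\<bar>real (Suc k) / real (Suc m) - real k / real m\<bar> \<le> 1 / real (Suc m)"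
      \<comment> \<open>For m = 0 the second node is 0 / 0 = 0, and the difference is exactly
        1.\<close>
      proof (cases "m = 0")
        case False
        have "real (Suc k) / real (Suc m) - real k / real m = (1 - real k / real m) / real (Suc m)"
          using False by (simp add: divide_simps) (simp add: algebra_simps)
        moreover have "0 \<le> 1 - real k / real m" "1 - real k / real m \<le> 1" using k False by (auto simp: field_simps)
        ultimately show ?thesis by (simp add: divide_right_mono del: of_nat_Suc)
      qed (use k in simp)
      have "\<bar>(real (Suc k) / real (Suc m)) ^ j - (real k / real m) ^ j\<bar> \<le> real j * \<bar>real (Suc k) / real (Suc m) - real k / real m\<bar>"
      proof -
        have "norm (real (Suc k) / real (Suc m)) \<le> 1" "norm (real k / real m) \<le> 1"
          using k by (auto simp: divide_le_eq_1)
        from norm_power_diff[OF this, of j] show ?thesis by (simp only: real_norm_def)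
      qed
      also have "\<dots> \<le> real j * (1 / real (Suc m))" by (intro mult_left_mono d) simp
      finally show "\<bar>((real (Suc k) / real (Suc m)) ^ j - (real k / real m) ^ j) * bernstein_weight (Suc i) m k\<bar>
          \<le> (real j * (1 / real (Suc m))) * bernstein_weight (Suc i) m k"
        unfolding abs_mult using bernstein_weight_nonneg[of "Suc i" m k] by (intro mult_mono) auto
    qed
    also have "\<dots> = (real j * L ([:0, 1:] ^ Suc i)) * (1 / real (Suc m))"
      unfolding sum_distrib_left[symmetric] sum_bernstein_weight by simp
    finally show ?thesis .
  qed
  have "(\<lambda>m. (real j * L ([:0, 1:] ^ Suc i)) * (1 / real (Suc m))) \<longlonglongrightarrow> (real j * L ([:0, 1:] ^ Suc i)) * 0"
    using LIMSEQ_Suc[OF lim_inverse_n'] by (intro tendsto_intros) simp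
  then have "(\<lambda>m. (real j * L ([:0, 1:] ^ Suc i)) * (1 / real (Suc m))) \<longlonglongrightarrow> 0" by (simp only: mult_zero_right)
  then have "(\<lambda>m. S (Suc j) i (Suc m) - S j (Suc i) m) \<longlonglongrightarrow> 0"
    by (rule Lim_null_comparison[rotated]) (intro always_eventually allI, simp only: real_norm_def le)
  moreover have "(\<lambda>m. S j (Suc i) m) \<longlonglongrightarrow> L ([:0, 1:] ^ (Suc i + j))" unfolding S_def by (rule Suc.IH)
  ultimately have "(\<lambda>m. (S (Suc j) i (Suc m) - S j (Suc i) m) + S j (Suc i) m) \<longlonglongrightarrow> 0 + L ([:0, 1:] ^ (Suc i + j))"
    by (rule tendsto_add)
  then have "(\<lambda>m. S (Suc j) i (Suc m)) \<longlonglongrightarrow> L ([:0, 1:] ^ (i + Suc j))" by simp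
  then show ?case unfolding S_def by (rule LIMSEQ_imp_Suc)
qed

lemma bernstein_limit: "(\<lambda>n. \<Sum>k\<le>n. poly p (real k / real n) * bernstein_weight 0 n k) \<longlonglongrightarrow> L p"
proof -
  have "(\<lambda>n. \<Sum>j\<le>degree p. coeff p j * (\<Sum>k\<le>n. (real k / real n) ^ j * bernstein_weight 0 n k))
      \<longlonglongrightarrow> (\<Sum>j\<le>degree p. coeff p j * L ([:0, 1:] ^ (0 + j)))"
    by (intro tendsto_intros bernstein_moments)
  moreover have "(\<Sum>j\<le>degree p. coeff p j * L ([:0, 1:] ^ (0 + j))) = L p"
    by (subst (3) poly_eq_sum_powers) (simp add: L_sum L_smult)
  moreover have "(\<Sum>j\<le>degree p. coeff p j * (\<Sum>k\<le>n. (real k / real n) ^ j * bernstein_weight 0 n k))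
      = (\<Sum>k\<le>n. poly p (real k / real n) * bernstein_weight 0 n k)" for n
    unfolding poly_altdef sum_distrib_left sum_distrib_right
    by (subst sum.swap) (simp add: mult_ac)
  ultimately show ?thesis by simp
qed

lemma hausdorff_probability:
  assumes L1: "L 1 = 1"
  shows "\<exists>M. real_distribution M \<and> (AE t in M. t \<in> {0..1}) \<and> (\<forall>p. (\<integral>t. poly p t \<partial>M) = L p)"
proof -
  define w where "w n k = (if k \<le> n then bernstein_weight 0 n k else 0)" for n k
  have w_nn: "w n k \<ge> 0" for n k by (simp add: w_def bernstein_weight_nonneg)
  have w_sum: "(\<integral>\<^sup>+ k. ennreal (w n k) \<partial>count_space UNIV) = 1" for n
  proof -
    have "(\<integral>\<^sup>+ k. ennreal (w n k) \<partial>count_space UNIV) = (\<Sum>k\<le>n. ennreal (w n k))"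
      by (rule nn_integral_count_space'[of "{..n}"]) (auto simp: w_def)
    also have "\<dots> = ennreal (\<Sum>k\<le>n. w n k)" by (rule sum_ennreal) (simp add: w_nn)
    also have "(\<Sum>k\<le>n. w n k) = 1" using sum_bernstein_weight[of 0 n] L1 by (simp add: w_def)
    finally show ?thesis by simp
  qed
  define q where "q n = embed_pmf (w n)" for n
  have pmf_q: "pmf (q n) k = w n k" for n k
    unfolding q_def by (rule pmf_embed_pmf[OF w_nn w_sum])
  have set_q: "set_pmf (q n) \<subseteq> {..n}" for n
    by (auto simp: set_pmf_iff pmf_q w_def split: if_splits)
  define \<mu> where "\<mu> n = distr (measure_pmf (q n)) borel (\<lambda>k. real k / real n)" for n
  have in01: "real k / real n \<in> {0..1}" if "k \<in> set_pmf (q n)" for k n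
    using that set_q[of n] by (auto simp: divide_le_eq_1)
  have rd: "real_distribution (\<mu> n)" for n
    unfolding \<mu>_def by (rule prob_space.real_distribution_distr[OF measure_pmf.prob_space_axioms]) simp
  have int: "(\<integral>t. f t \<partial>\<mu> n) = (\<Sum>k\<le>n. f (real k / real n) * bernstein_weight 0 n k)" if "f \<in> borel_measurable borel" for f n
  proof -
    have "(\<integral>t. f t \<partial>\<mu> n) = (\<integral>k. f (real k / real n) \<partial>measure_pmf (q n))"
      unfolding \<mu>_def by (rule integral_distr) (use that in auto)
    also have "\<dots> = (\<Sum>k\<le>n. pmf (q n) k *\<^sub>R f (real k / real n))"
      by (rule integral_measure_pmf) (use set_q in auto)
    finally show ?thesis by (simp add: pmf_q w_def mult.commute)
  qed
  have "tight \<mu>"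
    unfolding tight_def
  proof (intro conjI allI impI)
    fix \<epsilon> :: real assume e: "\<epsilon> > 0"
    \<comment> \<open>Tightness is stated with intervals open on the left, so the left end is moved
      to -1 in order to include the node 0.\<close>
    have "measure (\<mu> n) {-1<..1} = 1" for n
    proof -
      have "measure (\<mu> n) {-1<..1} = measure (measure_pmf (q n)) ((\<lambda>k. real k / real n) -` {-1<..1})"
        unfolding \<mu>_def by (subst measure_distr) auto
      also have "\<dots> = 1"
      proof (rule measure_pmf.prob_eq_1[THEN iffD2])
        have "real k / real n \<in> {-1<..1}" if "k \<in> set_pmf (q n)" for k
          using in01[OF that] unfolding atLeastAtMost_iff greaterThanAtMost_iff by linarith
        then show "AE k in measure_pmf (q n). k \<in> (\<lambda>k. real k / real n) -` {-1<..1}"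
          by (simp add: AE_measure_pmf_iff)
      qed simp
      finally show ?thesis .
    qed
    then show "\<exists>a b. a < b \<and> (\<forall>n. 1 - \<epsilon> < measure (\<mu> n) {a<..b})"
      using e by (intro exI[of _ "-1"] exI[of _ 1]) auto
  qed (rule rd)
  from tight_imp_convergent_subsubsequence[OF this strict_mono_id]
  obtain r M where r: "strict_mono r" and M: "real_distribution M" and wc: "weak_conv_m (\<mu> \<circ> id \<circ> r) M" by blast
  interpret M: real_distribution M by (rule M)
  have lim: "(\<lambda>n. \<integral>t. f t \<partial>\<mu> (r n)) \<longlonglongrightarrow> (\<integral>t. f t \<partial>M)" if f: "\<And>x. isCont f x" "\<And>x. norm (f x) \<le> B" for f :: "real \<Rightarrow> real" and B
    using weak_conv_imp_integral_bdd_continuous_conv[OF _ M wc f] rd by (simp add: o_def)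
  \<comment> \<open>A bounded continuous function that vanishes exactly on the unit interval. Its
    integral against the limit is zero, so the limit measure is concentrated there.\<close>
  define dst where "dst t = min 1 (max 0 (max (- t) (t - 1)))" for t :: real
  have dcont: "isCont dst x" for x
    unfolding dst_def by (intro continuous_intros)
  have d1: "norm (dst x) \<le> 1" for x by (auto simp: dst_def)
  have "(\<integral>t. dst t \<partial>\<mu> n) = 0" for n
  proof -
    have d0: "dst t = 0" if "0 \<le> t" "t \<le> 1" for t using that by (simp add: dst_def max_def min_def)
    have "dst (real k / real n) = 0" if "k \<le> n" for k using that by (intro d0) (auto simp: divide_le_eq_1)
    then show ?thesis
      by (subst int) (auto intro!: borel_measurable_continuous_onI continuous_at_imp_continuous_on dcont)
  qed
  then have "(\<integral>t. dst t \<partial>M) = 0" using lim[OF dcont d1] by (simp add: LIMSEQ_const_iff)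
  moreover have "integrable M dst"
  proof (rule M.integrable_const_bound[of _ 1])
    show "dst \<in> borel_measurable M"
      by (subst measurable_cong_sets[OF M.events_eq_borel refl])
         (intro borel_measurable_continuous_onI continuous_at_imp_continuous_on ballI dcont)
  qed (use d1 in simp)
  ultimately have "AE t in M. dst t = 0"
    by (subst (asm) integral_nonneg_eq_0_iff_AE) (auto simp: dst_def)
  then have AE01: "AE t in M. t \<in> {0..1}"
    by eventually_elim (auto simp: dst_def min_def max_def split: if_splits)
  have "(\<integral>t. poly p t \<partial>M) = L p" for p
  proof -
    \<comment> \<open>Weak convergence needs bounded test functions; clamping the argument alters
      the polynomial only off the unit interval.\<close>
    define f where "f t = poly p (max 0 (min 1 t))" for t
    have cont: "isCont f x" for x unfolding f_def by (intro continuous_intros)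
    have "compact (poly p ` {0..1})" by (intro compact_continuous_image continuous_intros) simp
    then obtain B where B: "\<And>t. t \<in> {0..1} \<Longrightarrow> norm (poly p t) \<le> B"
      by (meson compact_imp_bounded bounded_iff imageI)
    have bd: "norm (f x) \<le> B" for x unfolding f_def by (rule B) auto
    have "(\<integral>t. f t \<partial>\<mu> n) = (\<Sum>k\<le>n. poly p (real k / real n) * bernstein_weight 0 n k)" for n
    proof -
      have "f (real k / real n) = poly p (real k / real n)" if "k \<le> n" for k
      proof -
        have "real k / real n \<le> 1" "0 \<le> real k / real n" using that by (auto simp: divide_le_eq_1)
        then have "max 0 (min 1 (real k / real n)) = real k / real n" by (simp only: min_absorb2 max_absorb2)
        then show ?thesis by (simp only: f_def)
      qed
      then show ?thesis
        by (subst int) (auto intro!: borel_measurable_continuous_onI continuous_at_imp_continuous_on cont)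
    qed
    then have "(\<lambda>n. \<integral>t. f t \<partial>\<mu> (r n)) \<longlonglongrightarrow> L p"
      using LIMSEQ_subseq_LIMSEQ[OF bernstein_limit r] by (simp add: o_def)
    then have "(\<integral>t. f t \<partial>M) = L p" using lim[OF cont bd] LIMSEQ_unique by blast
    moreover have "(\<integral>t. f t \<partial>M) = (\<integral>t. poly p t \<partial>M)"
    proof (rule integral_cong_AE)
      show "AE t in M. f t = poly p t" using AE01 by eventually_elim (auto simp: f_def max_def min_def)
    qed (subst measurable_cong_sets[OF M.events_eq_borel refl],
        intro borel_measurable_continuous_onI continuous_at_imp_continuous_on ballI cont poly_isCont)+
    ultimately show ?thesis by simp
  qed
  then show ?thesis using M AE01 by blast
qed

end

text \<open>Division by \<open>L 1\<close> reduces to the probability case. If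
  \<open>L 1 = 0\<close>, all moments vanish because they decrease with the degree, and the zero
  measure serves.\<close>

theorem hausdorff_moment_problem:
  fixes L :: "real poly \<Rightarrow> real"
  assumes add: "\<And>p q. L (p + q) = L p + L q" and smult: "\<And>c p. L (smult c p) = c * L p"
    and pos: "\<And>k m. L ([:0, 1:] ^ k * [:1, -1:] ^ m) \<ge> 0"
  shows "\<exists>M. finite_measure M \<and> sets M = sets borel \<and> (AE t in M. t \<in> {0..1}) \<and> (\<forall>p. (\<integral>t. poly p t \<partial>M) = L p)"
proof -
  have mono: "L ([:0, 1:] ^ k) \<le> L 1" for k
  proof (induction k)
    case (Suc k)
    have "[:0, 1:] ^ k * [:1, -1:] ^ 1 + [:0, 1:] ^ Suc k = ([:0, 1:] ^ k * ([:1, -1:] + [:0, 1:]) :: real poly)"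
      by (simp only: power_one_right power_Suc2 distrib_left)
    also have "[:1, -1:] + [:0, 1:] = (1 :: real poly)" by (simp add: one_pCons)
    finally have "L ([:0, 1:] ^ k * [:1, -1:] ^ 1) + L ([:0, 1:] ^ Suc k) = L ([:0, 1:] ^ k)"
      by (simp only: add[symmetric] mult_1_right)
    then show ?case using pos[of k 1] Suc by linarith
  qed simp
  have L1: "L 1 \<ge> 0" using pos[of 0 0] by simp
  show ?thesis
  proof (cases "L 1 = 0")
    case True
    have "L ([:0, 1:] ^ k) = 0" for k using mono[of k] pos[of k 0] True by simp
    then have "L p = 0" for p
    proof -
      have "L (\<Sum>i\<le>degree p. smult (coeff p i) ([:0, 1:] ^ i)) = (\<Sum>i\<le>degree p. L (smult (coeff p i) ([:0, 1:] ^ i)))"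
        by (rule L_sum) (simp_all only: add smult pos)
      then show ?thesis
        using \<open>\<And>k. L ([:0, 1:] ^ k) = 0\<close> by (subst poly_eq_sum_powers) (simp add: smult)
    qed
    then show ?thesis
      by (intro exI[of _ "null_measure borel"]) (auto intro!: finite_measureI simp: AE_iff_null null_sets_def)
  next
    case False
    define c where "c = L 1"
    have c: "c > 0" using L1 False by (simp add: c_def)
    define L' where "L' p = L p / c" for p
    have "\<exists>M. real_distribution M \<and> (AE t in M. t \<in> {0..1}) \<and> (\<forall>p. (\<integral>t. poly p t \<partial>M) = L' p)"
      by (rule hausdorff_probability) (use c in \<open>auto simp: L'_def add smult pos add_divide_distrib c_def\<close>)
    then obtain M where M: "real_distribution M" "AE t in M. t \<in> {0..1}" "\<And>p. (\<integral>t. poly p t \<partial>M) = L' p" by blast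
    interpret M: real_distribution M by (rule M)
    let ?M = "density M (\<lambda>_. ennreal c)"
    have "finite_measure ?M"
      by (rule finite_measureI) (simp add: emeasure_density M.emeasure_space_1[simplified] ennreal_mult_eq_top_iff)
    moreover have "AE t in ?M. t \<in> {0..1}" using M(2) by (simp add: AE_density)
    moreover have "(\<integral>t. poly p t \<partial>?M) = L p" for p
    proof -
      have "(\<integral>t. poly p t \<partial>?M) = (\<integral>t. c *\<^sub>R poly p t \<partial>M)"
      proof (intro integral_density)
        show "poly p \<in> borel_measurable M"
          by (subst measurable_cong_sets[OF M.events_eq_borel refl])
             (intro borel_measurable_continuous_onI continuous_intros)
      qed (use c in auto)
      then show ?thesis using M(3)[of p] c by (simp add: L'_def)
    qed
    ultimately show ?thesis by (intro exI[of _ ?M]) simp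
  qed
qed

section \<open>The spectral measure of a bounded selfadjoint operator\<close>

text \<open>This is the square of the usual distance, so the triangle inequality carries factors
  2.\<close>

definition l2_dist :: "real measure \<Rightarrow> (real \<Rightarrow> real) \<Rightarrow> (real \<Rightarrow> real) \<Rightarrow> real" where
  "l2_dist M f g = (\<integral>t. (f t - g t)\<^sup>2 \<partial>M)"

locale unit_measure = finite_measure M for M :: "real measure" +
  assumes sets_borel [simp, measurable_cong]: "sets M = sets borel" and AE_unit: "AE t in M. t \<in> {0..1}"
begin

lemma bounded_integrable:
  fixes f :: "real \<Rightarrow> real"
  assumes [measurable]: "f \<in> borel_measurable borel" and "\<And>t. t \<in> {0..1} \<Longrightarrow> \<bar>f t\<bar> \<le> B"
  shows "integrable M f"
proof (rule integrable_const_bound[of _ B])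
  show "AE t in M. norm (f t) \<le> B" using AE_unit by eventually_elim (use assms(2) in simp)
qed measurable

lemma square_diff_integrable:
  fixes f g :: "real \<Rightarrow> real"
  assumes [measurable]: "f \<in> borel_measurable borel" "g \<in> borel_measurable borel"
    and f: "\<And>t. t \<in> {0..1} \<Longrightarrow> \<bar>f t\<bar> \<le> B1" and g: "\<And>t. t \<in> {0..1} \<Longrightarrow> \<bar>g t\<bar> \<le> B2"
  shows "integrable M (\<lambda>t. (f t - g t)\<^sup>2)"
proof (rule bounded_integrable[of _ "(B1 + B2)\<^sup>2"])
  fix t :: real assume t: "t \<in> {0..1}"
  have "\<bar>f t - g t\<bar>\<^sup>2 \<le> (B1 + B2)\<^sup>2" using f[OF t] g[OF t] by (intro power_mono) auto
  then show "\<bar>(f t - g t)\<^sup>2\<bar> \<le> (B1 + B2)\<^sup>2" by simp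
qed measurable

lemma l2_dist_triangle:
  assumes f: "f \<in> borel_measurable borel" "\<And>t. t \<in> {0..1} \<Longrightarrow> \<bar>f t\<bar> \<le> B1"
    and g: "g \<in> borel_measurable borel" "\<And>t. t \<in> {0..1} \<Longrightarrow> \<bar>g t\<bar> \<le> B2"
    and h: "h \<in> borel_measurable borel" "\<And>t. t \<in> {0..1} \<Longrightarrow> \<bar>h t\<bar> \<le> B3"
  shows "l2_dist M f h \<le> 2 * l2_dist M f g + 2 * l2_dist M g h"
proof -
  note i = square_diff_integrable
  have "l2_dist M f h \<le> (\<integral>t. 2 * (f t - g t)\<^sup>2 + 2 * (g t - h t)\<^sup>2 \<partial>M)"
    unfolding l2_dist_def
  proof (rule integral_mono)
    fix t
    have sq: "(a + b)\<^sup>2 \<le> 2 * a\<^sup>2 + 2 * b\<^sup>2" for a b :: real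
      using sum_squares_bound[of a b] by (simp add: power2_sum)
    have "(f t - h t)\<^sup>2 = ((f t - g t) + (g t - h t))\<^sup>2" by simp
    also have "\<dots> \<le> 2 * (f t - g t)\<^sup>2 + 2 * (g t - h t)\<^sup>2" by (rule sq)
    finally show "(f t - h t)\<^sup>2 \<le> 2 * (f t - g t)\<^sup>2 + 2 * (g t - h t)\<^sup>2" .
  qed (intro i[OF f(1) h(1) f(2) h(2)] i[OF f(1) g(1) f(2) g(2)] i[OF g(1) h(1) g(2) h(2)]
      Bochner_Integration.integrable_add integrable_mult_right; assumption)+
  also have "\<dots> = 2 * l2_dist M f g + 2 * l2_dist M g h"
    unfolding l2_dist_def
    by (subst Bochner_Integration.integral_add)
       (auto intro!: integrable_mult_right i[OF f(1) g(1) f(2) g(2)] i[OF g(1) h(1) g(2) h(2)])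
  finally show ?thesis .
qed

lemma l2_dist_nonneg: "l2_dist M f g \<ge> 0"
  unfolding l2_dist_def by simp

lemma l2_dist_uniform:
  assumes f: "f \<in> borel_measurable borel" and g: "g \<in> borel_measurable borel"
    and d: "\<And>t. t \<in> {0..1} \<Longrightarrow> \<bar>f t - g t\<bar> \<le> d"
  shows "l2_dist M f g \<le> d\<^sup>2 * measure M UNIV"
proof -
  have sp: "space M = UNIV" using sets_eq_imp_space_eq[OF sets_borel] by simp
  have sq: "(f t - g t)\<^sup>2 \<le> d\<^sup>2" if "t \<in> {0..1}" for t
    using power_mono[OF d[OF that] abs_ge_zero, of 2] by simp
  have "l2_dist M f g \<le> (\<integral>t. d\<^sup>2 \<partial>M)"
    unfolding l2_dist_def
  proof (rule integral_mono_AE)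
    show "integrable M (\<lambda>t. (f t - g t)\<^sup>2)"
      using f g sq by (intro bounded_integrable[of _ "d\<^sup>2"]) (auto intro!: borel_measurable_power borel_measurable_diff)
    show "AE t in M. (f t - g t)\<^sup>2 \<le> d\<^sup>2" using AE_unit by eventually_elim (rule sq)
  qed simp
  then show ?thesis by (simp add: sp mult.commute)
qed

lemma l2_dist_dominated:
  assumes f: "\<And>n. f n \<in> borel_measurable borel" "\<And>n t. \<bar>f n t\<bar> \<le> B" and g: "g \<in> borel_measurable borel"
    and lim: "\<And>t. (\<lambda>n. f n t) \<longlonglongrightarrow> g t"
  shows "(\<lambda>n. l2_dist M (f n) g) \<longlonglongrightarrow> 0"
proof -
  note [measurable] = f(1) g
  have gB: "\<bar>g t\<bar> \<le> B" for t
    by (rule LIMSEQ_le_const2[OF tendsto_rabs[OF lim]]) (use f(2) in blast)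
  have "(\<lambda>n. \<integral>t. (f n t - g t)\<^sup>2 \<partial>M) \<longlonglongrightarrow> (\<integral>t. 0 \<partial>M)"
  proof (rule integral_dominated_convergence[where w = "\<lambda>_. (2 * B)\<^sup>2"])
    show "AE t in M. (\<lambda>n. (f n t - g t)\<^sup>2) \<longlonglongrightarrow> 0"
    proof (rule AE_I2)
      fix t
      have "(\<lambda>n. (f n t - g t)\<^sup>2) \<longlonglongrightarrow> (g t - g t)\<^sup>2" by (intro tendsto_intros lim)
      then show "(\<lambda>n. (f n t - g t)\<^sup>2) \<longlonglongrightarrow> 0" by simp
    qed
    show "AE t in M. norm ((f n t - g t)\<^sup>2) \<le> (2 * B)\<^sup>2" for n
    proof (rule AE_I2)
      fix t
      have "\<bar>f n t - g t\<bar> \<le> 2 * B" using f(2)[of n t] gB[of t] by linarith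
      then have "\<bar>f n t - g t\<bar>\<^sup>2 \<le> (2 * B)\<^sup>2" by (intro power_mono) auto
      then show "norm ((f n t - g t)\<^sup>2) \<le> (2 * B)\<^sup>2" by simp
    qed
  qed simp_all
  then show ?thesis by (simp add: l2_dist_def)
qed

end

lemma poly_bounded_unit:
  obtains B where "\<And>t. t \<in> {0..1} \<Longrightarrow> \<bar>poly (p :: real poly) t\<bar> \<le> B"
proof -
  have "compact (poly p ` {0..1})" by (intro compact_continuous_image continuous_intros) simp
  then obtain B where "\<And>t. t \<in> {0..1} \<Longrightarrow> norm (poly p t) \<le> B"
    by (meson compact_imp_bounded bounded_iff imageI)
  then show ?thesis using that[of B] by simp
qed

lemma poly_borel [measurable]: "poly (p :: real poly) \<in> borel_measurable borel"
  by (intro borel_measurable_continuous_onI continuous_intros)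

lemma indicator_le_1: "\<bar>indicator S t :: real\<bar> \<le> 1"
  by (simp add: indicator_def)

lemma (in unit_measure) l2_dist_poly_union:
  assumes S: "S \<in> sets borel" and R: "R \<in> sets borel" and disj: "S \<inter> R = {}"
  shows "l2_dist M (poly (p + q)) (indicator (S \<union> R))
    \<le> 2 * l2_dist M (poly p) (indicator S) + 2 * l2_dist M (poly q) (indicator R)"
proof -
  obtain b c where b: "\<And>t. t \<in> {0..1} \<Longrightarrow> \<bar>poly p t\<bar> \<le> b" and c: "\<And>t. t \<in> {0..1} \<Longrightarrow> \<bar>poly q t\<bar> \<le> c"
    using poly_bounded_unit by metis
  have bc: "\<bar>poly (p + q) t\<bar> \<le> b + c" if "t \<in> {0..1}" for t using b[OF that] c[OF that] by simp
  have ic: "\<bar>indicator S t + poly q t\<bar> \<le> 1 + c" if "t \<in> {0..1}" for t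
    using c[OF that] indicator_le_1[of S t] by linarith
  have "l2_dist M (poly (p + q)) (indicator (S \<union> R)) \<le> 2 * l2_dist M (poly (p + q)) (\<lambda>t. indicator S t + poly q t)
      + 2 * l2_dist M (\<lambda>t. indicator S t + poly q t) (indicator (S \<union> R))"
    using S R by (intro l2_dist_triangle[OF poly_borel bc _ ic _ indicator_le_1])
      (auto intro!: borel_measurable_add borel_measurable_indicator)
  also have "l2_dist M (poly (p + q)) (\<lambda>t. indicator S t + poly q t) = l2_dist M (poly p) (indicator S)"
    unfolding l2_dist_def by (simp add: algebra_simps)
  also have "l2_dist M (\<lambda>t. indicator S t + poly q t) (indicator (S \<union> R)) = l2_dist M (poly q) (indicator R)"
    unfolding l2_dist_def using disj by (intro Bochner_Integration.integral_cong refl) (auto simp: indicator_def)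
  finally show ?thesis .
qed

lemma continuous_poly_approx:
  assumes "continuous_on {0..1} f" "e > 0"
  obtains p :: "real poly" where "\<And>t. t \<in> {0..1} \<Longrightarrow> \<bar>poly p t - f t\<bar> \<le> e"
proof -
  obtain N where N: "\<And>n x. N \<le> n \<Longrightarrow> x \<in> {0..1} \<Longrightarrow> \<bar>f x - (\<Sum>k\<le>n. f (real k / real n) * Bernstein n k x)\<bar> < e"
    using Bernstein_Weierstrass[OF assms] by blast
  define p where "p = (\<Sum>k\<le>N. smult (f (real k / real N) * of_nat (N choose k)) ([:0, 1:] ^ k * [:1, -1:] ^ (N - k)))"
  have "poly p t = (\<Sum>k\<le>N. f (real k / real N) * Bernstein N k t)" for t
    by (simp add: p_def poly_sum Bernstein_def mult_ac)
  then have "\<bar>poly p t - f t\<bar> \<le> e" if "t \<in> {0..1}" for t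
    using N[OF order_refl that] by (simp add: abs_minus_commute less_imp_le)
  then show ?thesis using that by blast
qed

text \<open>One polynomial has to serve finitely many measures, since additivity and symmetry of the
  projections compare several vectors. The approximable sets include the rays and are closed under
  complements and countable disjoint unions, so they are all the Borel sets.\<close>

lemma poly_dense_l2:
  fixes \<M> :: "real measure set"
  assumes fin: "finite \<M>" and M: "\<And>M. M \<in> \<M> \<Longrightarrow> unit_measure M"
    and S: "S \<in> sets borel" and e: "e > 0"
  shows "\<exists>p. \<forall>M\<in>\<M>. l2_dist M (poly p) (indicator S) < e"
proof -
  define good where "good S \<longleftrightarrow> (\<forall>e>0. \<exists>p. \<forall>M\<in>\<M>. l2_dist M (poly p) (indicator S) < e)" for S
  \<comment> \<open>Dominated convergence holds for each of the finitely many measures, so a common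
    index n exists.\<close>
  have approx: "good S"
    if S: "S \<in> sets borel"
      and f: "\<And>n. f n \<in> borel_measurable borel" "\<And>n t. \<bar>f n t\<bar> \<le> (B::real)" "\<And>t. (\<lambda>n. f n t) \<longlonglongrightarrow> indicator S t"
      and g: "\<And>n e. e > 0 \<Longrightarrow> \<exists>p. \<forall>M\<in>\<M>. l2_dist M (poly p) (f n) < e" for S f B
    unfolding good_def
  proof (intro allI impI)
    fix e :: real assume e: "e > 0"
    have "\<forall>M\<in>\<M>. \<forall>\<^sub>F n in sequentially. l2_dist M (f n) (indicator S) < e / 4"
    proof
      fix M assume "M \<in> \<M>"
      then interpret unit_measure M by (rule M)
      have "(\<lambda>n. l2_dist M (f n) (indicator S)) \<longlonglongrightarrow> 0"
        using f S by (intro l2_dist_dominated[where B = B]) auto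
      then show "\<forall>\<^sub>F n in sequentially. l2_dist M (f n) (indicator S) < e / 4"
        by (rule order_tendstoD(2)) (use e in simp)
    qed
    then have "\<forall>\<^sub>F n in sequentially. \<forall>M\<in>\<M>. l2_dist M (f n) (indicator S) < e / 4"
      by (rule eventually_ball_finite[OF fin])
    then have "\<exists>n. \<forall>M\<in>\<M>. l2_dist M (f n) (indicator S) < e / 4"
      by (rule eventually_happens'[OF sequentially_bot])
    then obtain n where n: "\<And>M. M \<in> \<M> \<Longrightarrow> l2_dist M (f n) (indicator S) < e / 4" by blast
    obtain p where p: "\<And>M. M \<in> \<M> \<Longrightarrow> l2_dist M (poly p) (f n) < e / 4"
      using g[of "e / 4" n] e by auto
    have "l2_dist M (poly p) (indicator S) < e" if MM: "M \<in> \<M>" for M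
    proof -
      interpret unit_measure M by (rule M[OF MM])
      obtain b where b: "\<And>t. t \<in> {0..1} \<Longrightarrow> \<bar>poly p t\<bar> \<le> b" using poly_bounded_unit by blast
      have "l2_dist M (poly p) (indicator S) \<le> 2 * l2_dist M (poly p) (f n) + 2 * l2_dist M (f n) (indicator S)"
        by (rule l2_dist_triangle[OF poly_borel b f(1) f(2) _ indicator_le_1]) (use S in auto)
      then show ?thesis using p[OF MM] n[OF MM] by linarith
    qed
    then show "\<exists>p. \<forall>M\<in>\<M>. l2_dist M (poly p) (indicator S) < e" by blast
  qed
  \<comment> \<open>The indicator of a ray is the pointwise limit of continuous ramps, which
    polynomials approximate uniformly on the unit interval.\<close>
  have gt: "good {a<..}" for a
  proof (rule approx[where B = 1 and f = "\<lambda>n t. min 1 (max 0 (real n * (t - a)))"])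
    show "(\<lambda>n. min 1 (max 0 (real n * (t - a)))) \<longlonglongrightarrow> indicator {a<..} t" for t
    proof (cases "t > a")
      case True
      obtain N :: nat where N: "1 / (t - a) < real N" using reals_Archimedean2 by blast
      have "min 1 (max 0 (real n * (t - a))) = 1" if "n \<ge> N" for n
      proof -
        have "1 / (t - a) < real n" using N that by linarith
        then have "1 < real n * (t - a)" using True by (simp add: field_simps)
        then show ?thesis by simp
      qed
      then have "\<forall>\<^sub>F n in sequentially. min 1 (max 0 (real n * (t - a))) = 1"
        by (rule eventually_sequentiallyI)
      then show ?thesis using True by (simp add: tendsto_eventually)
    next
      case False
      have "max 0 (real n * (t - a)) = 0" for n
        using mult_nonneg_nonpos[of "real n" "t - a"] False by (intro max_absorb1) simp
      then show ?thesis using False by simp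
    qed
    show "\<exists>p. \<forall>M\<in>\<M>. l2_dist M (poly p) (\<lambda>t. min 1 (max 0 (real n * (t - a)))) < e" if e: "e > 0" for n e
    proof -
      \<comment> \<open>A common strict bound for the total masses, positive even for an empty
        family.\<close>
      define m where "m = 1 + (\<Sum>M\<in>\<M>. measure M UNIV)"
      have m: "m > 0" "\<And>M. M \<in> \<M> \<Longrightarrow> measure M UNIV < m"
        unfolding m_def using member_le_sum[OF _ _ fin, of _ "\<lambda>M. measure M UNIV"] sum_nonneg[of \<M> "\<lambda>M. measure M UNIV"]
        by (auto simp: add_pos_nonneg) (smt (verit) measure_nonneg)
      define d where "d = sqrt (e / m)"
      have d: "d > 0" "d\<^sup>2 * m = e" using e m by (auto simp: d_def)
      obtain p :: "real poly" where p: "\<And>t. t \<in> {0..1} \<Longrightarrow> \<bar>poly p t - min 1 (max 0 (real n * (t - a)))\<bar> \<le> d"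
        by (rule continuous_poly_approx[of "\<lambda>t. min 1 (max 0 (real n * (t - a)))" d]) (use d in \<open>auto intro!: continuous_intros\<close>)
      have "l2_dist M (poly p) (\<lambda>t. min 1 (max 0 (real n * (t - a)))) < e" if MM: "M \<in> \<M>" for M
      proof -
        interpret unit_measure M by (rule M[OF MM])
        have "l2_dist M (poly p) (\<lambda>t. min 1 (max 0 (real n * (t - a)))) \<le> d\<^sup>2 * measure M UNIV"
          by (rule l2_dist_uniform[OF poly_borel _ p]) measurable
        also have "\<dots> < d\<^sup>2 * m" using d(1) m(2)[OF MM] by (intro mult_strict_left_mono) auto
        finally show ?thesis using d by simp
      qed
      then show ?thesis by blast
    qed
  qed auto
  have compl: "good (UNIV - S)" if "good S" for S
    unfolding good_def
  proof (intro allI impI)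
    fix e :: real assume "e > 0"
    then obtain p where p: "\<forall>M\<in>\<M>. l2_dist M (poly p) (indicator S) < e" using \<open>good S\<close> unfolding good_def by blast
    have eq: "l2_dist M (poly (1 - p)) (indicator (UNIV - S)) = l2_dist M (poly p) (indicator S)" for M
      unfolding l2_dist_def by (intro Bochner_Integration.integral_cong refl) (auto simp: indicator_def power2_commute)
    then show "\<exists>p. \<forall>M\<in>\<M>. l2_dist M (poly p) (indicator (UNIV - S)) < e"
      by (intro exI[of _ "1 - p"]) (unfold eq, rule p)
  qed
  have empty: "good {}"
    unfolding good_def by (intro allI impI exI[of _ 0]) (simp add: l2_dist_def)
  have good_union: "good (S \<union> T)" if S: "good S" "S \<in> sets borel" and T: "good T" "T \<in> sets borel" and disj: "S \<inter> T = {}" for S T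
    unfolding good_def
  proof (intro allI impI)
    fix e :: real assume e: "e > 0"
    obtain p q where p: "\<And>M. M \<in> \<M> \<Longrightarrow> l2_dist M (poly p) (indicator S) < e / 4"
      and q: "\<And>M. M \<in> \<M> \<Longrightarrow> l2_dist M (poly q) (indicator T) < e / 4"
      using S(1) T(1) e unfolding good_def by (meson divide_pos_pos zero_less_numeral)
    have "l2_dist M (poly (p + q)) (indicator (S \<union> T)) < e" if MM: "M \<in> \<M>" for M
      using unit_measure.l2_dist_poly_union[OF M[OF MM] S(2) T(2) disj, of p q] p[OF MM] q[OF MM] by linarith
    then show "\<exists>p. \<forall>M\<in>\<M>. l2_dist M (poly p) (indicator (S \<union> T)) < e" by blast
  qed
  have "sets (borel :: real measure) = sigma_sets UNIV (range (\<lambda>a. {a<..}))"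
    by (subst borel_Ioi) (rule sets_measure_of, simp)
  then have 3: "S \<in> sigma_sets UNIV (range (\<lambda>a. {a<..}))" using S by simp
  have 1: "Int_stable (range (\<lambda>a::real. {a<..}))"
  proof -
    have "{a<..} \<inter> {b<..} = {max a b<..}" for a b :: real by auto
    then show ?thesis by (auto simp: Int_stable_def)
  qed
  have 2: "range (\<lambda>a::real. {a<..}) \<subseteq> Pow UNIV" by simp
  from 1 2 3 have "good S \<and> S \<in> sets borel"
  proof (induction S rule: sigma_sets_induct_disjoint)
    case (union F)
    then have F: "range F \<subseteq> sets borel" by auto
    have goodU: "good (\<Union>k<n. F k)" for n
    proof (induction n)
      case (Suc n)
      have "F k \<inter> F n = {}" if "k < n" for k
        using union(1) that by (simp add: disjoint_family_on_def)
      then have "(\<Union>k<n. F k) \<inter> F n = {}" by auto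
      then have "good ((\<Union>k<n. F k) \<union> F n)" using Suc union(3) by (intro good_union) auto
      then show ?case by (simp add: lessThan_Suc Un_commute)
    qed (simp add: empty)
    have "good (\<Union>(range F))"
    proof (rule approx[where B = 1 and f = "\<lambda>n. indicator (\<Union>k<n. F k)"])
      show "(\<lambda>n. indicator (\<Union>k<n. F k) t :: real) \<longlonglongrightarrow> indicator (\<Union>(range F)) t" for t
      proof (cases "t \<in> \<Union>(range F)")
        case True
        then obtain k where k: "t \<in> F k" by blast
        have "\<forall>\<^sub>F n in sequentially. indicator (\<Union>k<n. F k) t = (1::real)"
          by (rule eventually_sequentiallyI[of "Suc k"]) (use k in \<open>auto simp: indicator_def\<close>)
        then show ?thesis using True by (simp add: tendsto_eventually)
      qed (auto simp: indicator_def)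
      show "\<exists>p. \<forall>M\<in>\<M>. l2_dist M (poly p) (indicator (\<Union>k<n. F k)) < e" if "e > 0" for n e
        using goodU that unfolding good_def by blast
    qed (use F indicator_le_1 in auto)
    then show ?case using F by auto
  qed (use gt compl empty in auto)
  then show ?thesis using e unfolding good_def by blast
qed


section \<open>Polynomial calculus and spectral projections for an operator between 0 and I\<close>

definition operator_poly :: "('a::complex_hilbert \<Rightarrow> 'a) \<Rightarrow> real poly \<Rightarrow> 'a \<Rightarrow> 'a" where
  "operator_poly T p = fold_coeffs (\<lambda>a f x. a *\<^sub>R x + T (f x)) p (\<lambda>x. 0)"

locale effect_operator =
  fixes T :: "'a::complex_hilbert \<Rightarrow> 'a"
  assumes selfadjoint_T: "selfadjoint T"
    and T_nonneg: "0 \<le> Re (cinner (T x) x)" and T_le: "Re (cinner (T x) x) \<le> (norm x)\<^sup>2"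
begin

lemmas T_clinear = selfadjointD(1)[OF selfadjoint_T] and T_sym = selfadjointD(2)[OF selfadjoint_T]

abbreviation "op_p \<equiv> operator_poly T"

lemma op_0 [simp]: "op_p 0 x = 0"
  by (simp add: operator_poly_def)

lemma op_pCons [simp]: "op_p (pCons a p) x = a *\<^sub>R x + T (op_p p x)"
  by (cases "p = 0 \<and> a = 0") (auto simp: operator_poly_def bounded_clinear_zero[OF T_clinear])

lemma op_1 [simp]: "op_p 1 x = x"
  by (simp add: one_pCons bounded_clinear_zero[OF T_clinear])

lemma op_clinear: "bounded_clinear (op_p p)"
proof (induction p)
  case (pCons a p)
  have "bounded_clinear (\<lambda>x. a *\<^sub>R x + T (op_p p x))"
    by (intro bounded_clinear_add_op bounded_clinear_scaleR_op bounded_clinear_compose[OF T_clinear pCons.IH]) simp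
  then show ?case by simp
qed (simp add: operator_poly_def)

lemma op_add: "op_p (p + q) x = op_p p x + op_p q x"
  by (induction p q rule: poly_induct2) (simp_all add: bounded_clinear_add[OF T_clinear] scaleR_add_left)

lemma op_smult: "op_p (smult c p) x = c *\<^sub>R op_p p x"
  by (induction p) (simp_all add: bounded_clinear_scaleR[OF T_clinear] scaleR_add_right)

lemma op_diff: "op_p (p - q) x = op_p p x - op_p q x"
proof -
  have "p - q = p + smult (-1) q" by simp
  then show ?thesis by (simp only: op_add op_smult) simp
qed

lemma op_mult: "op_p (p * q) x = op_p p (op_p q x)"
  by (induction p) (simp_all add: op_add op_smult)

lemma op_T: "op_p p (T x) = T (op_p p x)"
  by (induction p) (simp_all add: bounded_clinear_add[OF T_clinear] bounded_clinear_scaleR[OF T_clinear]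
      bounded_clinear_zero[OF T_clinear])

lemma op_sym: "cinner (op_p p x) y = cinner x (op_p p y)"
  by (induction p arbitrary: x y) (simp_all add: cinner_add_left cinner_add_right cinner_scaleR_left cinner_scaleR_right T_sym op_T)

lemma op_square: "Re (cinner (op_p (p * p) x) x) = (norm (op_p p x))\<^sup>2"
  by (simp add: op_mult op_sym norm_sq_eq_cinner)

text \<open>The even powers form a square, one factor of which moves to the other argument by
  symmetry. The remaining polynomial \<open>r\<close> has exponents 0 or 1 only.\<close>

lemma op_bernstein_nonneg: "0 \<le> Re (cinner (op_p ([:0, 1:] ^ k * [:1, -1:] ^ m) x) x)"
proof -
  define r :: "real poly" where "r = [:0, 1:] ^ (k mod 2) * [:1, -1:] ^ (m mod 2)"
  define q :: "real poly" where "q = [:0, 1:] ^ (k div 2) * [:1, -1:] ^ (m div 2)"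
  have e: "[:0, 1:] ^ k * [:1, -1:] ^ m = q * (r * q)"
  proof -
    have "k = k div 2 + k div 2 + k mod 2" "m = m div 2 + m div 2 + m mod 2" by presburger+
    then have "[:0, 1:] ^ k * [:1, -1:] ^ m
        = ([:0, 1:] ^ (k div 2 + k div 2 + k mod 2) * [:1, -1:] ^ (m div 2 + m div 2 + m mod 2) :: real poly)" by metis
    then show ?thesis unfolding power_add q_def r_def by (simp only: mult_ac)
  qed
  define y where "y = op_p q x"
  have "cinner (op_p ([:0, 1:] ^ k * [:1, -1:] ^ m) x) x = cinner (op_p r y) y"
    unfolding e op_mult y_def by (rule op_sym)
  moreover have "0 \<le> Re (cinner (op_p r y) y)"
  proof -
    have t: "op_p [:0, 1:] z = T z" "op_p [:1, -1:] z = z - T z" for z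
      by (simp_all add: bounded_clinear_zero[OF T_clinear] bounded_clinear_minus[OF T_clinear])
    have le: "0 \<le> Re (cinner (z - T z) z)" for z
      using T_le[of z] by (simp add: cinner_diff_left norm_sq_eq_cinner)
    have "0 \<le> Re (cinner (T (y - T y)) y)"
    proof -
      \<comment> \<open>Operator form of x (1 - x) = x^2 (1 - x) + x (1 - x)^2, where each summand
        is a square times 1 - x or x.\<close>
      have "cinner (T (y - T y)) y = cinner (T y - T (T y)) (T y) + cinner (T (y - T y)) (y - T y)"
        by (simp add: bounded_clinear_diff[OF T_clinear] cinner_diff_left cinner_diff_right T_sym)
      then show ?thesis using le[of "T y"] T_nonneg[of "y - T y"] by simp
    qed
    moreover have "k mod 2 = 0 \<or> k mod 2 = 1" "m mod 2 = 0 \<or> m mod 2 = 1" by auto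
    ultimately show ?thesis
      using le[of y] T_nonneg[of y]
      by (elim disjE) (simp_all only: r_def op_mult t op_1 power_0 power_one_right cinner_self mult_1_left mult_1_right
          Re_complex_of_real zero_le_power2)
  qed
  ultimately show ?thesis by simp
qed

lemma moment_measure_exists:
  "\<exists>M. unit_measure M \<and> (\<forall>p. (\<integral>t. poly p t \<partial>M) = Re (cinner (op_p p x) x))"
proof -
  have "\<exists>M. finite_measure M \<and> sets M = sets borel \<and> (AE t in M. t \<in> {0..1}) \<and>
      (\<forall>p. (\<integral>t. poly p t \<partial>M) = Re (cinner (op_p p x) x))"
    by (rule hausdorff_moment_problem) (auto simp: op_add op_smult cinner_add_left cinner_scaleR_left op_bernstein_nonneg)
  then show ?thesis by (auto simp: unit_measure_def unit_measure_axioms_def)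
qed

definition mu :: "'a \<Rightarrow> real measure" where
  "mu x = (SOME M. unit_measure M \<and> (\<forall>p. (\<integral>t. poly p t \<partial>M) = Re (cinner (op_p p x) x)))"

lemma mu: "unit_measure (mu x)" "(\<integral>t. poly p t \<partial>mu x) = Re (cinner (op_p p x) x)"
  using someI_ex[OF moment_measure_exists[of x]] unfolding mu_def by blast+

lemma norm_op: "(norm (op_p p x - op_p q x))\<^sup>2 = l2_dist (mu x) (poly p) (poly q)"
  using mu(2)[of x "(p - q) * (p - q)"] by (simp add: op_square op_diff l2_dist_def power2_eq_square)

definition approximates :: "(nat \<Rightarrow> real poly) \<Rightarrow> real set \<Rightarrow> 'a \<Rightarrow> bool" where
  "approximates p S x \<longleftrightarrow> (\<lambda>n. l2_dist (mu x) (poly (p n)) (indicator S)) \<longlonglongrightarrow> 0"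

lemma approximates_exists:
  assumes X: "finite X" and S: "S \<in> sets borel"
  shows "\<exists>p. \<forall>x\<in>X. approximates p S x"
proof -
  have "\<exists>p. \<forall>M\<in>mu ` X. l2_dist M (poly p) (indicator S) < 1 / real (Suc n)" for n
    by (rule poly_dense_l2) (use X S mu(1) in auto)
  then obtain p where p: "\<And>n x. x \<in> X \<Longrightarrow> l2_dist (mu x) (poly (p n)) (indicator S) < 1 / real (Suc n)"
    by (metis imageI)
  have "approximates p S x" if "x \<in> X" for x
    unfolding approximates_def
  proof (rule Lim_null_comparison)
    show "(\<lambda>n. 1 / real (Suc n)) \<longlonglongrightarrow> 0" using LIMSEQ_Suc[OF lim_inverse_n'] by simp
    show "\<forall>\<^sub>F n in sequentially. norm (l2_dist (mu x) (poly (p n)) (indicator S)) \<le> 1 / real (Suc n)"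
      using p[OF that] unit_measure.l2_dist_nonneg[OF mu(1)] by (auto intro!: always_eventually less_imp_le)
  qed
  then show ?thesis by blast
qed

lemma approximates_bound:
  assumes S: "S \<in> sets borel"
  shows "(norm (op_p p x - op_p q x))\<^sup>2
    \<le> 2 * l2_dist (mu x) (poly p) (indicator S) + 2 * l2_dist (mu x) (poly q) (indicator S)"
proof -
  interpret unit_measure "mu x" by (rule mu)
  obtain b c where "\<And>t. t \<in> {0..1} \<Longrightarrow> \<bar>poly p t\<bar> \<le> b" "\<And>t. t \<in> {0..1} \<Longrightarrow> \<bar>poly q t\<bar> \<le> c"
    using poly_bounded_unit by metis
  then have "l2_dist (mu x) (poly p) (poly q) \<le> 2 * l2_dist (mu x) (poly p) (indicator S) + 2 * l2_dist (mu x) (indicator S) (poly q)"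
    by (intro l2_dist_triangle[OF poly_borel _ _ indicator_le_1 poly_borel]) (use S in auto)
  moreover have "l2_dist (mu x) (indicator S) (poly q) = l2_dist (mu x) (poly q) (indicator S)"
    unfolding l2_dist_def by (simp add: power2_commute)
  ultimately show ?thesis by (simp add: norm_op)
qed

text \<open>By \<open>norm_op\<close>, \<open>p \<mapsto> p(T) x\<close> is isometric from \<open>L\<^sup>2(mu x)\<close>, so polynomials tending to an
  indicator function define the spectral projection at \<open>x\<close>, whichever are chosen.\<close>

definition pvm :: "real set \<Rightarrow> 'a \<Rightarrow> 'a" where
  "pvm S x = lim (\<lambda>n. op_p ((SOME p. approximates p S x) n) x)"

lemma pvm_tendsto:
  assumes S: "S \<in> sets borel" and p: "approximates p S x"
  shows "(\<lambda>n. op_p (p n) x) \<longlonglongrightarrow> pvm S x"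
proof -
  define q where "q = (SOME p. approximates p S x)"
  have q: "approximates q S x"
    unfolding q_def by (rule someI[of _ p]) (rule p)
  have "Cauchy (\<lambda>n. op_p (q n) x)"
  proof (rule metric_CauchyI)
    fix e :: real assume e: "e > 0"
    have "\<forall>\<^sub>F n in sequentially. l2_dist (mu x) (poly (q n)) (indicator S) < e\<^sup>2 / 4"
      by (rule order_tendstoD(2)[OF q[unfolded approximates_def]]) (use e in simp)
    then obtain N where N: "\<And>n. n \<ge> N \<Longrightarrow> l2_dist (mu x) (poly (q n)) (indicator S) < e\<^sup>2 / 4"
      unfolding eventually_sequentially by blast
    show "\<exists>M. \<forall>m\<ge>M. \<forall>n\<ge>M. dist (op_p (q m) x) (op_p (q n) x) < e"
    proof (intro exI[of _ N] allI impI)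
      fix m n assume "m \<ge> N" "n \<ge> N"
      then have "(norm (op_p (q m) x - op_p (q n) x))\<^sup>2 < e\<^sup>2"
        using approximates_bound[OF S, of "q m" x "q n"] N[of m] N[of n] by linarith
      then show "dist (op_p (q m) x) (op_p (q n) x) < e" using e by (simp add: dist_norm power2_less_imp_less)
    qed
  qed
  then have lim: "(\<lambda>n. op_p (q n) x) \<longlonglongrightarrow> pvm S x"
    unfolding pvm_def q_def[symmetric] by (simp add: Cauchy_convergent_iff convergent_LIMSEQ_iff)
  have "(\<lambda>n. (norm (op_p (p n) x - op_p (q n) x))\<^sup>2) \<longlonglongrightarrow> 0"
  proof (rule Lim_null_comparison)
    show "\<forall>\<^sub>F n in sequentially. norm ((norm (op_p (p n) x - op_p (q n) x))\<^sup>2)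
        \<le> 2 * l2_dist (mu x) (poly (p n)) (indicator S) + 2 * l2_dist (mu x) (poly (q n)) (indicator S)"
      using approximates_bound[OF S] by (auto intro: always_eventually)
    have "(\<lambda>n. 2 * l2_dist (mu x) (poly (p n)) (indicator S) + 2 * l2_dist (mu x) (poly (q n)) (indicator S)) \<longlonglongrightarrow> 2 * 0 + 2 * 0"
      using p q unfolding approximates_def by (intro tendsto_intros)
    then show "(\<lambda>n. 2 * l2_dist (mu x) (poly (p n)) (indicator S) + 2 * l2_dist (mu x) (poly (q n)) (indicator S)) \<longlonglongrightarrow> 0" by simp
  qed
  then have "(\<lambda>n. sqrt ((norm (op_p (p n) x - op_p (q n) x))\<^sup>2)) \<longlonglongrightarrow> sqrt 0" by (rule tendsto_real_sqrt)
  then have "(\<lambda>n. op_p (p n) x - op_p (q n) x) \<longlonglongrightarrow> 0" by (simp add: tendsto_norm_zero_iff)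
  from tendsto_add[OF this lim] show ?thesis by simp
qed

text \<open>A single polynomial sequence approximates the indicator in the measures of x, y and
  \<open>x + y\<close>, so additivity of each \<open>op_p\<close> passes to the limit. Homogeneity
  and symmetry follow the same pattern.\<close>

lemma pvm_add:
  assumes S: "S \<in> sets borel" shows "pvm S (x + y) = pvm S x + pvm S y"
proof -
  obtain p where p: "\<forall>z\<in>{x, y, x + y}. approximates p S z" using approximates_exists[of "{x, y, x + y}"] S by blast
  have "(\<lambda>n. op_p (p n) (x + y)) \<longlonglongrightarrow> pvm S x + pvm S y"
    unfolding bounded_clinear_add[OF op_clinear] using p by (intro tendsto_intros pvm_tendsto[OF S]) auto
  then show ?thesis using pvm_tendsto[OF S, of p "x + y"] p LIMSEQ_unique by blast
qed

lemma pvm_scaleC: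
  assumes S: "S \<in> sets borel" shows "pvm S (c *\<^sub>C x) = c *\<^sub>C pvm S x"
proof -
  obtain p where p: "\<forall>z\<in>{x, c *\<^sub>C x}. approximates p S z" using approximates_exists[of "{x, c *\<^sub>C x}"] S by blast
  have "(\<lambda>n. op_p (p n) (c *\<^sub>C x)) \<longlonglongrightarrow> c *\<^sub>C pvm S x"
    unfolding bounded_clinear_scaleC[OF op_clinear] using p by (intro tendsto_scaleC tendsto_const pvm_tendsto[OF S]) auto
  then show ?thesis using pvm_tendsto[OF S, of p "c *\<^sub>C x"] p LIMSEQ_unique by blast
qed

lemma pvm_sym:
  assumes S: "S \<in> sets borel" shows "cinner (pvm S x) y = cinner x (pvm S y)"
proof -
  obtain p where p: "\<forall>z\<in>{x, y}. approximates p S z" using approximates_exists[of "{x, y}"] S by blast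
  have "(\<lambda>n. cinner (op_p (p n) x) y) \<longlonglongrightarrow> cinner (pvm S x) y"
    using p by (intro tendsto_cinner tendsto_const pvm_tendsto[OF S]) auto
  moreover have "(\<lambda>n. cinner (op_p (p n) x) y) \<longlonglongrightarrow> cinner x (pvm S y)"
    unfolding op_sym using p by (intro tendsto_cinner tendsto_const pvm_tendsto[OF S]) auto
  ultimately show ?thesis by (rule LIMSEQ_unique)
qed

text \<open>Both values are the integral of the indicator: mean square convergence implies
  convergence in the mean for the approximating polynomials and, as an indicator is its own square,
  for their squares.\<close>

lemma pvm_form:
  assumes S: "S \<in> sets borel"
  shows "Re (cinner (pvm S x) x) = measure (mu x) S" "(norm (pvm S x))\<^sup>2 = measure (mu x) S"
proof -
  interpret unit_measure "mu x" by (rule mu)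
  obtain p where p: "approximates p S x" using approximates_exists[of "{x}"] S by blast
  let ?d = "\<lambda>n. l2_dist (mu x) (poly (p n)) (indicator S)"
  have d: "?d \<longlonglongrightarrow> 0" using p by (simp add: approximates_def)
  have pi: "integrable (mu x) (\<lambda>t. poly q t)" for q
    using poly_bounded_unit[of q] bounded_integrable[of "poly q"] by (metis poly_borel)
  have ii: "integrable (mu x) (\<lambda>t. indicator S t :: real)" using S by (intro bounded_integrable[of _ 1]) auto
  have iS: "(\<integral>t. indicator S t \<partial>mu x) = measure (mu x) S" using S by simp
  have sp: "space (mu x) = UNIV" using sets_eq_imp_space_eq[OF sets_borel] by simp
  have i2: "integrable (mu x) (\<lambda>t. (poly q t - indicator S t)\<^sup>2)" for q
  proof -
    obtain b where b: "\<And>t. t \<in> {0..1} \<Longrightarrow> \<bar>poly q t\<bar> \<le> b" using poly_bounded_unit by blast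
    show ?thesis by (rule square_diff_integrable[OF poly_borel _ b indicator_le_1]) (use S in simp_all)
  qed
  have ia: "integrable (mu x) (\<lambda>t. \<bar>poly q t - indicator S t\<bar>)" for q
    by (intro integrable_abs Bochner_Integration.integrable_diff pi ii)
  define a where "a n = (\<integral>t. \<bar>poly (p n) t - indicator S t\<bar> \<partial>mu x)" for n
  have a0: "a n \<ge> 0" for n unfolding a_def by simp
  have a: "a \<longlonglongrightarrow> 0"
  proof (rule LIMSEQ_I)
    fix e :: real assume e: "e > 0"
    define m where "m = measure (mu x) UNIV + 1"
    have m: "m > 0" "measure (mu x) UNIV < m" unfolding m_def using measure_nonneg[of "mu x" UNIV] by linarith+
    define \<delta> where "\<delta> = e / (2 * m)"
    have dl: "\<delta> > 0" "\<delta> * m = e / 2" using e m by (auto simp: \<delta>_def)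
    have le: "a n \<le> \<delta> * measure (mu x) UNIV + ?d n / \<delta>" for n
    proof -
      have "a n \<le> (\<integral>t. \<delta> + (poly (p n) t - indicator S t)\<^sup>2 / \<delta> \<partial>mu x)"
        unfolding a_def
      proof (rule integral_mono[OF ia])
        fix t
        \<comment> \<open>This elementary inequality bounds the mean by the mean square:
          \<open>\<delta>\<close> is small against the total mass, and then n is taken
          large.\<close>
        have am: "\<bar>z\<bar> \<le> \<delta> + z\<^sup>2 / \<delta>" for z :: real
        proof (cases "\<bar>z\<bar> \<le> \<delta>")
          case False
          then have "\<delta> * \<bar>z\<bar> \<le> \<bar>z\<bar> * \<bar>z\<bar>" by (intro mult_right_mono) auto
          then have "\<bar>z\<bar> \<le> z\<^sup>2 / \<delta>" using dl by (simp add: field_simps power2_eq_square)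
          then show ?thesis using dl by simp
        qed (use dl in \<open>simp add: add_increasing2\<close>)
        then show "\<bar>poly (p n) t - indicator S t\<bar> \<le> \<delta> + (poly (p n) t - indicator S t)\<^sup>2 / \<delta>" .
      qed (intro Bochner_Integration.integrable_add integrable_divide i2, simp)
      also have "\<dots> = \<delta> * measure (mu x) UNIV + ?d n / \<delta>"
        by (subst Bochner_Integration.integral_add) (auto intro!: integrable_divide i2 simp: l2_dist_def sp mult.commute)
      finally show ?thesis .
    qed
    have "\<forall>\<^sub>F n in sequentially. ?d n < \<delta> * (e / 2)"
      by (rule order_tendstoD(2)[OF d]) (use dl e in simp)
    then obtain N where N: "\<And>n. n \<ge> N \<Longrightarrow> ?d n < \<delta> * (e / 2)" unfolding eventually_sequentially by blast
    show "\<exists>N. \<forall>n\<ge>N. norm (a n - 0) < e"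
    proof (intro exI[of _ N] allI impI)
      fix n assume "n \<ge> N"
      then have "?d n / \<delta> < e / 2" using N[of n] dl by (simp add: pos_divide_less_eq mult.commute)
      moreover have "\<delta> * measure (mu x) UNIV \<le> e / 2"
        unfolding dl(2)[symmetric] using m dl by (intro mult_left_mono) auto
      ultimately show "norm (a n - 0) < e" using le[of n] a0[of n] unfolding real_norm_def by linarith
    qed
  qed
  have Ip: "(\<lambda>n. \<integral>t. poly (p n) t \<partial>mu x) \<longlonglongrightarrow> measure (mu x) S"
  proof (rule LIM_zero_cancel, rule Lim_null_comparison[OF _ a], rule always_eventually, rule allI)
    fix n
    have "(\<integral>t. poly (p n) t \<partial>mu x) - measure (mu x) S = (\<integral>t. poly (p n) t - indicator S t \<partial>mu x)"
      unfolding iS[symmetric] by (rule Bochner_Integration.integral_diff[symmetric, OF pi ii])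
    then show "norm ((\<integral>t. poly (p n) t \<partial>mu x) - measure (mu x) S) \<le> a n"
      unfolding a_def by (simp add: integral_abs_bound)
  qed
  have "(\<lambda>n. Re (cinner (op_p (p n) x) x)) \<longlonglongrightarrow> Re (cinner (pvm S x) x)"
    by (intro tendsto_Re tendsto_cinner tendsto_const pvm_tendsto[OF S p])
  then show "Re (cinner (pvm S x) x) = measure (mu x) S" using Ip LIMSEQ_unique unfolding mu(2) by blast
  have I2: "(\<lambda>n. \<integral>t. poly (p n * p n) t \<partial>mu x) \<longlonglongrightarrow> measure (mu x) S"
  proof (rule LIM_zero_cancel, rule Lim_null_comparison[of _ "\<lambda>n. ?d n + 2 * a n"])
    have "(\<lambda>n. ?d n + 2 * a n) \<longlonglongrightarrow> 0 + 2 * 0" by (intro tendsto_intros d a)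
    then show "(\<lambda>n. ?d n + 2 * a n) \<longlonglongrightarrow> 0" by simp
    show "\<forall>\<^sub>F n in sequentially. norm ((\<integral>t. poly (p n * p n) t \<partial>mu x) - measure (mu x) S) \<le> ?d n + 2 * a n"
    proof (rule always_eventually, rule allI)
      fix n
      have "(\<integral>t. poly (p n * p n) t \<partial>mu x) - measure (mu x) S = (\<integral>t. poly (p n * p n) t - indicator S t \<partial>mu x)"
        unfolding iS[symmetric] by (rule Bochner_Integration.integral_diff[symmetric, OF pi ii])
      also have "norm \<dots> \<le> (\<integral>t. \<bar>poly (p n * p n) t - indicator S t\<bar> \<partial>mu x)" by (simp add: integral_abs_bound)
      also have "\<dots> \<le> (\<integral>t. (poly (p n) t - indicator S t)\<^sup>2 + 2 * \<bar>poly (p n) t - indicator S t\<bar> \<partial>mu x)"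
      proof (rule integral_mono[OF ia])
        fix t
        \<comment> \<open>For an indicator value a, which is 0 or 1, p^2 - a = (p - a)^2 + 2 a (p -
          a).\<close>
        have "poly (p n * p n) t - indicator S t
            = (poly (p n) t - indicator S t)\<^sup>2 + 2 * (indicator S t * (poly (p n) t - indicator S t))"
          by (auto simp: indicator_def power2_eq_square algebra_simps)
        also have "\<bar>\<dots>\<bar> \<le> \<bar>(poly (p n) t - indicator S t)\<^sup>2\<bar> + \<bar>2 * (indicator S t * (poly (p n) t - indicator S t))\<bar>"
          by (rule abs_triangle_ineq)
        also have "\<dots> \<le> (poly (p n) t - indicator S t)\<^sup>2 + 2 * \<bar>poly (p n) t - indicator S t\<bar>"
        proof -
          have "\<bar>2 * (indicator S t * z)\<bar> \<le> 2 * \<bar>z\<bar>" for z :: real by (simp add: indicator_def abs_mult)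
          then show ?thesis by simp
        qed
        finally show "\<bar>poly (p n * p n) t - indicator S t\<bar>
            \<le> (poly (p n) t - indicator S t)\<^sup>2 + 2 * \<bar>poly (p n) t - indicator S t\<bar>" .
      qed (intro Bochner_Integration.integrable_add integrable_mult_right i2 ia)
      also have "\<dots> = ?d n + 2 * a n"
        by (subst Bochner_Integration.integral_add) (auto intro!: integrable_mult_right i2 ia simp: l2_dist_def a_def)
      finally show "norm ((\<integral>t. poly (p n * p n) t \<partial>mu x) - measure (mu x) S) \<le> ?d n + 2 * a n" .
    qed
  qed
  have "(\<lambda>n. (norm (op_p (p n) x))\<^sup>2) \<longlonglongrightarrow> (norm (pvm S x))\<^sup>2"
    by (intro tendsto_intros pvm_tendsto[OF S p])
  then show "(norm (pvm S x))\<^sup>2 = measure (mu x) S" using I2 LIMSEQ_unique unfolding mu(2) op_square by blast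
qed

lemma pvm_UNIV: "pvm UNIV x = x"
proof -
  have "approximates (\<lambda>_. 1) UNIV x" by (simp add: approximates_def l2_dist_def)
  from pvm_tendsto[OF _ this] show ?thesis by (simp add: LIMSEQ_const_iff)
qed

lemma norm_pvm_le:
  assumes S: "S \<in> sets borel" shows "norm (pvm S x) \<le> norm x"
proof -
  interpret unit_measure "mu x" by (rule mu)
  have sp: "space (mu x) = UNIV" using sets_eq_imp_space_eq[OF sets_borel] by simp
  have "measure (mu x) S \<le> measure (mu x) UNIV" using bounded_measure[of S] by (simp add: sp)
  then have "(norm (pvm S x))\<^sup>2 \<le> (norm x)\<^sup>2" using pvm_form(2)[OF S, of x] pvm_form(2)[of UNIV x] by (simp add: pvm_UNIV)
  then show ?thesis by (rule power2_le_imp_le) simp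
qed

text \<open>\<open>B\<close> measures the failure of idempotence. Its form vanishes by
  \<open>pvm_form\<close>, and testing at \<open>x + B x\<close> shows that a symmetric operator
  with vanishing form is zero.\<close>

lemma pvm_projection:
  assumes S: "S \<in> sets borel" shows "orthogonal_projection (pvm S)"
proof -
  have bc: "bounded_clinear (pvm S)"
    by (rule bounded_clinearI[where K = 1]) (use pvm_add[OF S] pvm_scaleC[OF S] norm_pvm_le[OF S] in auto)
  define B where "B x = pvm S (pvm S x) - pvm S x" for x
  have Bs: "cinner (B x) y = cinner x (B y)" for x y by (simp add: B_def cinner_diff_left cinner_diff_right pvm_sym[OF S])
  have Bc: "bounded_clinear B" unfolding B_def by (intro bounded_clinear_diff_op bounded_clinear_compose[OF bc bc] bc)
  have B0: "Re (cinner (B x) x) = 0" for x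
  proof -
    have "Re (cinner (pvm S (pvm S x)) x) = (norm (pvm S x))\<^sup>2" by (simp add: pvm_sym[OF S] norm_sq_eq_cinner)
    then show ?thesis by (simp add: B_def cinner_diff_left pvm_form[OF S])
  qed
  have "B x = 0" for x
  proof -
    have "Re (cinner (B (x + B x)) (x + B x)) = 2 * Re (cinner (B x) (B x)) + Re (cinner (B x) x) + Re (cinner (B (B x)) (B x))"
      by (simp add: bounded_clinear_add[OF Bc] cinner_add_left cinner_add_right Bs[of "B x" x])
    then have "(norm (B x))\<^sup>2 = 0" by (simp add: B0 norm_sq_eq_cinner)
    then show ?thesis by simp
  qed
  then have "pvm S \<circ> pvm S = pvm S" by (auto simp: B_def)
  then show ?thesis unfolding orthogonal_projection_def selfadjoint_iff using bc pvm_sym[OF S] by blast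
qed

lemma pvm_union:
  assumes S: "S \<in> sets borel" and R: "R \<in> sets borel" and disj: "S \<inter> R = {}"
  shows "pvm (S \<union> R) x = pvm S x + pvm R x"
proof -
  interpret unit_measure "mu x" by (rule mu)
  obtain p where p: "approximates p S x" using approximates_exists[of "{x}" S] S by auto
  obtain q where q: "approximates q R x" using approximates_exists[of "{x}" R] R by auto
  have "approximates (\<lambda>n. p n + q n) (S \<union> R) x"
    unfolding approximates_def
  proof (rule Lim_null_comparison)
    show "\<forall>\<^sub>F n in sequentially. norm (l2_dist (mu x) (poly (p n + q n)) (indicator (S \<union> R)))
        \<le> 2 * l2_dist (mu x) (poly (p n)) (indicator S) + 2 * l2_dist (mu x) (poly (q n)) (indicator R)"
      using l2_dist_poly_union[OF S R disj] l2_dist_nonneg by (auto intro!: always_eventually)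
    have "(\<lambda>n. 2 * l2_dist (mu x) (poly (p n)) (indicator S) + 2 * l2_dist (mu x) (poly (q n)) (indicator R)) \<longlonglongrightarrow> 2 * 0 + 2 * 0"
      using p q unfolding approximates_def by (intro tendsto_intros)
    then show "(\<lambda>n. 2 * l2_dist (mu x) (poly (p n)) (indicator S) + 2 * l2_dist (mu x) (poly (q n)) (indicator R)) \<longlonglongrightarrow> 0" by simp
  qed
  then have "(\<lambda>n. op_p (p n + q n) x) \<longlonglongrightarrow> pvm (S \<union> R) x" using S R by (intro pvm_tendsto) auto
  moreover have "(\<lambda>n. op_p (p n + q n) x) \<longlonglongrightarrow> pvm S x + pvm R x"
    unfolding op_add by (intro tendsto_add pvm_tendsto S R p q)
  ultimately show ?thesis by (rule LIMSEQ_unique)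
qed

text \<open>The remainder after n terms is the projection over the union of the tail. The square of
  its norm is the measure of that union, which tends to zero because the tails shrink to the empty
  set.\<close>

lemma pvm_sums:
  fixes F :: "nat \<Rightarrow> real set"
  assumes F: "range F \<subseteq> sets borel" "disjoint_family F"
  shows "(\<lambda>n. pvm (F n) x) sums pvm (\<Union>n. F n) x"
proof -
  interpret unit_measure "mu x" by (rule mu)
  have Fb: "F n \<in> sets borel" for n using F(1) by auto
  have dj: "k = l" if "t \<in> F k" "t \<in> F l" for t k l
    using F(2) that unfolding disjoint_family_on_def by blast
  have e0: "pvm {} x = 0" using pvm_union[of "{}" "{}" x] by simp
  have fin: "(\<Sum>k<n. pvm (F k) x) = pvm (\<Union>k<n. F k) x" for n
  proof (induction n)
    case (Suc n)
    have "(\<Union>k<n. F k) \<inter> F n = {}" by (auto dest: dj)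
    then have "pvm ((\<Union>k<n. F k) \<union> F n) x = pvm (\<Union>k<n. F k) x + pvm (F n) x" using Fb by (intro pvm_union) auto
    then show ?case using Suc by (simp add: lessThan_Suc Un_commute)
  qed (simp add: e0)
  have rest: "pvm (\<Union>n. F n) x - (\<Sum>k<n. pvm (F k) x) = pvm (\<Union>k\<in>{n..}. F k) x" for n
  proof -
    have "(\<Union>k<n. F k) \<inter> (\<Union>k\<in>{n..}. F k) = {}" by (auto dest: dj)
    then have "pvm ((\<Union>k<n. F k) \<union> (\<Union>k\<in>{n..}. F k)) x = pvm (\<Union>k<n. F k) x + pvm (\<Union>k\<in>{n..}. F k) x"
      using Fb by (intro pvm_union) auto
    moreover have "(\<Union>k<n. F k) \<union> (\<Union>k\<in>{n..}. F k) = (\<Union>n. F n)"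
    proof -
      have "{..<n} \<union> {n..} = (UNIV :: nat set)" by auto
      then show ?thesis by (metis UN_Un)
    qed
    ultimately show ?thesis by (simp add: fin)
  qed
  have "(\<lambda>n. measure (mu x) (\<Union>k\<in>{n..}. F k)) \<longlonglongrightarrow> measure (mu x) (\<Inter>n. \<Union>k\<in>{n..}. F k)"
    by (rule finite_Lim_measure_decseq) (use Fb in \<open>auto simp: decseq_def intro: order_trans\<close>)
  moreover have "(\<Inter>n. \<Union>k\<in>{n..}. F k) = {}"
  proof -
    have False if t: "t \<in> (\<Inter>n. \<Union>k\<in>{n..}. F k)" for t
    proof -
      obtain k where k: "t \<in> F k" using t by blast
      obtain l where "l \<ge> Suc k" "t \<in> F l" using t by blast
      then show False using dj[OF k] by fastforce
    qed
    then show ?thesis by blast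
  qed
  ultimately have "(\<lambda>n. (norm (pvm (\<Union>n. F n) x - (\<Sum>k<n. pvm (F k) x)))\<^sup>2) \<longlonglongrightarrow> 0"
    unfolding rest using Fb by (subst pvm_form) auto
  then have "(\<lambda>n. sqrt ((norm (pvm (\<Union>n. F n) x - (\<Sum>k<n. pvm (F k) x)))\<^sup>2)) \<longlonglongrightarrow> sqrt 0" by (rule tendsto_real_sqrt)
  then have "(\<lambda>n. pvm (\<Union>n. F n) x - (\<Sum>k<n. pvm (F k) x)) \<longlonglongrightarrow> 0" by (simp add: tendsto_norm_zero_iff)
  from tendsto_diff[OF tendsto_const[of "pvm (\<Union>n. F n) x"] this] show ?thesis by (simp add: sums_def)
qed

lemma pvm_unit: "pvm {0..1} x = x"
proof -
  interpret unit_measure "mu x" by (rule mu)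
  have "l2_dist (mu x) (poly 1) (indicator {0..1}) = 0"
    unfolding l2_dist_def by (rule integral_eq_zero_AE) (use AE_unit in \<open>eventually_elim, simp add: indicator_def\<close>)
  then have "approximates (\<lambda>_. 1) {0..1} x" by (simp add: approximates_def)
  from pvm_tendsto[OF _ this] show ?thesis by (simp add: LIMSEQ_const_iff)
qed

end

theorem spectral_measure_exists:
  fixes H :: "'a::complex_hilbert \<Rightarrow> 'a"
  assumes H: "selfadjoint H"
  shows "\<exists>E. spectral_measure_of H E"
proof -
  note Hc = selfadjointD(1)[OF H] and Hs = selfadjointD(2)[OF H]
  obtain r where r: "r > 0" "\<And>x. norm (H x) \<le> r * norm x" using bounded_clinear_bound[OF Hc] by blast
  \<comment> \<open>This affine change moves the interval from -r to r, which carries the spectrum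
    of \<open>H\<close>, onto the unit interval; \<open>\<phi>\<close> below is the inverse
    map.\<close>
  define T where "T x = (1 / (2 * r)) *\<^sub>R (H x + r *\<^sub>R x)" for x
  have TH: "2 * r * Re (cinner (T x) x) = Re (cinner (H x) x) + r * (norm x)\<^sup>2" for x
    using r by (simp add: T_def cinner_scaleR_left cinner_add_left norm_sq_eq_cinner)
  have Hb: "\<bar>Re (cinner (H x) x)\<bar> \<le> r * (norm x)\<^sup>2" for x
  proof -
    have "\<bar>Re (cinner (H x) x)\<bar> \<le> norm (H x) * norm x"
      using abs_Re_le_cmod[of "cinner (H x) x"] cinner_cauchy_schwarz[of "H x" x] by linarith
    also have "\<dots> \<le> r * norm x * norm x" by (intro mult_right_mono r) simp
    finally show ?thesis by (simp add: power2_eq_square)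
  qed
  interpret effect_operator T
  proof
    show "selfadjoint T" unfolding selfadjoint_iff
    proof (intro conjI allI)
      show "bounded_clinear T" unfolding T_def
        by (intro bounded_clinear_scaleR_op bounded_clinear_add_op Hc) simp
      show "cinner (T x) y = cinner x (T y)" for x y
        by (simp add: T_def cinner_scaleR_left cinner_scaleR_right cinner_add_left cinner_add_right Hs)
    qed
    fix x
    have "0 \<le> 2 * r * Re (cinner (T x) x)" unfolding TH using Hb[of x] by linarith
    then show "0 \<le> Re (cinner (T x) x)" using r by (simp add: zero_le_mult_iff)
    have "2 * r * Re (cinner (T x) x) \<le> 2 * r * (norm x)\<^sup>2" unfolding TH using Hb[of x] by linarith
    then show "Re (cinner (T x) x) \<le> (norm x)\<^sup>2" using r by simp
  qed
  define \<phi> where "\<phi> t = 2 * r * t - r" for t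
  have phi [measurable]: "\<phi> \<in> borel_measurable borel" unfolding \<phi>_def by measurable
  have phiS: "\<phi> -` S \<in> sets borel" if "S \<in> sets borel" for S
    using measurable_sets[OF phi that] by simp
  define E where "E S = pvm (\<phi> -` S)" for S
  have "spectral_measure_of H E"
    unfolding spectral_measure_of_def
  proof (intro conjI allI ballI impI)
    show "orthogonal_projection (E S)" if "S \<in> sets borel" for S
      unfolding E_def by (rule pvm_projection[OF phiS[OF that]])
    show "E UNIV = id" by (auto simp: E_def pvm_UNIV)
    show "(\<lambda>n. E (F n) x) sums E (\<Union>n. F n) x" if F: "range F \<subseteq> sets borel" "disjoint_family F" for F :: "nat \<Rightarrow> real set" and x
      unfolding E_def vimage_UN
      by (rule pvm_sums) (use F phiS in \<open>auto simp: disjoint_family_on_def\<close>)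
    have "\<phi> -` {-r..r} = {0..1}"
    proof -
      have "- r \<le> \<phi> t \<longleftrightarrow> 0 \<le> t" "\<phi> t \<le> r \<longleftrightarrow> t \<le> 1" for t
        using r(1) mult_le_cancel_left_pos[of "2 * r" t 1] by (auto simp: \<phi>_def zero_le_mult_iff)
      then show ?thesis by auto
    qed
    then show "\<exists>r. E {-r..r} = id" by (intro exI[of _ r]) (auto simp: E_def pvm_unit)
    fix x
    interpret unit_measure "mu x" by (rule mu)
    have sp: "space (mu x) = UNIV" using sets_eq_imp_space_eq[OF sets_borel] by simp
    \<comment> \<open>The scalar measures of \<open>E\<close> are images of the moment measures
      under \<open>\<phi>\<close>, so the integral of the identity becomes that of a polynomial of
      degree one, which is a known moment.\<close>
    have "scalar_measure E x = distr (mu x) borel \<phi>"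
    proof -
      have "scalar_measure E x = measure_of UNIV (sets borel) (emeasure (distr (mu x) borel \<phi>))"
        unfolding scalar_measure_def
      proof (rule measure_of_eq)
        fix S assume "S \<in> sigma_sets UNIV (sets (borel :: real measure))"
        then have S: "S \<in> sets borel" using sets.sigma_sets_eq[of "borel :: real measure"] by simp
        have "emeasure (distr (mu x) borel \<phi>) S = emeasure (mu x) (\<phi> -` S)"
          using S by (subst emeasure_distr) (auto simp: sp)
        then show "ennreal (Re (cinner (E S x) x)) = emeasure (distr (mu x) borel \<phi>) S"
          by (simp add: E_def pvm_form[OF phiS[OF S]] emeasure_eq_measure)
      qed simp
      also have "\<dots> = distr (mu x) borel \<phi>"
        using measure_of_of_measure[of "distr (mu x) borel \<phi>"] by simp
      finally show ?thesis .
    qed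
    then have "(\<integral>t. t \<partial>scalar_measure E x) = (\<integral>t. \<phi> t \<partial>mu x)"
      by (simp add: integral_distr)
    also have "\<dots> = (\<integral>t. poly [:- r, 2 * r:] t \<partial>mu x)" by (simp add: \<phi>_def algebra_simps)
    also have "\<dots> = 2 * r * Re (cinner (T x) x) - r * (norm x)\<^sup>2"
      unfolding mu(2) by (simp add: cinner_add_left cinner_diff_left cinner_scaleR_left norm_sq_eq_cinner
          bounded_clinear_scaleR[OF T_clinear] bounded_clinear_zero[OF T_clinear])
    also have "\<dots> = Re (cinner (H x) x)" by (simp add: TH)
    finally show "cinner (H x) x = complex_of_real (\<integral>t. t \<partial>scalar_measure E x)"
      using selfadjoint_cinner_real[OF H] by simp
  qed
  then show ?thesis by blast
qed


section \<open>The bounded real lemma\<close>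

theorem theorem7p1:
  fixes A :: "'x::complex_hilbert \<Rightarrow> 'x"
    and B :: "'u::complex_hilbert \<Rightarrow> 'x"
    and C :: "'x \<Rightarrow> 'y::complex_hilbert"
    and D :: "'u \<Rightarrow> 'y"
  assumes "bounded_clinear A" and "bounded_clinear B"
    and "bounded_clinear C" and "bounded_clinear D"
    and "has_dichotomy A"
    and "dichotomously_exactly_controllable A B"
    and "dichotomously_exactly_observable A C"
  shows "(transfer_norm A B C D \<le> 1 \<longleftrightarrow>
          (\<exists>H. selfadjoint H \<and> boundedly_invertible H \<and> KYP_inequality A B C D H))
    \<and> (\<forall>H. selfadjoint H \<and> boundedly_invertible H \<and> KYP_inequality A B C D H \<longrightarrow>
          (hilbert_dim (X_plus A), hilbert_dim (spectral_subspace H {0<..})) \<in> ordIso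
        \<and> (hilbert_dim (X_minus A), hilbert_dim (spectral_subspace H {..<0})) \<in> ordIso)"
proof -
  note cl = assms(1-4) and dich = assms(5) and ctrl = assms(6) and obs = assms(7)
  obtain J K \<rho> where exp: "exp_dichotomy A (riesz_projection A) J K \<rho>"
    using dichotomy_imp_exp_dichotomy[OF cl(1) dich] by blast
  interpret riesz_system A "riesz_projection A" J K \<rho> B C D
    by (intro riesz_system.intro dichotomous_system.intro dichotomous_system_axioms.intro
        riesz_system_axioms.intro exp cl refl)
  have KYP: "KYP_inequality A B C D H \<longleftrightarrow>
      (\<forall>x v. Re (cinner (H (A x + B v)) (A x + B v)) + (norm (C x + D v))\<^sup>2 \<le> Re (cinner (H x) x) + (norm v)\<^sup>2)"
    if "selfadjoint H" for H
    by (rule KYP_inequality_iff[OF cl that])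
  have "transfer_norm A B C D \<le> 1 \<longleftrightarrow>
      (\<exists>H. selfadjoint H \<and> boundedly_invertible H \<and> KYP_inequality A B C D H)"
    unfolding transfer_norm_le_1_iff[OF cl dich]
  proof
    assume "\<forall>z v. cmod z = 1 \<longrightarrow> norm (transfer_function A B C D z v) \<le> norm v"
    then show "\<exists>H. selfadjoint H \<and> boundedly_invertible H \<and> KYP_inequality A B C D H"
      by (intro contractive_imp_KYP dich ctrl obs) blast
  next
    assume "\<exists>H. selfadjoint H \<and> boundedly_invertible H \<and> KYP_inequality A B C D H"
    then obtain H where H: "selfadjoint H" "KYP_inequality A B C D H" by blast
    show "\<forall>z v. cmod z = 1 \<longrightarrow> norm (transfer_function A B C D z v) \<le> norm v"
      using KYP_imp_contractive[OF cl(1) dich selfadjointD(1)[OF H(1)] _ _ cl(3)] H(2) unfolding KYP[OF H(1)] by blast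
  qed
  \<comment> \<open>The definiteness estimate holds for every solution \<open>H\<close>, not just
    for the available storage, so the dimension count covers each of them.\<close>
  moreover have "(hilbert_dim (X_plus A), hilbert_dim (spectral_subspace H {0<..})) \<in> ordIso
      \<and> (hilbert_dim (X_minus A), hilbert_dim (spectral_subspace H {..<0})) \<in> ordIso"
    if H: "selfadjoint H" "KYP_inequality A B C D H" for H
  proof -
    obtain c where "c > 0" "\<And>x. x \<in> X_plus A \<Longrightarrow> c * (norm x)\<^sup>2 \<le> Re (cinner (H x) x)"
      "\<And>x. x \<in> X_minus A \<Longrightarrow> c * (norm x)\<^sup>2 \<le> - Re (cinner (H x) x)"
      using KYP_definite[OF H(1) _ obs] H(2) unfolding KYP[OF H(1)] by blast
    then show ?thesis using inertia[OF spectral_measure_exists[OF H(1)]] by blast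
  qed
  ultimately show ?thesis by blast
qed

end
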